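(* Let $F_{\mathrm T}<1$ be a threshold fidelity, $\alpha>0$ a maximal failure probability, and $0<\varepsilon\le(1-F_{\mathrm T})/2$ an estimation error. Let $\varrho_{\mathrm t}=\hat U|\mathbf 0\rangle\langle\mathbf 0|\hat U^\dagger$ be an $m$-mode pure Gaussian state ($\hat U$ a Gaussian unitary) with maximum single-mode squeezing $s_{\max}\ge1$, mode range $d\le m$, and displacement $\mathbf x\in\mathbb R^{2m}$, and put $\kappa:=2\min\{d^2,m\}$. Then test $\mathcal T$ (described in the context) is a certification test for $\varrho_{\mathrm t}$: with probability at least $1-\alpha$, it both rejects every preparation $\varrho_{\mathrm p}$ for which $F(\varrho_{\mathrm t},\varrho_{\mathrm p})<F_{\mathrm T}$ and accepts $\varrho_{\mathrm p}=\varrho_{\mathrm t}$. Moreover, $\mathcal T$ requires at most $$O\!\left(\frac{s_{\max}^4\left(2\sigma_1^2\|\mathbf x\|_2^2\,m^3+\sigma_2^2\kappa^3m^4\right)}{\varepsilon^2\ln\left(1/(1-\alpha)\right)}\right)$$ copies of a preparation $\varrho_{\mathrm p}$ with first and second variance bounds $\sigma_1>0$ and $\sigma_2>0$, respectively.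
   Context: Fidelity. For the pure state $\varrho_{\mathrm t}$, $F(\varrho_{\mathrm t},\varrho_{\mathrm p})=\operatorname{Tr}[\varrho_{\mathrm t}\varrho_{\mathrm p}]$. A preparation is an $m$-mode state $\varrho_{\mathrm p}$, of which independent identical copies are supplied. Certification test. A test takes as input a classical description of $\varrho_{\mathrm t}$ and copies of $\varrho_{\mathrm p}$ and outputs "accept" or "reject". It is a certification test for $\varrho_{\mathrm t}$ if, with probability at least $1-\alpha$, it both rejects every $\varrho_{\mathrm p}$ with $F(\varrho_{\mathrm t},\varrho_{\mathrm p})<F_{\mathrm T}$ and accepts $\varrho_{\mathrm p}=\varrho_{\mathrm t}$. Modes and quadratures. There are $m$ bosonic modes with annihilation operators $\hat a_j$, $[\hat a_j,\hat a_{j'}^\dagger]=\delta_{jj'}$, vacuum $|\mathbf 0\rangle$, and $\hat n_j=\hat a_j^\dagger\hat a_j$. The quadratures are $\hat q_j=(\hat a_j+\hat a_j^\dagger)/2$ and $\hat p_j=(\hat a_j-\hat a_j^\dagger)/(2\mathrm i)$, so that $\hat n_j=\hat q_j^2+\hat p_j^2-1/2$. They are collected in $\hat{\mathbf r}$ with $\hat r_{2j-1}=\hat q_j$, $\hat r_{2j}=\hat p_j$. Gaussian unitary. $\hat U^\dagger\hat{\mathbf r}\hat U=\mathbf S\hat{\mathbf r}+\mathbf x$ with $\mathbf S\in\mathrm{Sp}(2m,\mathbb R)$ and displacement $\mathbf x\in\mathbb R^{2m}$. By the Euler decomposition, and because passive transformations fix the vacuum, one may take $\mathbf S=\mathbf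 O\mathbf D$ with $\mathbf O$ orthogonal (passive) and $\mathbf D$ diagonal, $D_{2j-1,2j-1}=s_j\ge1$, $D_{2j,2j}=s_j^{-1}$; $s_{\max}:=\max_js_j$. The mode range $d\le m$ is the maximal number of input modes to which each output mode is coupled; in terms of the columns $\mathbf o^{(k)}$ of $\mathbf O$: for every $j$, $\mathbf o^{(2j-1)}$ and $\mathbf o^{(2j)}$ have at least $2(m-d)$ zero entries in common. Variance bounds. $\sigma_i^2$ is a uniform upper bound on the variances, in the state $\varrho_{\mathrm p}$, of any product of $i$ quadratures (the products relevant here are $\hat r_l$ for $i=1$ and $(\hat r_l\hat r_{l'}+\hat r_{l'}\hat r_l)/2$ for $i=2$). Moments and fidelity bound. $\gamma_l:=\operatorname{Tr}[\varrho_{\mathrm p}\hat r_l]$, $\Gamma^{(1)}_{l,l'}:=\operatorname{Tr}[\varrho_{\mathrm p}(\hat r_l\hat r_{l'}+\hat r_{l'}\hat r_l)/2]$, and $$F^{(0)}:=1-\operatorname{Tr}\left[\mathbf O\mathbf D^{-2}\mathbf O^T\left(\boldsymbol\Gamma^{(1)}-(2\boldsymbol\gamma-\mathbf x)\mathbf x^T\right)\right]+\frac m2,$$ which equals $1-\operatorname{Tr}[\hat n\,\hat U^\dagger\varrho_{\mathrm p}\hat U]$ with $\hat n=\sum_j\hat n_j$. Test $\mathcal T$. Let $C_1,C_2$ be the smallest positive integers with $$C_1\ge 2^6\frac{\sigma_1^2(2m+1)\,m\,s_{\max}^4\|\mathbf x\|_2^2}{\varepsilon^2\ln(1/(1-\alpha))},\qquad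 C_2\ge2^5\frac{\sigma_2^2(2\kappa m+1)\,m^2s_{\max}^4\kappa}{\varepsilon^2\ln(1/(1-\alpha))}.$$ For each $l\in\{1,\dots,2m\}$, measure $\hat r_l$ on $C_1$ copies of $\varrho_{\mathrm p}$ and let $\gamma^*_l$ be the average of the outcomes. For each $l\le l'$ with $(\mathbf O\mathbf D^{-2}\mathbf O^T)_{l,l'}\ne0$, measure $(\hat r_l\hat r_{l'}+\hat r_{l'}\hat r_l)/2$ on $C_2$ further copies and let $\Gamma^{(1)*}_{l,l'}=\Gamma^{(1)*}_{l',l}$ be the average of the outcomes. All outcomes are independent. Let $F^{(0)*}$ be $F^{(0)}$ with $\boldsymbol\gamma,\boldsymbol\Gamma^{(1)}$ replaced by $\boldsymbol\gamma^*,\boldsymbol\Gamma^{(1)*}$ (the other entries of $\boldsymbol\Gamma^{(1)}$ do not enter). Reject if $F^{(0)*}<F_{\mathrm T}+\varepsilon$; otherwise accept.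
   Formalization: The O-bound is proved uniformly for ε² ln(1/(1−α)) ≤ B, for each B, with a constant depending on B: as α→1 the stated bound tends to 0 while at least 2m copies are always used. *)

theory Defs
  imports
    "HOL-Probability.Probability"
    "HOL-Library.Landau_Symbols"
    "Jordan_Normal_Form.Matrix"
begin

section \<open>Fock space of finitely many bosonic modes\<close>

text \<open>
  The Hilbert space of \<open>m\<close> modes is the space of square-summable functions of the occupation
  numbers of the modes \<open>0, \<dots>, m - 1\<close>. The number of modes is a natural number and not a type,
  because the copy count is bounded uniformly in it. An occupation pattern vanishes at all
  indices \<open>\<ge> m\<close>, and a state vector vanishes at all other patterns. Operators are functions on all
  \<open>wave\<close>s; only their values on \<open>fock m\<close> (bounded operators) matter.
\<close>

type_synonym occ = "nat \<Rightarrow> nat"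
type_synonym wave = "occ \<Rightarrow> complex"
type_synonym op = "wave \<Rightarrow> wave"

definition occs :: "nat \<Rightarrow> occ set" where
  "occs m = {n. \<forall>j\<ge>m. n j = 0}"

definition fock :: "nat \<Rightarrow> wave set" where
  "fock m = {\<psi>. (\<forall>n. n \<notin> occs m \<longrightarrow> \<psi> n = 0) \<and> (\<lambda>n. (cmod (\<psi> n))\<^sup>2) summable_on UNIV}"

definition finite_fock :: "nat \<Rightarrow> wave set" where
  "finite_fock m = {\<psi> \<in> fock m. finite {n. \<psi> n \<noteq> 0}}"

definition braket :: "wave \<Rightarrow> wave \<Rightarrow> complex" where
  "braket \<phi> \<psi> = (\<Sum>\<^sub>\<infinity>n. cnj (\<phi> n) * \<psi> n)"

definition ket :: "occ \<Rightarrow> wave" where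
  "ket n = (\<lambda>k. of_bool (k = n))"

definition vacuum :: wave where
  "vacuum = ket (\<lambda>_. 0)"

definition ketbra :: "wave \<Rightarrow> wave \<Rightarrow> op" where
  "ketbra \<phi> \<psi> = (\<lambda>\<eta> n. braket \<psi> \<eta> * \<phi> n)"

definition bounded_op :: "nat \<Rightarrow> op \<Rightarrow> bool" where
  "bounded_op m T \<longleftrightarrow>
     (\<forall>\<psi>\<in>fock m. T \<psi> \<in> fock m) \<and>
     (\<forall>\<psi>\<in>fock m. \<forall>\<phi>\<in>fock m. \<forall>a b.
        T (\<lambda>n. a * \<psi> n + b * \<phi> n) = (\<lambda>n. a * T \<psi> n + b * T \<phi> n)) \<and>
     (\<exists>K. \<forall>\<psi>\<in>fock m. sqrt (Re (braket (T \<psi>) (T \<psi>))) \<le> K * sqrt (Re (braket \<psi> \<psi>)))"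

definition unitary_op :: "nat \<Rightarrow> op \<Rightarrow> bool" where
  "unitary_op m U \<longleftrightarrow>
     bounded_op m U \<and> U ` fock m = fock m \<and>
     (\<forall>\<phi>\<in>fock m. \<forall>\<psi>\<in>fock m. braket (U \<phi>) (U \<psi>) = braket \<phi> \<psi>)"

definition projection_op :: "nat \<Rightarrow> op \<Rightarrow> bool" where
  "projection_op m T \<longleftrightarrow>
     bounded_op m T \<and> (\<forall>\<psi>\<in>fock m. T (T \<psi>) = T \<psi>) \<and>
     (\<forall>\<phi>\<in>fock m. \<forall>\<psi>\<in>fock m. braket \<phi> (T \<psi>) = braket (T \<phi>) \<psi>)"

definition trace_op :: "nat \<Rightarrow> op \<Rightarrow> complex" where
  "trace_op m T = (\<Sum>\<^sub>\<infinity>n\<in>occs m. braket (ket n) (T (ket n)))"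

definition density_op :: "nat \<Rightarrow> op \<Rightarrow> bool" where
  "density_op m \<rho> \<longleftrightarrow>
     bounded_op m \<rho> \<and>
     (\<forall>\<psi>\<in>fock m. Im (braket \<psi> (\<rho> \<psi>)) = 0 \<and> 0 \<le> Re (braket \<psi> (\<rho> \<psi>))) \<and>
     trace_op m \<rho> = 1"

text \<open>The first argument is the pure target state.\<close>

definition fidelity :: "nat \<Rightarrow> op \<Rightarrow> op \<Rightarrow> real" where
  "fidelity m \<rho>t \<rho> = Re (trace_op m (\<rho>t \<circ> \<rho>))"

section \<open>Quadratures\<close>

text \<open>
  Each occupation pattern is coupled to finitely many others by a polynomial in the ladder
  operators, so such a polynomial acts entrywise on every function of the occupation
  numbers. The corresponding unbounded operator is its restriction to the vectors of \<open>fock m\<close>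
  that it maps into \<open>fock m\<close>. For the quadratures and their symmetrised products of degree two this
  is the closure of the restriction to \<^term>\<open>finite_fock m\<close>, and it is self-adjoint.
\<close>

definition annihilate :: "nat \<Rightarrow> op" where
  "annihilate j \<psi> = (\<lambda>n. complex_of_real (sqrt (real (n j + 1))) * \<psi> (n(j := n j + 1)))"

definition create :: "nat \<Rightarrow> op" where
  "create j \<psi> = (\<lambda>n. complex_of_real (sqrt (real (n j))) * \<psi> (n(j := n j - 1)))"

text \<open>Modes and quadratures are numbered from \<open>0\<close>: index \<open>2 * j\<close> is the position and index \<open>2 * j + 1\<close>
  the momentum of mode \<open>j\<close>.\<close>

definition quadrature :: "nat \<Rightarrow> op" where
  "quadrature l \<psi> =
     (if even l then (\<lambda>n. (annihilate (l div 2) \<psi> n + create (l div 2) \<psi> n) / 2)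
      else (\<lambda>n. (annihilate (l div 2) \<psi> n - create (l div 2) \<psi> n) / (2 * \<i>)))"

definition sym_product :: "nat \<Rightarrow> nat \<Rightarrow> op" where
  "sym_product l l' \<psi> =
     (\<lambda>n. (quadrature l (quadrature l' \<psi>) n + quadrature l' (quadrature l \<psi>) n) / 2)"

lemma canonical_commutation:
  "annihilate j (create k \<psi>) n - create k (annihilate j \<psi>) n = of_bool (j = k) * \<psi> n"
proof (cases "j = k")
  case True
  have sq: "complex_of_real (sqrt x) * (complex_of_real (sqrt x) * z) = x * z" if "x \<ge> 0" for x z
    using that by (simp flip: mult.assoc of_real_mult)
  show ?thesis
    using True sq[of "real (n k)"] sq[of "1 + real (n k)"]
    by (cases "n k") (auto simp: annihilate_def create_def algebra_simps fun_upd_idem)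
next
  case False
  then show ?thesis
    by (simp add: annihilate_def create_def fun_upd_twist)
qed

lemma number_eq_quadratures:
  "create j (annihilate j \<psi>) n =
     quadrature (2 * j) (quadrature (2 * j) \<psi>) n
     + quadrature (2 * j + 1) (quadrature (2 * j + 1) \<psi>) n - \<psi> n / 2"
proof -
  have q: "quadrature (2 * j) = (\<lambda>\<psi> n. (annihilate j \<psi> n + create j \<psi> n) / 2)"
    and p: "quadrature (2 * j + 1) = (\<lambda>\<psi> n. (annihilate j \<psi> n - create j \<psi> n) * (- \<i> / 2))"
    by (auto simp: quadrature_def fun_eq_iff field_simps)
  have a: "annihilate j (\<lambda>n. (f n + g n) / 2) n = (annihilate j f n + annihilate j g n) / 2"
    "create j (\<lambda>n. (f n + g n) / 2) n = (create j f n + create j g n) / 2"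
    "annihilate j (\<lambda>n. (f n - g n) * c) n = (annihilate j f n - annihilate j g n) * c"
    "create j (\<lambda>n. (f n - g n) * c) n = (create j f n - create j g n) * c"
    for f g c n
    by (simp_all add: annihilate_def create_def algebra_simps add_divide_distrib)
  have c: "annihilate j (create j \<psi>) n = \<psi> n + create j (annihilate j \<psi>) n"
    using canonical_commutation[of j j \<psi> n] by (simp add: algebra_simps)
  show ?thesis
    unfolding q p a c by (simp add: field_simps)
qed

section \<open>Measurement of observables\<close>

text \<open>The outcome distribution of the observable with projection-valued measure \<open>E\<close>, in a pure
  state \<open>\<psi>\<close> and in a mixed state \<open>\<rho>\<close> (Born's rule).\<close>

definition pure_law :: "(real set \<Rightarrow> op) \<Rightarrow> wave \<Rightarrow> real measure" where
  "pure_law E \<psi> = measure_of UNIV (sets borel) (\<lambda>B. ennreal (Re (braket \<psi> (E B \<psi>))))"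

definition born_law :: "nat \<Rightarrow> (real set \<Rightarrow> op) \<Rightarrow> op \<Rightarrow> real measure" where
  "born_law m E \<rho> = measure_of UNIV (sets borel) (\<lambda>B. ennreal (Re (trace_op m (\<rho> \<circ> E B))))"

definition pvm :: "nat \<Rightarrow> (real set \<Rightarrow> op) \<Rightarrow> bool" where
  "pvm m E \<longleftrightarrow>
     (\<forall>B\<in>sets borel. projection_op m (E B)) \<and>
     (\<forall>\<psi>\<in>fock m. E UNIV \<psi> = \<psi>) \<and>
     (\<forall>\<psi>\<in>fock m. \<forall>B :: nat \<Rightarrow> real set. range B \<subseteq> sets borel \<longrightarrow> disjoint_family B \<longrightarrow>
        (\<lambda>i. braket \<psi> (E (B i) \<psi>)) sums braket \<psi> (E (\<Union>i. B i) \<psi>))"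

text \<open>
  \<open>E\<close> is the spectral measure of \<open>A\<close>, i.e. \<open>A = \<integral>x dE(x)\<close>, including equality of the domains.
  By polarisation it is enough to compare the quadratic forms on the common domain. A self-adjoint
  \<open>A\<close> has exactly one spectral measure (up to values outside \<open>fock m\<close> and on non-Borel sets).
\<close>

definition spectral_measure :: "nat \<Rightarrow> op \<Rightarrow> (real set \<Rightarrow> op) \<Rightarrow> bool" where
  "spectral_measure m A E \<longleftrightarrow>
     pvm m E \<and>
     (\<forall>\<psi>\<in>fock m. A \<psi> \<in> fock m \<longleftrightarrow> integrable (pure_law E \<psi>) (\<lambda>x. x\<^sup>2)) \<and>
     (\<forall>\<psi>\<in>fock m. A \<psi> \<in> fock m \<longrightarrow> braket \<psi> (A \<psi>) = of_real (\<integral>x. x \<partial>pure_law E \<psi>))"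

definition variance_at_most :: "real measure \<Rightarrow> real \<Rightarrow> bool" where
  "variance_at_most M v \<longleftrightarrow>
     integrable M (\<lambda>x. x\<^sup>2) \<and> (\<integral>x. (x - (\<integral>y. y \<partial>M))\<^sup>2 \<partial>M) \<le> v"

section \<open>Gaussian unitaries\<close>

definition symplectic_form :: "nat \<Rightarrow> real mat" where
  "symplectic_form m = mat (2 * m) (2 * m)
     (\<lambda>(i, k). if even i \<and> k = i + 1 then 1 else if odd i \<and> i = k + 1 then - 1 else 0)"

definition symplectic :: "nat \<Rightarrow> real mat \<Rightarrow> bool" where
  "symplectic m S \<longleftrightarrow>
     S \<in> carrier_mat (2 * m) (2 * m) \<and>
     S * symplectic_form m * transpose_mat S = symplectic_form m"

definition passive_mat :: "nat \<Rightarrow> real mat \<Rightarrow> bool" where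
  "passive_mat m R \<longleftrightarrow> symplectic m R \<and> R * transpose_mat R = 1\<^sub>m (2 * m)"

text \<open>The condition reads \<open>U\<^sup>\<dagger> r U = S r + x\<close> on the common invariant core of the quadratures.\<close>

definition gaussian_unitary :: "nat \<Rightarrow> op \<Rightarrow> real mat \<Rightarrow> real vec \<Rightarrow> bool" where
  "gaussian_unitary m U S x \<longleftrightarrow>
     unitary_op m U \<and> symplectic m S \<and> x \<in> carrier_vec (2 * m) \<and>
     (\<forall>l<2 * m. \<forall>\<psi>\<in>finite_fock m.
        quadrature l (U \<psi>) =
        U (\<lambda>n. (\<Sum>k<2 * m. of_real (S $$ (l, k)) * quadrature k \<psi> n) + of_real (x $ l) * \<psi> n))"

definition squeeze_entry :: "(nat \<Rightarrow> real) \<Rightarrow> nat \<Rightarrow> real" where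
  "squeeze_entry s i = (if even i then s (i div 2) else inverse (s (i div 2)))"

definition squeeze_mat :: "nat \<Rightarrow> (nat \<Rightarrow> real) \<Rightarrow> real mat" where
  "squeeze_mat m s = mat_diag (2 * m) (squeeze_entry s)"

definition squeeze_inv_sq :: "nat \<Rightarrow> (nat \<Rightarrow> real) \<Rightarrow> real mat" where
  "squeeze_inv_sq m s = mat_diag (2 * m) (\<lambda>i. inverse ((squeeze_entry s i)\<^sup>2))"

text \<open>
  Every symplectic matrix is of the form \<open>S = R D V\<close> with \<open>R, V\<close> passive and \<open>D\<close> a squeezing matrix. The
  factor \<open>V\<close> fixes the vacuum, so it does not influence the target state; \<open>V = 1\<close> gives the
  normal form \<open>S = R D\<close>.
\<close>

definition euler_decomposition :: "nat \<Rightarrow> real mat \<Rightarrow> real mat \<Rightarrow> (nat \<Rightarrow> real) \<Rightarrow> bool" where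
  "euler_decomposition m S R s \<longleftrightarrow>
     passive_mat m R \<and> (\<forall>j<m. 1 \<le> s j) \<and> (\<exists>V. passive_mat m V \<and> S = R * squeeze_mat m s * V)"

definition has_mode_range :: "nat \<Rightarrow> real mat \<Rightarrow> nat \<Rightarrow> bool" where
  "has_mode_range m R d \<longleftrightarrow>
     d \<le> m \<and>
     (\<forall>j<m. 2 * (m - d) \<le> card {i. i < 2 * m \<and> R $$ (i, 2 * j) = 0 \<and> R $$ (i, 2 * j + 1) = 0})"

section \<open>The test\<close>

record config =
  modes :: nat
  mode_range :: nat
  orth :: "real mat"
  squeezing :: "nat \<Rightarrow> real"
  displacement :: "real vec"
  threshold :: real
  fail_prob :: real
  err :: real
  sigma1 :: real
  sigma2 :: real

definition valid_config :: "config \<Rightarrow> bool" where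
  "valid_config P \<longleftrightarrow>
     1 \<le> modes P \<and>
     passive_mat (modes P) (orth P) \<and>
     (\<forall>j<modes P. 1 \<le> squeezing P j) \<and>
     has_mode_range (modes P) (orth P) (mode_range P) \<and>
     displacement P \<in> carrier_vec (2 * modes P) \<and>
     threshold P < 1 \<and>
     0 < fail_prob P \<and> fail_prob P < 1 \<and>
     0 < err P \<and> err P \<le> (1 - threshold P) / 2 \<and>
     0 < sigma1 P \<and> 0 < sigma2 P"

definition s_max :: "config \<Rightarrow> real" where
  "s_max P = Max (squeezing P ` {..<modes P})"

definition kappa :: "config \<Rightarrow> nat" where
  "kappa P = 2 * min ((mode_range P)\<^sup>2) (modes P)"

definition log_conf :: "config \<Rightarrow> real" where
  "log_conf P = ln (1 / (1 - fail_prob P))"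

definition displacement_norm_sq :: "config \<Rightarrow> real" where
  "displacement_norm_sq P = scalar_prod (displacement P) (displacement P)"

definition weight_mat :: "config \<Rightarrow> real mat" where
  "weight_mat P = orth P * squeeze_inv_sq (modes P) (squeezing P) * transpose_mat (orth P)"

definition mat_trace :: "real mat \<Rightarrow> real" where
  "mat_trace A = (\<Sum>i<dim_row A. A $$ (i, i))"

definition fidelity_bound :: "config \<Rightarrow> real vec \<Rightarrow> real mat \<Rightarrow> real" where
  "fidelity_bound P \<gamma> \<Gamma> =
     (let x = displacement P; N = 2 * modes P in
      1 - mat_trace (weight_mat P * (\<Gamma> - mat N N (\<lambda>(i, k). (2 * \<gamma> $ i - x $ i) * x $ k)))
        + real (modes P) / 2)"

definition C1 :: "config \<Rightarrow> nat" where
  "C1 P = (LEAST C. 0 < C \<and>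
     real C \<ge> 2 ^ 6 * ((sigma1 P)\<^sup>2 * (2 * real (modes P) + 1) * real (modes P) * s_max P ^ 4
                      * displacement_norm_sq P)
              / ((err P)\<^sup>2 * log_conf P))"

definition C2 :: "config \<Rightarrow> nat" where
  "C2 P = (LEAST C. 0 < C \<and>
     real C \<ge> 2 ^ 5 * ((sigma2 P)\<^sup>2 * (2 * real (kappa P) * real (modes P) + 1) * (real (modes P))\<^sup>2
                      * s_max P ^ 4 * real (kappa P))
              / ((err P)\<^sup>2 * log_conf P))"

text \<open>Each element names one copy of the preparation, by the observable measured on it and a
  running number.\<close>

datatype copy = First nat nat | Second nat nat nat

definition copies :: "config \<Rightarrow> copy set" where
  "copies P =
     {First l c | l c. l < 2 * modes P \<and> c < C1 P} \<union>
     {Second l l' c | l l' c. l \<le> l' \<and> l' < 2 * modes P \<and> weight_mat P $$ (l, l') \<noteq> 0 \<and> c < C2 P}"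

text \<open>The joint distribution of all outcomes. \<open>E1 l\<close> and \<open>E2 l l'\<close> are the spectral measures of
  \<^term>\<open>quadrature l\<close> and \<^term>\<open>sym_product l l'\<close>.\<close>

definition outcome_space ::
  "config \<Rightarrow> (nat \<Rightarrow> real set \<Rightarrow> op) \<Rightarrow> (nat \<Rightarrow> nat \<Rightarrow> real set \<Rightarrow> op) \<Rightarrow> op \<Rightarrow> (copy \<Rightarrow> real) measure" where
  "outcome_space P E1 E2 \<rho> =
     (\<Pi>\<^sub>M i\<in>copies P.
        (case i of First l c \<Rightarrow> born_law (modes P) (E1 l) \<rho>
                 | Second l l' c \<Rightarrow> born_law (modes P) (E2 l l') \<rho>))"

definition gamma_est :: "config \<Rightarrow> (copy \<Rightarrow> real) \<Rightarrow> real vec" where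
  "gamma_est P \<omega> = vec (2 * modes P) (\<lambda>l. (\<Sum>c<C1 P. \<omega> (First l c)) / real (C1 P))"

text \<open>Entries that are not measured are multiplied by \<open>0\<close> in \<^term>\<open>fidelity_bound P\<close>.\<close>

definition Gamma_est :: "config \<Rightarrow> (copy \<Rightarrow> real) \<Rightarrow> real mat" where
  "Gamma_est P \<omega> = mat (2 * modes P) (2 * modes P)
     (\<lambda>(l, l'). (\<Sum>c<C2 P. \<omega> (Second (min l l') (max l l') c)) / real (C2 P))"

definition rejects :: "config \<Rightarrow> (copy \<Rightarrow> real) \<Rightarrow> bool" where
  "rejects P \<omega> \<longleftrightarrow> fidelity_bound P (gamma_est P \<omega>) (Gamma_est P \<omega>) < threshold P + err P"

definition reject_prob ::
  "config \<Rightarrow> (nat \<Rightarrow> real set \<Rightarrow> op) \<Rightarrow> (nat \<Rightarrow> nat \<Rightarrow> real set \<Rightarrow> op) \<Rightarrow> op \<Rightarrow> real" where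
  "reject_prob P E1 E2 \<rho> =
     measure (outcome_space P E1 E2 \<rho>) {\<omega> \<in> space (outcome_space P E1 E2 \<rho>). rejects P \<omega>}"

definition accept_prob ::
  "config \<Rightarrow> (nat \<Rightarrow> real set \<Rightarrow> op) \<Rightarrow> (nat \<Rightarrow> nat \<Rightarrow> real set \<Rightarrow> op) \<Rightarrow> op \<Rightarrow> real" where
  "accept_prob P E1 E2 \<rho> =
     measure (outcome_space P E1 E2 \<rho>) {\<omega> \<in> space (outcome_space P E1 E2 \<rho>). \<not> rejects P \<omega>}"

definition quadrature_measurements ::
  "nat \<Rightarrow> (nat \<Rightarrow> real set \<Rightarrow> op) \<Rightarrow> (nat \<Rightarrow> nat \<Rightarrow> real set \<Rightarrow> op) \<Rightarrow> bool" where
  "quadrature_measurements m E1 E2 \<longleftrightarrow>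
     (\<forall>l<2 * m. spectral_measure m (quadrature l) (E1 l)) \<and>
     (\<forall>l<2 * m. \<forall>l'<2 * m. spectral_measure m (sym_product l l') (E2 l l'))"

definition preparations ::
  "config \<Rightarrow> (nat \<Rightarrow> real set \<Rightarrow> op) \<Rightarrow> (nat \<Rightarrow> nat \<Rightarrow> real set \<Rightarrow> op) \<Rightarrow> op set" where
  "preparations P E1 E2 =
     {\<rho>. density_op (modes P) \<rho> \<and>
         (\<forall>l<2 * modes P. variance_at_most (born_law (modes P) (E1 l) \<rho>) ((sigma1 P)\<^sup>2)) \<and>
         (\<forall>l<2 * modes P. \<forall>l'<2 * modes P.
            variance_at_most (born_law (modes P) (E2 l l') \<rho>) ((sigma2 P)\<^sup>2))}"

text \<open>A test is given by its rejection and acceptance probabilities on the preparations in \<open>X\<close>.\<close>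

definition certification_test ::
  "nat \<Rightarrow> op set \<Rightarrow> (op \<Rightarrow> real) \<Rightarrow> (op \<Rightarrow> real) \<Rightarrow> op \<Rightarrow> real \<Rightarrow> real \<Rightarrow> bool" where
  "certification_test m X rej acc \<rho>t F\<^sub>T \<alpha> \<longleftrightarrow>
     (\<forall>\<rho>\<in>X. fidelity m \<rho>t \<rho> < F\<^sub>T \<longrightarrow> 1 - \<alpha> \<le> rej \<rho>) \<and>
     (\<rho>t \<in> X \<longrightarrow> 1 - \<alpha> \<le> acc \<rho>t)"

definition copy_bound :: "config \<Rightarrow> real" where
  "copy_bound P =
     s_max P ^ 4 *
       (2 * (sigma1 P)\<^sup>2 * displacement_norm_sq P * real (modes P) ^ 3
        + (sigma2 P)\<^sup>2 * real (kappa P) ^ 3 * real (modes P) ^ 4)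
     / ((err P)\<^sup>2 * log_conf P)"

end

theory Submission
  imports Defs "Jordan_Normal_Form.Determinant"
begin

text \<open>
  By a Cholesky factorisation a density operator is a mixture of (unnormalised) pure states \<open>v\<close>, and
  every outcome distribution is the corresponding mixture. For one \<open>v\<close> with finite second moments,
  write \<open>v = U w\<close>. Testing against number states gives \<open>r v = U (S r + x) w\<close>, so the quadratic
  polynomial in the moments that enters \<open>F\<^sup>(\<^sup>0\<^sup>)\<close> is \<open>\<Sum>n. (\<bar>n\<bar> + m/2) \<bar>w n\<bar>\<^sup>2\<close>, which is at least
  \<open>(1 + m/2) \<parallel>w\<parallel>\<^sup>2 - \<bar>w 0\<bar>\<^sup>2\<close> with \<open>w 0 = \<langle>U 0, v\<rangle>\<close>. Hence \<open>F\<^sup>(\<^sup>0\<^sup>) \<le> F\<close>, with equality for the target.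

  The estimator is linear in the independent outcomes. With \<open>C\<^sub>1\<close> and \<open>C\<^sub>2\<close> copies its variance is at most
  \<open>\<epsilon>\<^sup>2 L\<close> with \<open>L = ln (1 / (1 - \<alpha>))\<close>, and Cantelli's inequality bounds the failure
  probability by \<open>L / (1 + L) \<le> \<alpha>\<close>.

  In the copy count, a nonzero entry of \<open>O D\<^sup>-\<^sup>2 O\<^sup>T\<close> needs a common mode in the two rows of \<open>O\<close>, so there
  are at most \<open>2 m \<kappa>\<close> of them; the rounding in \<open>C\<^sub>1\<close> and \<open>C\<^sub>2\<close> is absorbed because an
  uncertainty relation for \<open>q\<^sup>2\<close>, \<open>p\<^sup>2\<close> and \<open>(q p + p q) / 2\<close> forces \<open>\<sigma>\<^sub>2\<^sup>2 \<ge> 1/8\<close>.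
\<close>

section \<open>The inner product of Fock space\<close>

text \<open>The obstacle is that the quadratures are unbounded, while a preparation is known only
  through laws with finite second moments. In a sum of rank-one pieces all contributions to a second
  moment are nonnegative, so finiteness for the mixture is finiteness for each piece: every
  \<open>v\<close> lies in the domains of all quadratures and of their symmetrised products, and
  operator identities have to be settled for single vectors only. The Cholesky pieces are built from
  positivity alone, without eigenvectors, and only finitely many of them meet a given number state,
  so the traces that occur become absolutely convergent double series. Ladder polynomials act
  entrywise, so two sides of an identity can be compared at each occupation pattern before either is
  known to be square-summable; inverting S afterwards yields the square-summability of the vectors
  \<open>r w\<close>. In the error analysis the variance budget is split evenly between the two
  kinds of measurement.\<close>

definition nsq :: "wave \<Rightarrow> real" where
  "nsq \<psi> = (\<Sum>\<^sub>\<infinity>n. (cmod (\<psi> n))\<^sup>2)"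

lemma fock_zero_outside: "\<psi> \<in> fock m \<Longrightarrow> n \<notin> occs m \<Longrightarrow> \<psi> n = 0"
  by (auto simp: fock_def)

lemma fock_summable: "\<psi> \<in> fock m \<Longrightarrow> (\<lambda>n. (cmod (\<psi> n))\<^sup>2) summable_on UNIV"
  by (auto simp: fock_def)

lemma nsq_has_sum: "\<psi> \<in> fock m \<Longrightarrow> ((\<lambda>n. (cmod (\<psi> n))\<^sup>2) has_sum nsq \<psi>) UNIV"
  unfolding nsq_def by (intro has_sum_infsum fock_summable)

lemma nsq_nonneg: "0 \<le> nsq \<psi>"
  unfolding nsq_def by (intro infsum_nonneg) auto

lemma fock_lincomb:
  assumes "\<psi> \<in> fock m" "\<phi> \<in> fock m"
  shows "(\<lambda>n. a * \<psi> n + b * \<phi> n) \<in> fock m"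
proof -
  have "(\<lambda>n. 2 * (cmod a)\<^sup>2 * (cmod (\<psi> n))\<^sup>2 + 2 * (cmod b)\<^sup>2 * (cmod (\<phi> n))\<^sup>2) summable_on UNIV"
    using assms by (intro summable_on_add summable_on_cmult_right fock_summable)
  moreover have "(cmod (a * \<psi> n + b * \<phi> n))\<^sup>2
      \<le> 2 * (cmod a)\<^sup>2 * (cmod (\<psi> n))\<^sup>2 + 2 * (cmod b)\<^sup>2 * (cmod (\<phi> n))\<^sup>2" for n
  proof -
    have "(cmod (a * \<psi> n + b * \<phi> n))\<^sup>2 \<le> (cmod (a * \<psi> n) + cmod (b * \<phi> n))\<^sup>2"
      by (intro power_mono norm_triangle_ineq) auto
    also have "\<dots> \<le> 2 * (cmod (a * \<psi> n))\<^sup>2 + 2 * (cmod (b * \<phi> n))\<^sup>2"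
      using sum_squares_bound[of "cmod (a * \<psi> n)" "cmod (b * \<phi> n)"] by (simp add: power2_sum)
    finally show ?thesis by (simp add: norm_mult power_mult_distrib)
  qed
  ultimately have "(\<lambda>n. (cmod (a * \<psi> n + b * \<phi> n))\<^sup>2) summable_on UNIV"
    by (rule summable_on_comparison_test) auto
  then show ?thesis using assms by (auto simp: fock_def)
qed

lemma fock_zero: "(\<lambda>n. 0) \<in> fock m"
  by (auto simp: fock_def)

lemma fock_scale: "\<psi> \<in> fock m \<Longrightarrow> (\<lambda>n. a * \<psi> n) \<in> fock m"
  using fock_lincomb[of \<psi> m \<psi> a 0] by simp

lemma fock_add: "\<psi> \<in> fock m \<Longrightarrow> \<phi> \<in> fock m \<Longrightarrow> (\<lambda>n. \<psi> n + \<phi> n) \<in> fock m"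
  using fock_lincomb[of \<psi> m \<phi> 1 1] by simp

lemma fock_diff: "\<psi> \<in> fock m \<Longrightarrow> \<phi> \<in> fock m \<Longrightarrow> (\<lambda>n. \<psi> n - \<phi> n) \<in> fock m"
  using fock_lincomb[of \<psi> m \<phi> 1 "-1"] by simp

lemma fock_sum: "(\<And>i. i \<in> I \<Longrightarrow> f i \<in> fock m) \<Longrightarrow> (\<lambda>n. \<Sum>i\<in>I. f i n) \<in> fock m"
  by (induction I rule: infinite_finite_induct) (auto intro: fock_zero fock_add)

lemma cmod_mult_le: "cmod (cnj a * b) \<le> (cmod a)\<^sup>2 + (cmod b)\<^sup>2"
proof -
  have "0 \<le> cmod a * cmod b" by simp
  then have "cmod a * cmod b \<le> (cmod a)\<^sup>2 + (cmod b)\<^sup>2"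
    using sum_squares_bound[of "cmod a" "cmod b"] by linarith
  then show ?thesis by (simp add: norm_mult)
qed

lemma braket_summable:
  assumes "\<phi> \<in> fock m" "\<psi> \<in> fock m"
  shows "(\<lambda>n. cnj (\<phi> n) * \<psi> n) summable_on UNIV"
proof (rule abs_summable_summable)
  have s: "(\<lambda>n. (cmod (\<phi> n))\<^sup>2 + (cmod (\<psi> n))\<^sup>2) summable_on UNIV"
    using assms by (intro summable_on_add fock_summable)
  show "(\<lambda>n. cmod (cnj (\<phi> n) * \<psi> n)) summable_on UNIV"
    using s by (rule summable_on_comparison_test) (auto simp: cmod_mult_le)
qed

lemma braket_has_sum:
  assumes "\<phi> \<in> fock m" "\<psi> \<in> fock m"
  shows "((\<lambda>n. cnj (\<phi> n) * \<psi> n) has_sum braket \<phi> \<psi>) UNIV"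
  unfolding braket_def using braket_summable[OF assms] by (rule has_sum_infsum)

lemma braket_cnj: "cnj (braket \<phi> \<psi>) = braket \<psi> \<phi>"
  unfolding braket_def infsum_cnj[symmetric] by (simp add: mult.commute)

lemma braket_lincomb_right:
  assumes "\<phi> \<in> fock m" "\<psi> \<in> fock m" "\<eta> \<in> fock m"
  shows "braket \<phi> (\<lambda>n. a * \<psi> n + b * \<eta> n) = a * braket \<phi> \<psi> + b * braket \<phi> \<eta>"
proof -
  have "((\<lambda>n. a * (cnj (\<phi> n) * \<psi> n) + b * (cnj (\<phi> n) * \<eta> n)) has_sum
      a * braket \<phi> \<psi> + b * braket \<phi> \<eta>) UNIV"
    using assms by (intro has_sum_add has_sum_cmult_right braket_has_sum)
  then have "((\<lambda>n. cnj (\<phi> n) * (a * \<psi> n + b * \<eta> n)) has_sum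
      a * braket \<phi> \<psi> + b * braket \<phi> \<eta>) UNIV"
    by (simp add: algebra_simps)
  then show ?thesis unfolding braket_def by (rule infsumI)
qed

lemma braket_lincomb_left:
  assumes "\<phi> \<in> fock m" "\<psi> \<in> fock m" "\<eta> \<in> fock m"
  shows "braket (\<lambda>n. a * \<psi> n + b * \<eta> n) \<phi> = cnj a * braket \<psi> \<phi> + cnj b * braket \<eta> \<phi>"
  using braket_lincomb_right[OF assms, of a b]
  by (metis braket_cnj complex_cnj_add complex_cnj_mult)

lemma braket_scale_right: "braket \<phi> (\<lambda>n. a * \<psi> n) = a * braket \<phi> \<psi>"
  unfolding braket_def by (subst infsum_cmult_right'[symmetric]) (simp add: mult_ac)

lemma braket_scale_left: "braket (\<lambda>n. a * \<psi> n) \<phi> = cnj a * braket \<psi> \<phi>"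
  by (metis braket_scale_right braket_cnj complex_cnj_mult)

lemma braket_zero_right: "braket \<phi> (\<lambda>n. 0) = 0"
  by (simp add: braket_def)

lemma braket_add_right:
  "\<phi> \<in> fock m \<Longrightarrow> \<psi> \<in> fock m \<Longrightarrow> \<eta> \<in> fock m \<Longrightarrow>
    braket \<phi> (\<lambda>n. \<psi> n + \<eta> n) = braket \<phi> \<psi> + braket \<phi> \<eta>"
  using braket_lincomb_right[of \<phi> m \<psi> \<eta> 1 1] by simp

lemma braket_diff_right:
  "\<phi> \<in> fock m \<Longrightarrow> \<psi> \<in> fock m \<Longrightarrow> \<eta> \<in> fock m \<Longrightarrow>
    braket \<phi> (\<lambda>n. \<psi> n - \<eta> n) = braket \<phi> \<psi> - braket \<phi> \<eta>"
  using braket_lincomb_right[of \<phi> m \<psi> \<eta> 1 "-1"] by simp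

lemma braket_add_left:
  "\<phi> \<in> fock m \<Longrightarrow> \<psi> \<in> fock m \<Longrightarrow> \<eta> \<in> fock m \<Longrightarrow>
    braket (\<lambda>n. \<psi> n + \<eta> n) \<phi> = braket \<psi> \<phi> + braket \<eta> \<phi>"
  using braket_lincomb_left[of \<phi> m \<psi> \<eta> 1 1] by simp

lemma braket_diff_left:
  "\<phi> \<in> fock m \<Longrightarrow> \<psi> \<in> fock m \<Longrightarrow> \<eta> \<in> fock m \<Longrightarrow>
    braket (\<lambda>n. \<psi> n - \<eta> n) \<phi> = braket \<psi> \<phi> - braket \<eta> \<phi>"
  using braket_lincomb_left[of \<phi> m \<psi> \<eta> 1 "-1"] by simp

lemma braket_lincomb_lincomb:
  assumes "\<phi> \<in> fock m" "\<psi> \<in> fock m" "\<eta> \<in> fock m" "\<zeta> \<in> fock m"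
  shows "braket (\<lambda>n. a * \<phi> n + b * \<psi> n) (\<lambda>n. c * \<eta> n + d * \<zeta> n) =
    cnj a * c * braket \<phi> \<eta> + cnj a * d * braket \<phi> \<zeta> + cnj b * c * braket \<psi> \<eta> + cnj b * d * braket \<psi> \<zeta>"
  unfolding braket_lincomb_left[OF fock_lincomb[OF assms(3,4)] assms(1,2)]
    braket_lincomb_right[OF assms(1,3,4)] braket_lincomb_right[OF assms(2,3,4)]
  by (simp add: algebra_simps)

lemma braket_sum_right:
  assumes "\<phi> \<in> fock m" "\<And>i. i \<in> I \<Longrightarrow> f i \<in> fock m"
  shows "braket \<phi> (\<lambda>n. \<Sum>i\<in>I. f i n) = (\<Sum>i\<in>I. braket \<phi> (f i))"
  using assms(2)
proof (induction I rule: infinite_finite_induct)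
  case (insert x F)
  then show ?case
    by (simp add: braket_add_right[of \<phi> m "f x" "\<lambda>n. \<Sum>i\<in>F. f i n"] fock_sum assms(1))
qed (auto simp: braket_zero_right)

lemma braket_sum_left:
  assumes "\<phi> \<in> fock m" "\<And>i. i \<in> I \<Longrightarrow> f i \<in> fock m"
  shows "braket (\<lambda>n. \<Sum>i\<in>I. f i n) \<phi> = (\<Sum>i\<in>I. braket (f i) \<phi>)"
proof -
  have "cnj (braket \<phi> (\<lambda>n. \<Sum>i\<in>I. f i n)) = cnj (\<Sum>i\<in>I. braket \<phi> (f i))"
    by (subst braket_sum_right[OF assms]) auto
  then show ?thesis by (simp add: braket_cnj)
qed

lemma braket_self: "braket \<psi> \<psi> = of_real (nsq \<psi>)"
proof -
  have "cnj (\<psi> n) * \<psi> n = of_real ((cmod (\<psi> n))\<^sup>2)" for n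
    by (metis complex_norm_square mult.commute)
  then show ?thesis
    unfolding braket_def nsq_def
    using infsum_bounded_linear_strong[OF summable_on_bounded_linear_iff[OF bounded_linear_of_real
        bounded_linear_Re Re_complex_of_real] bounded_linear_of_real]
    by (simp del: of_real_power)
qed

lemma braket_ket_left: "braket (ket n) \<psi> = \<psi> n"
proof -
  have "braket (ket n) \<psi> = (\<Sum>\<^sub>\<infinity>k\<in>{n}. cnj (ket n k) * \<psi> k)"
    unfolding braket_def by (intro infsum_cong_neutral) (auto simp: ket_def)
  then show ?thesis by (simp add: ket_def)
qed

lemma braket_ket_right: "braket \<psi> (ket n) = cnj (\<psi> n)"
  by (metis braket_ket_left braket_cnj)

lemma ket_in_finite_fock: "n \<in> occs m \<Longrightarrow> ket n \<in> finite_fock m"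
proof -
  assume n: "n \<in> occs m"
  have "finite {k. ket n k \<noteq> 0}" by (rule finite_subset[of _ "{n}"]) (auto simp: ket_def)
  moreover have "(\<lambda>k. (cmod (ket n k))\<^sup>2) summable_on UNIV"
    using summable_on_cong_neutral[of "{n}" UNIV "\<lambda>k. (cmod (ket n k))\<^sup>2" "\<lambda>k. (cmod (ket n k))\<^sup>2"]
    by (auto simp: ket_def)
  ultimately show ?thesis using n by (auto simp: finite_fock_def fock_def ket_def)
qed

lemma ket_in_fock: "n \<in> occs m \<Longrightarrow> ket n \<in> fock m"
  using ket_in_finite_fock by (auto simp: finite_fock_def)

lemma nsq_diff:
  assumes "\<psi> \<in> fock m" "\<phi> \<in> fock m"
  shows "nsq (\<lambda>n. \<psi> n - \<phi> n) = nsq \<psi> + nsq \<phi> - 2 * Re (braket \<psi> \<phi>)"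
proof -
  have "complex_of_real (nsq (\<lambda>n. \<psi> n - \<phi> n)) =
      braket \<psi> \<psi> - braket \<phi> \<psi> - (braket \<psi> \<phi> - braket \<phi> \<phi>)"
    unfolding braket_self[symmetric]
    by (simp add: braket_diff_left[of _ m] braket_diff_right[of _ m] assms fock_diff)
  then have "Re (complex_of_real (nsq (\<lambda>n. \<psi> n - \<phi> n))) =
      Re (braket \<psi> \<psi> - braket \<phi> \<psi> - (braket \<psi> \<phi> - braket \<phi> \<phi>))" by simp
  moreover have "Re (braket \<phi> \<psi>) = Re (braket \<psi> \<phi>)"
    by (metis braket_cnj cnj.sel(1))
  ultimately show ?thesis by (simp add: braket_self)
qed

lemma nsq_scale: "nsq (\<lambda>n. a * \<psi> n) = (cmod a)\<^sup>2 * nsq \<psi>"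
  unfolding nsq_def
  by (simp add: norm_mult power_mult_distrib infsum_cmult_right')

lemma nsq_add:
  assumes "\<psi> \<in> fock m" "\<phi> \<in> fock m"
  shows "nsq (\<lambda>n. \<psi> n + \<phi> n) = nsq \<psi> + nsq \<phi> + 2 * Re (braket \<psi> \<phi>)"
  using nsq_diff[OF assms(1) fock_scale[OF assms(2), of "-1"]]
    nsq_scale[of "-1" \<phi>] braket_scale_right[of \<psi> "-1" \<phi>] by simp

lemma nsq_zero_imp:
  assumes "\<psi> \<in> fock m" "nsq \<psi> = 0"
  shows "\<psi> = (\<lambda>n. 0)"
proof
  fix n
  have "(cmod (\<psi> n))\<^sup>2 \<le> nsq \<psi>"
    using has_sum_mono2[OF has_sum_finite[of "{n}" "\<lambda>n. (cmod (\<psi> n))\<^sup>2"] nsq_has_sum[OF assms(1)]]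
    by auto
  with assms(2) show "\<psi> n = 0" by simp
qed

text \<open>The squared norm of \<open>\<psi>\<close> minus its component along
  \<open>\<phi>\<close> is nonnegative. The bound makes the fidelity series below summable.\<close>

lemma Bessel:
  assumes "\<phi> \<in> fock m" "\<psi> \<in> fock m" "nsq \<phi> = 1"
  shows "(cmod (braket \<phi> \<psi>))\<^sup>2 \<le> nsq \<psi>"
proof -
  let ?c = "braket \<phi> \<psi>"
  have "0 \<le> nsq (\<lambda>n. \<psi> n - ?c * \<phi> n)" by (rule nsq_nonneg)
  also have "\<dots> = nsq \<psi> + (cmod ?c)\<^sup>2 - 2 * Re (?c * cnj ?c)"
    using assms by (simp add: nsq_diff[of _ m] fock_scale nsq_scale braket_scale_right braket_cnj)
  also have "Re (?c * cnj ?c) = (cmod ?c)\<^sup>2"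
    by (simp add: complex_mult_cnj cmod_power2)
  finally show ?thesis by simp
qed

section \<open>Decomposition of mixed states into pure states\<close>

text \<open>Linearity without a norm bound: the part of \<open>bounded_op\<close> that is carried
  through the successive Schur complements.\<close>

definition linear_op :: "nat \<Rightarrow> op \<Rightarrow> bool" where
  "linear_op m T \<longleftrightarrow>
     (\<forall>\<psi>\<in>fock m. T \<psi> \<in> fock m) \<and>
     (\<forall>\<psi>\<in>fock m. \<forall>\<phi>\<in>fock m. \<forall>a b.
        T (\<lambda>n. a * \<psi> n + b * \<phi> n) = (\<lambda>n. a * T \<psi> n + b * T \<phi> n))"

lemma bounded_op_linear: "bounded_op m T \<Longrightarrow> linear_op m T"
  by (auto simp: bounded_op_def linear_op_def)

lemma linear_op_fock: "linear_op m T \<Longrightarrow> \<psi> \<in> fock m \<Longrightarrow> T \<psi> \<in> fock m"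
  by (auto simp: linear_op_def)

lemma linear_op_lincomb:
  "linear_op m T \<Longrightarrow> \<psi> \<in> fock m \<Longrightarrow> \<phi> \<in> fock m \<Longrightarrow>
    T (\<lambda>n. a * \<psi> n + b * \<phi> n) = (\<lambda>n. a * T \<psi> n + b * T \<phi> n)"
  by (auto simp: linear_op_def)

text \<open>Polarisation: reality of the form at \<open>\<phi> + b \<psi>\<close> makes the cross
  terms real; b = 1 then compares the imaginary parts and b = \<i> the real parts. The subspace
  \<open>D\<close> is kept general so that the lemma serves both positive operators on all of
  \<open>fock m\<close> and unbounded operators on their domains.\<close>

lemma real_form_symmetric:
  assumes AD: "\<And>\<psi>. \<psi> \<in> D \<Longrightarrow> \<psi> \<in> fock m \<and> A \<psi> \<in> fock m"
    and lin: "\<And>\<psi> \<phi> a b. \<psi> \<in> D \<Longrightarrow> \<phi> \<in> D \<Longrightarrow>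
      A (\<lambda>n. a * \<psi> n + b * \<phi> n) = (\<lambda>n. a * A \<psi> n + b * A \<phi> n)"
    and sub: "\<And>\<psi> \<phi> a b. \<psi> \<in> D \<Longrightarrow> \<phi> \<in> D \<Longrightarrow> (\<lambda>n. a * \<psi> n + b * \<phi> n) \<in> D"
    and real: "\<And>\<psi>. \<psi> \<in> D \<Longrightarrow> Im (braket \<psi> (A \<psi>)) = 0"
    and D: "\<phi> \<in> D" "\<psi> \<in> D"
  shows "braket \<phi> (A \<psi>) = braket (A \<phi>) \<psi>"
proof -
  have expand: "braket (\<lambda>n. 1 * \<phi> n + b * \<psi> n) (A (\<lambda>n. 1 * \<phi> n + b * \<psi> n)) =
      braket \<phi> (A \<phi>) + b * braket \<phi> (A \<psi>) + cnj b * braket \<psi> (A \<phi>) + cnj b * b * braket \<psi> (A \<psi>)" for b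
    unfolding lin[OF D] using AD[OF D(1)] AD[OF D(2)]
    by (subst braket_lincomb_lincomb[of _ m]) auto
  have "Im (b * braket \<phi> (A \<psi>) + cnj b * braket \<psi> (A \<phi>)) = 0" for b
  proof -
    have "cnj b * b = of_real ((cmod b)\<^sup>2)" by (metis complex_norm_square mult.commute)
    then have "Im (cnj b * b * braket \<psi> (A \<psi>)) = 0" using real[OF D(2)] by simp
    with real[OF sub[OF D, of 1 b]] real[OF D(1)] show ?thesis
      unfolding expand plus_complex.sel by linarith
  qed
  from this[of 1] this[of \<i>] have "braket \<phi> (A \<psi>) = cnj (braket \<psi> (A \<phi>))"
    by (intro complex_eqI) auto
  then show ?thesis by (simp add: braket_cnj)
qed

section \<open>Positive operators and their Schur complements\<close>

definition positive_op :: "nat \<Rightarrow> op \<Rightarrow> bool" where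
  "positive_op m R \<longleftrightarrow> linear_op m R \<and>
     (\<forall>\<psi>\<in>fock m. Im (braket \<psi> (R \<psi>)) = 0 \<and> 0 \<le> Re (braket \<psi> (R \<psi>)))"

lemma positive_op_symmetric:
  assumes "positive_op m R" "\<phi> \<in> fock m" "\<psi> \<in> fock m"
  shows "braket \<phi> (R \<psi>) = braket (R \<phi>) \<psi>"
  by (rule real_form_symmetric[where D = "fock m" and m = m])
    (use assms in \<open>auto simp: positive_op_def linear_op_def fock_lincomb\<close>)

text \<open>If the form vanishes at e, its value at e + t R e is
  \<open>t\<^sup>2 * q + 2 * t * nsq (R e)\<close>. The linear term would make it negative for small
  negative t unless R e = 0.\<close>

lemma positive_op_kernel:
  assumes R: "positive_op m R" and e: "e \<in> fock m" "braket e (R e) = 0"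
  shows "R e = (\<lambda>n. 0)"
proof -
  have lin: "linear_op m R" using R by (simp add: positive_op_def)
  let ?f = "R e"
  have f: "?f \<in> fock m" "R ?f \<in> fock m"
    using linear_op_fock[OF lin e(1)] linear_op_fock[OF lin linear_op_fock[OF lin e(1)]] by simp_all
  define q where "q = Re (braket ?f (R ?f))"
  have ef: "braket e (R ?f) = of_real (nsq ?f)"
    using positive_op_symmetric[OF R e(1) f(1)] by (simp add: braket_self)
  have "0 \<le> t\<^sup>2 * q + 2 * t * nsq ?f" for t :: real
  proof -
    let ?u = "\<lambda>n. 1 * e n + of_real t * ?f n"
    have "braket ?u (R ?u) = braket e (R e) + of_real t * braket e (R ?f)
        + of_real t * braket ?f ?f + of_real t * of_real t * braket ?f (R ?f)"
      unfolding linear_op_lincomb[OF lin e(1) f(1)] using f e(1)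
      by (subst braket_lincomb_lincomb[of _ m]) auto
    moreover have "?u \<in> fock m" using e(1) f(1) by (rule fock_lincomb)
    then have "0 \<le> Re (braket ?u (R ?u))"
      using R unfolding positive_op_def by blast
    ultimately show ?thesis
      by (simp add: e(2) ef braket_self q_def power2_eq_square)
  qed
  note quad = this
  have "nsq ?f = 0"
  proof (rule ccontr)
    assume "nsq ?f \<noteq> 0"
    then have pos: "nsq ?f > 0" using nsq_nonneg[of ?f] by simp
    have q0: "0 \<le> q" using R f by (auto simp: q_def positive_op_def)
    \<comment> \<open>The minimiser would be t = - nsq ?f / q; the denominator q + 1 also covers q =
      0 and still gives a negative value.\<close>
    have "0 \<le> (- (nsq ?f / (q + 1)))\<^sup>2 * q + 2 * (- (nsq ?f / (q + 1))) * nsq ?f" by (rule quad)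
    also have "\<dots> = (nsq ?f)\<^sup>2 / (q + 1) * (q / (q + 1) - 2)"
      using q0 by (simp add: power2_eq_square divide_simps) (simp add: algebra_simps)
    also have "\<dots> < 0"
      using q0 pos by (intro mult_pos_neg) (auto simp: field_simps)
    finally show False by simp
  qed
  then show ?thesis using nsq_zero_imp f by blast
qed

text \<open>The column split off by one Cholesky step with pivot \<langle>e, R e\<rangle>. For a
  zero pivot the division by zero returns 0, so the column is the zero vector and the step leaves R
  unchanged.\<close>

definition schur_vec :: "wave \<Rightarrow> op \<Rightarrow> wave" where
  "schur_vec e R = (\<lambda>n. of_real (1 / sqrt (Re (braket e (R e)))) * R e n)"

definition schur :: "wave \<Rightarrow> op \<Rightarrow> op" where
  "schur e R = (\<lambda>\<psi> n. R \<psi> n - braket (schur_vec e R) \<psi> * schur_vec e R n)"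

lemma braket_schur_vec:
  "braket (schur_vec e R) \<psi> = of_real (1 / sqrt (Re (braket e (R e)))) * braket (R e) \<psi>"
  unfolding schur_vec_def by (subst braket_scale_left) simp

lemma schur_vec_fock: "positive_op m R \<Longrightarrow> e \<in> fock m \<Longrightarrow> schur_vec e R \<in> fock m"
  unfolding schur_vec_def by (rule fock_scale) (auto simp: positive_op_def linear_op_def)

lemma positive_op_real:
  "positive_op m R \<Longrightarrow> \<psi> \<in> fock m \<Longrightarrow> braket \<psi> (R \<psi>) = of_real (Re (braket \<psi> (R \<psi>)))"
  by (auto simp: positive_op_def complex_eq_iff)

text \<open>Completing the square: the form of the Schur complement at \<open>\<psi>\<close> is the
  value of the form of R at \<open>\<psi> + b e\<close> for the minimising coefficient
  \<open>?b\<close>, hence nonnegative. For a zero pivot nothing is subtracted.\<close>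

lemma schur_positive:
  assumes R: "positive_op m R" and e: "e \<in> fock m"
  shows "positive_op m (schur e R)"
proof -
  let ?v = "schur_vec e R"
  let ?c = "Re (braket e (R e))"
  have lin: "linear_op m R" using R by (simp add: positive_op_def)
  have Re: "R e \<in> fock m" using linear_op_fock[OF lin e] .
  have v: "?v \<in> fock m" using schur_vec_fock[OF assms] .
  have "linear_op m (schur e R)"
    unfolding linear_op_def schur_def
  proof (intro conjI ballI allI)
    fix \<psi> assume "\<psi> \<in> fock m"
    then show "(\<lambda>n. R \<psi> n - braket ?v \<psi> * ?v n) \<in> fock m"
      by (intro fock_diff fock_scale v linear_op_fock[OF lin])
  next
    fix \<psi> \<phi> a b assume "\<psi> \<in> fock m" "\<phi> \<in> fock m"
    then show "(\<lambda>n. R (\<lambda>n. a * \<psi> n + b * \<phi> n) n - braket ?v (\<lambda>n. a * \<psi> n + b * \<phi> n) * ?v n) =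
        (\<lambda>n. a * (R \<psi> n - braket ?v \<psi> * ?v n) + b * (R \<phi> n - braket ?v \<phi> * ?v n))"
      by (simp add: linear_op_lincomb[OF lin] braket_lincomb_right[OF v] algebra_simps)
  qed
  moreover have "Im (braket \<psi> (schur e R \<psi>)) = 0 \<and> 0 \<le> Re (braket \<psi> (schur e R \<psi>))"
    if \<psi>: "\<psi> \<in> fock m" for \<psi>
  proof -
    have R\<psi>: "R \<psi> \<in> fock m" using linear_op_fock[OF lin \<psi>] .
    have "braket \<psi> (schur e R \<psi>) = braket \<psi> (R \<psi>) - braket ?v \<psi> * braket \<psi> ?v"
      unfolding schur_def using R\<psi> \<psi> v
      by (simp add: braket_diff_right[of _ m] fock_scale braket_scale_right)
    also have "braket ?v \<psi> * braket \<psi> ?v = of_real ((cmod (braket ?v \<psi>))\<^sup>2)"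
      by (metis braket_cnj complex_norm_square)
    finally have eq: "braket \<psi> (schur e R \<psi>) =
        of_real (Re (braket \<psi> (R \<psi>)) - (cmod (braket ?v \<psi>))\<^sup>2)"
      using positive_op_real[OF R \<psi>] by simp
    have "(cmod (braket ?v \<psi>))\<^sup>2 \<le> Re (braket \<psi> (R \<psi>))"
    proof (cases "?c = 0")
      case True
      then have "?v = (\<lambda>n. 0)" by (simp add: schur_vec_def)
      then have "braket ?v \<psi> = 0" by (simp add: braket_def)
      then show ?thesis using R \<psi> by (simp add: positive_op_def)
    next
      case False
      then have c: "?c > 0" using R e by (auto simp: positive_op_def less_le)
      let ?z = "braket (R e) \<psi>"
      let ?b = "- ?z / of_real ?c"
      let ?u = "\<lambda>n. 1 * \<psi> n + ?b * e n"
      have zz: "braket \<psi> (R e) = cnj ?z" by (simp add: braket_cnj)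
      have ez: "braket e (R \<psi>) = ?z" by (rule positive_op_symmetric[OF R e \<psi>])
      have "braket ?u (R ?u) = braket \<psi> (R \<psi>) + ?b * braket \<psi> (R e)
          + cnj ?b * braket e (R \<psi>) + cnj ?b * ?b * braket e (R e)"
        unfolding linear_op_lincomb[OF lin \<psi> e] using R\<psi> \<psi> Re e
        by (subst braket_lincomb_lincomb[of _ m]) auto
      also have "\<dots> = braket \<psi> (R \<psi>) - ?z * cnj ?z / of_real ?c"
        unfolding zz ez using c by (subst (2) positive_op_real[OF R e]) (simp add: field_simps)
      also have "?z * cnj ?z = of_real ((cmod ?z)\<^sup>2)" by (metis complex_norm_square)
      finally have "Re (braket ?u (R ?u)) = Re (braket \<psi> (R \<psi>)) - (cmod ?z)\<^sup>2 / ?c" by simp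
      moreover have "?u \<in> fock m" using \<psi> e by (rule fock_lincomb)
      then have "0 \<le> Re (braket ?u (R ?u))"
        using R unfolding positive_op_def by blast
      moreover have "(cmod (braket ?v \<psi>))\<^sup>2 = (cmod ?z)\<^sup>2 / ?c"
        unfolding braket_schur_vec using c
        by (simp add: norm_mult norm_divide power_mult_distrib power_divide)
      ultimately show ?thesis by simp
    qed
    then show ?thesis unfolding eq by simp
  qed
  ultimately show ?thesis by (simp add: positive_op_def)
qed

text \<open>One step eliminates e. For a nonzero pivot the subtracted term reproduces R e; for a
  zero pivot R e is already 0 by \<open>positive_op_kernel\<close>.\<close>

lemma schur_self:
  assumes R: "positive_op m R" and e: "e \<in> fock m"
  shows "schur e R e = (\<lambda>n. 0)"
proof (cases "Re (braket e (R e)) = 0")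
  case True
  then have "R e = (\<lambda>n. 0)"
    using positive_op_kernel[OF R e] positive_op_real[OF R e] by simp
  then show ?thesis by (simp add: schur_def schur_vec_def)
next
  case False
  let ?c = "Re (braket e (R e))"
  have c: "?c > 0" using False R e by (auto simp: positive_op_def less_le)
  have "braket (R e) e = of_real ?c"
    using positive_op_symmetric[OF R e e] positive_op_real[OF R e] by simp
  then have "braket (schur_vec e R) e * schur_vec e R n = R e n" for n
  proof -
    have s: "complex_of_real (sqrt ?c) * complex_of_real (sqrt ?c) = of_real ?c"
      using c by (simp flip: of_real_mult)
    have "braket (schur_vec e R) e * schur_vec e R n =
        of_real ?c * R e n / (complex_of_real (sqrt ?c) * complex_of_real (sqrt ?c))"
      unfolding braket_schur_vec \<open>braket (R e) e = of_real ?c\<close> by (simp add: schur_vec_def)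
    then show ?thesis using c by (simp add: s)
  qed
  then show ?thesis by (simp add: schur_def)
qed

text \<open>Eliminated vectors stay eliminated: by symmetry R e is orthogonal to the kernel of R, so
  the subtracted term vanishes on u.\<close>

lemma schur_kernel:
  assumes R: "positive_op m R" and e: "e \<in> fock m" and u: "u \<in> fock m" "R u = (\<lambda>n. 0)"
  shows "schur e R u = (\<lambda>n. 0)"
proof -
  have "braket (R e) u = 0"
    using positive_op_symmetric[OF R e u(1)] u(2) by (simp add: braket_zero_right)
  then have "braket (schur_vec e R) u = 0"
    by (simp add: braket_schur_vec)
  then show ?thesis using u by (simp add: schur_def)
qed

text \<open>A pure-state decomposition \<open>\<rho> = \<Sum>k. |v k\<rangle>\<langle>v k|\<close> with unnormalised vectors, tested on the
  number basis only, where the sum is finite.\<close>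

definition pure_decomposition :: "nat \<Rightarrow> op \<Rightarrow> (nat \<Rightarrow> wave) \<Rightarrow> bool" where
  "pure_decomposition m \<rho> v \<longleftrightarrow>
     (\<forall>k. v k \<in> fock m) \<and>
     (\<forall>n\<in>occs m. \<exists>K. (\<forall>k\<ge>K. v k n = 0) \<and> \<rho> (ket n) = (\<lambda>i. \<Sum>k<K. cnj (v k n) * v k i))"

lemma countable_occs: "countable (occs m)"
proof -
  let ?f = "\<lambda>(xs :: nat list) j. if j < length xs then xs ! j else 0"
  have "occs m \<subseteq> range ?f"
  proof
    fix n :: occ assume "n \<in> occs m"
    then have "n = ?f (map n [0..<m])" by (auto simp: occs_def fun_eq_iff)
    then show "n \<in> range ?f" by blast
  qed
  then show ?thesis by (rule countable_subset) (rule countable_image[OF countableI_type])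
qed

lemma zero_in_occs: "(\<lambda>_. 0) \<in> occs m"
  by (simp add: occs_def)

fun schur_iter :: "(nat \<Rightarrow> wave) \<Rightarrow> op \<Rightarrow> nat \<Rightarrow> op" where
  "schur_iter e \<rho> 0 = \<rho>"
| "schur_iter e \<rho> (Suc k) = schur (e k) (schur_iter e \<rho> k)"

text \<open>The vectors \<open>v\<close> are the columns of the Cholesky factor of the matrix of \<open>\<rho>\<close>.\<close>

lemma positive_op_decomposition:
  assumes \<rho>: "positive_op m \<rho>"
  shows "\<exists>v. pure_decomposition m \<rho> v"
proof -
  define enum where "enum = from_nat_into (occs m)"
  define e where "e = (\<lambda>k. ket (enum k))"
  \<comment> \<open>Only the range of the enumeration is used. A number state that is met a second
    time is already in the kernel and contributes a zero column.\<close>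
  have ran: "range enum = occs m"
    unfolding enum_def by (rule range_from_nat_into) (use zero_in_occs countable_occs in auto)
  have e: "e k \<in> fock m" for k
    unfolding e_def by (rule ket_in_fock) (use ran in blast)
  define R where "R = schur_iter e \<rho>"
  define v where "v = (\<lambda>k. schur_vec (e k) (R k))"
  have pos: "positive_op m (R k)" for k
    by (induction k) (auto simp: R_def \<rho> intro!: schur_positive e)
  have v: "v k \<in> fock m" for k
    unfolding v_def by (rule schur_vec_fock[OF pos e])
  have RS: "R (Suc k) = schur (e k) (R k)" for k by (simp add: R_def)
  have van: "R (Suc i + d) (e i) = (\<lambda>n. 0)" for i d
  proof (induction d)
    case 0
    then show ?case using schur_self[OF pos[of i] e[of i]] by (simp add: RS)
  next
    case (Suc d)
    then show ?case
      using schur_kernel[OF pos[of "Suc i + d"] e[of "Suc i + d"] e[of i]] by (simp add: RS)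
  qed
  have van': "R k (e i) = (\<lambda>n. 0)" if "i < k" for i k
  proof -
    from that obtain d where "k = Suc i + d" by (metis less_iff_Suc_add add_Suc)
    then show ?thesis using van by simp
  qed
  have dec: "\<rho> \<psi> n = R k \<psi> n + (\<Sum>i<k. braket (v i) \<psi> * v i n)" for \<psi> n k
    by (induction k) (auto simp: R_def schur_def v_def)
  have "\<exists>K. (\<forall>k\<ge>K. v k n = 0) \<and> \<rho> (ket n) = (\<lambda>i. \<Sum>k<K. cnj (v k n) * v k i)"
    if "n \<in> occs m" for n
  proof -
    from that ran obtain i where i: "n = enum i" by blast
    have kn: "ket n = e i" by (simp add: e_def i)
    \<comment> \<open>The entry at n of column k is a multiple of the conjugate of \<langle>R k (e
      k), e i\<rangle> = \<langle>e k, R k (e i)\<rangle>, which is 0 once step i is done. This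
      triangular shape makes the expansion of \<rho> finite on each number state.\<close>
    have "v k n = 0" if "k \<ge> Suc i" for k
    proof -
      have "cnj (v k n) = braket (v k) (e i)" by (simp add: kn[symmetric] braket_ket_right)
      also have "\<dots> = of_real (1 / sqrt (Re (braket (e k) (R k (e k))))) * braket (R k (e k)) (e i)"
        by (simp add: v_def braket_schur_vec)
      also have "braket (R k (e k)) (e i) = 0"
        using positive_op_symmetric[OF pos[of k] e[of k] e[of i]] van'[of i k] that
        by (simp add: braket_zero_right)
      finally show ?thesis by simp
    qed
    moreover have "\<rho> (ket n) = (\<lambda>j. \<Sum>k<Suc i. cnj (v k n) * v k j)"
      using dec[of "ket n" _ "Suc i"] van'[of i "Suc i"]
      by (auto simp: fun_eq_iff braket_ket_right simp flip: kn)
    ultimately show ?thesis by blast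
  qed
  then show ?thesis using v by (auto simp: pure_decomposition_def)
qed

section \<open>Traces and fidelities as series over the pure components\<close>

lemma density_op_positive: "density_op m \<rho> \<Longrightarrow> positive_op m \<rho>"
  by (auto simp: density_op_def positive_op_def intro: bounded_op_linear)

lemma projection_nsq:
  assumes "projection_op m T" "\<psi> \<in> fock m"
  shows "braket \<psi> (T \<psi>) = of_real (nsq (T \<psi>))"
proof -
  have T\<psi>: "T \<psi> \<in> fock m" "T (T \<psi>) = T \<psi>"
    using assms by (auto simp: projection_op_def bounded_op_def)
  have "braket \<psi> (T (T \<psi>)) = braket (T \<psi>) (T \<psi>)"
    using assms T\<psi>(1) by (auto simp: projection_op_def)
  then show ?thesis by (simp add: T\<psi>(2) braket_self)
qed

lemma projection_fock: "projection_op m T \<Longrightarrow> \<psi> \<in> fock m \<Longrightarrow> T \<psi> \<in> fock m"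
  by (auto simp: projection_op_def bounded_op_def)

lemma projection_nsq_le:
  assumes "projection_op m T" "\<psi> \<in> fock m"
  shows "nsq (T \<psi>) \<le> nsq \<psi>"
proof -
  have "0 \<le> nsq (\<lambda>n. \<psi> n - T \<psi> n)" by (rule nsq_nonneg)
  also have "\<dots> = nsq \<psi> - nsq (T \<psi>)"
    using projection_nsq[OF assms] assms by (simp add: nsq_diff[of _ m] projection_fock)
  finally show ?thesis by simp
qed

text \<open>The nonnegative double series of the \<open>(cmod (v k n))\<^sup>2\<close> is the trace
  when summed over k before n, and the total weight of the components when summed over n before
  k.\<close>

lemma pure_decomposition_weight:
  assumes v: "pure_decomposition m \<rho> v" and tr: "trace_op m \<rho> = 1"
  shows "(\<lambda>k. nsq (v k)) sums 1"
    and "((\<lambda>(n, k). (cmod (v k n))\<^sup>2) has_sum 1) (UNIV \<times> UNIV)"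
proof -
  have vf: "v k \<in> fock m" for k using v by (simp add: pure_decomposition_def)
  define s where "s = (\<lambda>n. \<Sum>\<^sub>\<infinity>k. (cmod (v k n))\<^sup>2)"
  have s: "((\<lambda>k. (cmod (v k n))\<^sup>2) has_sum s n) UNIV \<and> (n \<in> occs m \<longrightarrow> \<rho> (ket n) n = of_real (s n))" for n
  proof (cases "n \<in> occs m")
    case True
    with v obtain K where K: "\<forall>k\<ge>K. v k n = 0" "\<rho> (ket n) = (\<lambda>i. \<Sum>k<K. cnj (v k n) * v k i)"
      unfolding pure_decomposition_def by blast
    have h: "((\<lambda>k. (cmod (v k n))\<^sup>2) has_sum (\<Sum>k<K. (cmod (v k n))\<^sup>2)) UNIV"
      by (rule has_sum_finite_neutralI[of "{..<K}"]) (use K(1) in \<open>auto simp: not_less\<close>)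
    moreover have "\<rho> (ket n) n = of_real (\<Sum>k<K. (cmod (v k n))\<^sup>2)"
      unfolding K(2) of_real_sum
      by (intro sum.cong refl) (metis complex_norm_square mult.commute)
    ultimately show ?thesis unfolding s_def by (simp add: infsumI)
  next
    case False
    then have "v k n = 0" for k using fock_zero_outside[OF vf] by blast
    then show ?thesis using False by (simp add: s_def)
  qed
  have tr': "trace_op m \<rho> = (\<Sum>\<^sub>\<infinity>n\<in>occs m. complex_of_real (s n))"
    unfolding trace_op_def using s by (intro infsum_cong) (simp add: braket_ket_left)
  \<comment> \<open>A family that is not summable has infinite sum 0 by convention, so a trace equal
    to 1 entails summability.\<close>
  have "(\<lambda>n. complex_of_real (s n)) summable_on occs m"
    using tr tr' by (metis infsum_not_exists zero_neq_one)
  then have "((\<lambda>n. complex_of_real (s n)) has_sum complex_of_real 1) (occs m)"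
    using tr tr' by (simp add: has_sum_iff)
  then have sum_occs: "(s has_sum 1) (occs m)"
    unfolding has_sum_of_real_iff .
  have "s n = 0" if "n \<notin> occs m" for n
    using that fock_zero_outside[OF vf] by (simp add: s_def)
  then have sum_s: "(s has_sum 1) UNIV"
    using has_sum_cong_neutral[of UNIV "occs m" s s 1] sum_occs by auto
  show two: "((\<lambda>(n, k). (cmod (v k n))\<^sup>2) has_sum 1) (UNIV \<times> UNIV)"
    using sum_s s
    by (intro has_sum_SigmaI[where g = s] summable_on_SigmaI[where g = s]) (auto simp: has_sum_iff)
  have "((\<lambda>(k, n). (cmod (v k n))\<^sup>2) has_sum 1) (UNIV \<times> UNIV)"
    using two has_sum_swap[of "\<lambda>(n, k). (cmod (v k n))\<^sup>2" UNIV UNIV 1] by simp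
  then have "((\<lambda>k. nsq (v k)) has_sum 1) UNIV"
    by (rule has_sum_SigmaD) (use nsq_has_sum[OF vf] in auto)
  then show "(\<lambda>k. nsq (v k)) sums 1" by (rule has_sum_imp_sums)
qed

text \<open>Fubini for products of two square-summable double families, absolutely summable because
  \<open>\<bar>a b\<bar> \<le> \<bar>a\<bar>\<^sup>2 + \<bar>b\<bar>\<^sup>2\<close>. In the uses
  below the rows are the diagonal entries of a trace and the columns are the contributions of single
  pure components; convergence of the trace is part of what comes out.\<close>

lemma double_series:
  fixes a b :: "occ \<Rightarrow> nat \<Rightarrow> complex"
  assumes s1: "(\<lambda>(n, k). (cmod (a n k))\<^sup>2) summable_on UNIV \<times> UNIV"
    and s2: "(\<lambda>(n, k). (cmod (b n k))\<^sup>2) summable_on UNIV \<times> UNIV"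
    and rows: "\<And>n. n \<in> N \<Longrightarrow> ((\<lambda>k. a n k * b n k) has_sum r n) UNIV"
    and zero: "\<And>n k. n \<notin> N \<Longrightarrow> a n k = 0"
    and cols: "\<And>k. ((\<lambda>n. a n k * b n k) has_sum c k) UNIV"
  shows "(c has_sum infsum r N) UNIV"
proof -
  let ?f = "\<lambda>(n, k). a n k * b n k"
  have "(\<lambda>x. cmod (?f x)) summable_on UNIV \<times> UNIV"
  proof (rule summable_on_comparison_test[OF summable_on_add[OF s1 s2]])
    fix x :: "occ \<times> nat"
    show "cmod (?f x) \<le> (case x of (n, k) \<Rightarrow> (cmod (a n k))\<^sup>2) + (case x of (n, k) \<Rightarrow> (cmod (b n k))\<^sup>2)"
      using cmod_mult_le[of "cnj (a (fst x) (snd x))" "b (fst x) (snd x)"] by (cases x) simp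
  qed auto
  then have "?f summable_on UNIV \<times> UNIV" by (rule abs_summable_summable)
  then obtain S where S: "(?f has_sum S) (UNIV \<times> UNIV)" by (auto simp: summable_on_def)
  let ?r = "\<lambda>n. if n \<in> N then r n else 0"
  have "((\<lambda>k. ?f (n, k)) has_sum ?r n) UNIV" for n
    using rows zero by auto
  with S have "(?r has_sum S) UNIV" by (rule has_sum_SigmaD)
  then have "(r has_sum S) N"
    by (subst has_sum_cong_neutral[where g = ?r and T = UNIV]) auto
  then have "S = infsum r N" by (rule infsumI[symmetric])
  moreover have "((\<lambda>(k, n). ?f (n, k)) has_sum S) (UNIV \<times> UNIV)"
    using S has_sum_swap[of ?f UNIV UNIV S] by simp
  then have "(c has_sum S) UNIV" by (rule has_sum_SigmaD) (use cols in auto)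
  ultimately show ?thesis by simp
qed

lemma has_sum_of_real_sums:
  assumes "((\<lambda>k. complex_of_real (f k)) has_sum z) UNIV"
  shows "f sums Re z"
  using has_sum_imp_sums[OF has_sum_Re[OF assms]] by simp

lemma summable_on_pairs_swap:
  fixes f :: "'a \<Rightarrow> 'b \<Rightarrow> real"
  assumes "\<And>k. ((\<lambda>n. f n k) has_sum g k) UNIV" "g summable_on UNIV" "\<And>n k. 0 \<le> f n k"
  shows "(\<lambda>(n, k). f n k) summable_on UNIV \<times> UNIV"
proof -
  have "(\<lambda>(k, n). f n k) summable_on UNIV \<times> UNIV"
    by (rule summable_on_SigmaI[where g = g]) (use assms in auto)
  then show ?thesis by (subst summable_on_swap) simp
qed

text \<open>Born's rule for the mixture as a sum over its components. \<open>double_series\<close>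
  is applied to the entries of \<open>v k\<close> and of \<open>T (v k)\<close>, both
  square-summable over all pairs because a projection does not increase norms.\<close>

lemma trace_decomposition:
  assumes v: "pure_decomposition m \<rho> v" and tr: "trace_op m \<rho> = 1" and sym: "positive_op m \<rho>"
    and T: "projection_op m T"
  shows "(\<lambda>k. nsq (T (v k))) sums Re (trace_op m (\<rho> \<circ> T))"
proof -
  have vf: "v k \<in> fock m" for k using v by (simp add: pure_decomposition_def)
  have Tv: "T (v k) \<in> fock m" for k using projection_fock[OF T vf] .
  have s1: "(\<lambda>(n, k). (cmod (v k n))\<^sup>2) summable_on UNIV \<times> UNIV"
    using pure_decomposition_weight(2)[OF v tr] by (rule has_sum_imp_summable)
  have wt: "(\<lambda>k. nsq (v k)) summable_on UNIV"
    using pure_decomposition_weight(1)[OF v tr]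
    by (subst summable_on_UNIV_nonneg_real_iff) (auto simp: nsq_nonneg sums_iff)
  have "(\<lambda>k. nsq (T (v k))) summable_on UNIV"
    by (rule summable_on_comparison_test[OF wt])
      (auto simp: nsq_nonneg intro: projection_nsq_le[OF T vf])
  then have s2: "(\<lambda>(n, k). (cmod (cnj (T (v k) n)))\<^sup>2) summable_on UNIV \<times> UNIV"
    by (intro summable_on_pairs_swap[where g = "\<lambda>k. nsq (T (v k))"]) (auto intro: nsq_has_sum[OF Tv])
  have "((\<lambda>k. complex_of_real (nsq (T (v k)))) has_sum
      infsum (\<lambda>n. braket (ket n) ((\<rho> \<circ> T) (ket n))) (occs m)) UNIV"
  proof (rule double_series[OF s1 s2])
    fix n assume n: "n \<in> occs m"
    from v n obtain K where K: "\<forall>k\<ge>K. v k n = 0" "\<rho> (ket n) = (\<lambda>i. \<Sum>k<K. cnj (v k n) * v k i)"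
      unfolding pure_decomposition_def by blast
    have Tn: "T (ket n) \<in> fock m" using projection_fock[OF T ket_in_fock[OF n]] .
    \<comment> \<open>The finite expansion of \<rho> is available on number states, but
      \<open>T (ket n)\<close> is none; symmetry moves \<rho> to the left factor. Below, T is moved
      in the same way onto \<open>v k\<close>.\<close>
    have "braket (ket n) ((\<rho> \<circ> T) (ket n)) = braket (\<rho> (ket n)) (T (ket n))"
      using positive_op_symmetric[OF sym ket_in_fock[OF n] Tn] by simp
    also have "\<dots> = (\<Sum>k<K. v k n * braket (v k) (T (ket n)))"
      unfolding K(2)
      by (subst braket_sum_left[OF Tn]) (auto intro: fock_scale vf simp: braket_scale_left)
    also have "\<dots> = (\<Sum>k<K. v k n * cnj (T (v k) n))"
      using T ket_in_fock[OF n] vf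
      by (intro sum.cong) (auto simp: projection_op_def braket_ket_right)
    finally show "((\<lambda>k. v k n * cnj (T (v k) n)) has_sum braket (ket n) ((\<rho> \<circ> T) (ket n))) UNIV"
      by (intro has_sum_finite_neutralI[of "{..<K}"]) (use K(1) in \<open>auto simp: not_less\<close>)
  next
    show "((\<lambda>n. v k n * cnj (T (v k) n)) has_sum of_real (nsq (T (v k)))) UNIV" for k
      using braket_has_sum[OF Tv vf, of k k] projection_nsq[OF T vf, of k]
        braket_cnj[of "v k" "T (v k)"] by (simp add: mult.commute)
  qed (rule fock_zero_outside[OF vf])
  from has_sum_of_real_sums[OF this] show ?thesis by (simp add: trace_op_def)
qed

text \<open>In the order \<open>ketbra \<phi> \<phi> \<circ> \<rho>\<close> the state acts on the
  number states directly, so its finite expansion applies without moving operators.\<close>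

lemma fidelity_decomposition:
  assumes v: "pure_decomposition m \<rho> v" and tr: "trace_op m \<rho> = 1"
    and \<phi>: "\<phi> \<in> fock m" "nsq \<phi> = 1"
  shows "(\<lambda>k. (cmod (braket \<phi> (v k)))\<^sup>2) sums fidelity m (ketbra \<phi> \<phi>) \<rho>"
proof -
  have vf: "v k \<in> fock m" for k using v by (simp add: pure_decomposition_def)
  let ?g = "\<lambda>k. braket \<phi> (v k)"
  have s1: "(\<lambda>(n, k). (cmod (cnj (v k n)))\<^sup>2) summable_on UNIV \<times> UNIV"
    using has_sum_imp_summable[OF pure_decomposition_weight(2)[OF v tr]] by simp
  have wt: "(\<lambda>k. nsq (v k)) summable_on UNIV"
    using pure_decomposition_weight(1)[OF v tr]
    by (subst summable_on_UNIV_nonneg_real_iff) (auto simp: nsq_nonneg sums_iff)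
  have "(\<lambda>k. (cmod (?g k))\<^sup>2) summable_on UNIV"
    by (rule summable_on_comparison_test[OF wt]) (auto intro: Bessel[OF \<phi>(1) vf \<phi>(2)])
  moreover have "((\<lambda>n. (cmod (\<phi> n * ?g k))\<^sup>2) has_sum (cmod (?g k))\<^sup>2) UNIV" for k
    using has_sum_cmult_left[OF nsq_has_sum[OF \<phi>(1)], of "(cmod (?g k))\<^sup>2"] \<phi>(2)
    by (simp add: norm_mult power_mult_distrib)
  ultimately have s2: "(\<lambda>(n, k). (cmod (\<phi> n * ?g k))\<^sup>2) summable_on UNIV \<times> UNIV"
    by (intro summable_on_pairs_swap[where g = "\<lambda>k. (cmod (?g k))\<^sup>2"]) auto
  have "((\<lambda>k. complex_of_real ((cmod (?g k))\<^sup>2)) has_sum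
      infsum (\<lambda>n. braket (ket n) ((ketbra \<phi> \<phi> \<circ> \<rho>) (ket n))) (occs m)) UNIV"
  proof (rule double_series[OF s1 s2])
    fix n assume n: "n \<in> occs m"
    from v n obtain K where K: "\<forall>k\<ge>K. v k n = 0" "\<rho> (ket n) = (\<lambda>i. \<Sum>k<K. cnj (v k n) * v k i)"
      unfolding pure_decomposition_def by blast
    have "braket \<phi> (\<rho> (ket n)) = (\<Sum>k<K. cnj (v k n) * ?g k)"
      unfolding K(2)
      by (subst braket_sum_right[OF \<phi>(1)]) (auto intro: fock_scale vf simp: braket_scale_right)
    then have "braket (ket n) ((ketbra \<phi> \<phi> \<circ> \<rho>) (ket n)) = (\<Sum>k<K. cnj (v k n) * (\<phi> n * ?g k))"
      by (simp add: braket_ket_left ketbra_def sum_distrib_left mult_ac)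
    then show "((\<lambda>k. cnj (v k n) * (\<phi> n * ?g k)) has_sum braket (ket n) ((ketbra \<phi> \<phi> \<circ> \<rho>) (ket n))) UNIV"
      by (intro has_sum_finite_neutralI[of "{..<K}"]) (use K(1) in \<open>auto simp: not_less\<close>)
  next
    show "((\<lambda>n. cnj (v k n) * (\<phi> n * ?g k)) has_sum of_real ((cmod (?g k))\<^sup>2)) UNIV" for k
      using has_sum_cmult_left[OF braket_has_sum[OF vf \<phi>(1), of k], of "?g k"]
        complex_norm_square[of "?g k"] braket_cnj[of \<phi> "v k"] by (simp add: mult_ac)
  qed (use fock_zero_outside[OF vf] in auto)
  from has_sum_of_real_sums[OF this] show ?thesis by (simp add: trace_op_def fidelity_def)
qed

text \<open>Lets the target pass through the same series as a general preparation, with a single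
  nonzero term.\<close>

lemma pure_state_decomposition:
  assumes "\<phi> \<in> fock m"
  shows "pure_decomposition m (ketbra \<phi> \<phi>) (\<lambda>k n. if k = 0 then \<phi> n else 0)"
  unfolding pure_decomposition_def
proof (intro conjI allI ballI exI[of _ 1])
  fix k :: nat show "(\<lambda>n. if k = 0 then \<phi> n else 0) \<in> fock m"
    using assms by (cases "k = 0") (auto simp: fock_zero)
qed (auto simp: ketbra_def braket_ket_right)

section \<open>Outcome distributions\<close>

lemma pvm_projection: "pvm m E \<Longrightarrow> B \<in> sets borel \<Longrightarrow> projection_op m (E B)"
  by (auto simp: pvm_def)

lemma pvm_sums:
  assumes "pvm m E" "\<psi> \<in> fock m" "range B \<subseteq> sets borel" "disjoint_family B"
  shows "(\<lambda>i. nsq (E (B i) \<psi>)) sums nsq (E (\<Union>i. B i) \<psi>)"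
proof -
  have "(\<lambda>i. braket \<psi> (E (B i) \<psi>)) sums braket \<psi> (E (\<Union>i. B i) \<psi>)"
    using assms by (auto simp: pvm_def)
  moreover have "braket \<psi> (E (B i) \<psi>) = of_real (nsq (E (B i) \<psi>))" for i
    using assms by (intro projection_nsq pvm_projection) auto
  moreover have "braket \<psi> (E (\<Union>i. B i) \<psi>) = of_real (nsq (E (\<Union>i. B i) \<psi>))"
    using assms by (intro projection_nsq pvm_projection) auto
  ultimately have "(\<lambda>i. complex_of_real (nsq (E (B i) \<psi>))) sums of_real (nsq (E (\<Union>i. B i) \<psi>))"
    by simp
  from sums_Re[OF this] show ?thesis by simp
qed

text \<open>Countable additivity along the sequence of empty sets: a convergent constant series has
  terms 0.\<close>

lemma pvm_empty:
  assumes "pvm m E" "\<psi> \<in> fock m"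
  shows "nsq (E {} \<psi>) = 0"
proof -
  have "(\<lambda>i :: nat. nsq (E {} \<psi>)) sums nsq (E {} \<psi>)"
    using pvm_sums[OF assms, of "\<lambda>_. {}"] by (simp add: disjoint_family_on_def)
  then show ?thesis using summable_const_iff sums_summable by blast
qed

lemma sets_pure_law [measurable_cong]: "sets (pure_law E \<psi>) = sets borel"
  using sets.sigma_sets_eq[of "borel :: real measure"] by (simp add: pure_law_def sets_measure_of)

lemma space_pure_law [simp]: "space (pure_law E \<psi>) = UNIV"
  by (simp add: pure_law_def space_measure_of_conv)

lemma sets_born_law [measurable_cong]: "sets (born_law m E \<rho>) = sets borel"
  using sets.sigma_sets_eq[of "borel :: real measure"] by (simp add: born_law_def sets_measure_of)

lemma space_born_law [simp]: "space (born_law m E \<rho>) = UNIV"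
  by (simp add: born_law_def space_measure_of_conv)

text \<open>\<open>measure_of\<close> has the prescribed values once the set function is shown to be
  positive and countably additive, and here both come from the projection-valued measure.\<close>

lemma emeasure_pure_law:
  assumes E: "pvm m E" and \<psi>: "\<psi> \<in> fock m" and B: "B \<in> sets borel"
  shows "emeasure (pure_law E \<psi>) B = ennreal (nsq (E B \<psi>))"
proof -
  have eq: "Re (braket \<psi> (E B \<psi>)) = nsq (E B \<psi>)" if "B \<in> sets borel" for B
    using projection_nsq[OF pvm_projection[OF E that] \<psi>] by simp
  have "emeasure (pure_law E \<psi>) B = ennreal (Re (braket \<psi> (E B \<psi>)))"
  proof (rule emeasure_measure_of[OF pure_law_def])
    show "positive (sets (pure_law E \<psi>)) (\<lambda>B. ennreal (Re (braket \<psi> (E B \<psi>))))"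
      by (simp add: positive_def eq pvm_empty[OF E \<psi>])
    show "countably_additive (sets (pure_law E \<psi>)) (\<lambda>B. ennreal (Re (braket \<psi> (E B \<psi>))))"
    proof (rule countably_additiveI)
      fix A :: "nat \<Rightarrow> real set"
      assume "range A \<subseteq> sets (pure_law E \<psi>)" and d: "disjoint_family A"
      then have A: "range A \<subseteq> sets borel" by (simp add: sets_pure_law)
      then have "A i \<in> sets borel" "(\<Union>i. A i) \<in> sets borel" for i by auto
      then show "(\<Sum>i. ennreal (Re (braket \<psi> (E (A i) \<psi>)))) = ennreal (Re (braket \<psi> (E (\<Union>i. A i) \<psi>)))"
        by (simp add: eq suminf_ennreal_eq[OF nsq_nonneg pvm_sums[OF E \<psi> A d]])
    qed
  qed (use B in \<open>auto simp: sets_pure_law\<close>)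
  then show ?thesis by (simp add: eq B)
qed

lemma finite_measure_pure_law: "pvm m E \<Longrightarrow> \<psi> \<in> fock m \<Longrightarrow> finite_measure (pure_law E \<psi>)"
  by (rule finite_measureI) (simp add: emeasure_pure_law)

lemma measure_pure_law:
  "pvm m E \<Longrightarrow> \<psi> \<in> fock m \<Longrightarrow> B \<in> sets borel \<Longrightarrow> measure (pure_law E \<psi>) B = nsq (E B \<psi>)"
  by (simp add: measure_def emeasure_pure_law nsq_nonneg)

lemma suminf_swap_ennreal: "(\<Sum>i. \<Sum>k. f i k) = (\<Sum>k. \<Sum>i. f i k :: ennreal)"
proof -
  have "(\<Sum>i. \<Sum>k. f i k) = (\<Sum>i. \<integral>\<^sup>+k. f i k \<partial>count_space UNIV)"
    by (simp add: nn_integral_count_space_nat)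
  also have "\<dots> = (\<integral>\<^sup>+k. (\<Sum>i. f i k) \<partial>count_space UNIV)"
    by (rule nn_integral_suminf[symmetric]) simp
  finally show ?thesis by (simp add: nn_integral_count_space_nat)
qed

text \<open>Countable additivity of the mixed law is inherited from the pure laws by exchanging two
  series of nonnegative terms.\<close>

lemma emeasure_born_law:
  assumes v: "pure_decomposition m \<rho> v" and tr: "trace_op m \<rho> = 1" and \<rho>: "positive_op m \<rho>"
    and E: "pvm m E" and B: "B \<in> sets borel"
  shows "emeasure (born_law m E \<rho>) B = (\<Sum>k. emeasure (pure_law E (v k)) B)"
proof -
  have vf: "v k \<in> fock m" for k using v by (simp add: pure_decomposition_def)
  have eq: "ennreal (Re (trace_op m (\<rho> \<circ> E B))) = (\<Sum>k. emeasure (pure_law E (v k)) B)"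
    if "B \<in> sets borel" for B
    using suminf_ennreal_eq[OF nsq_nonneg trace_decomposition[OF v tr \<rho> pvm_projection[OF E that]]]
    by (simp add: emeasure_pure_law[OF E vf that])
  have "emeasure (born_law m E \<rho>) B = ennreal (Re (trace_op m (\<rho> \<circ> E B)))"
  proof (rule emeasure_measure_of[OF born_law_def])
    show "positive (sets (born_law m E \<rho>)) (\<lambda>B. ennreal (Re (trace_op m (\<rho> \<circ> E B))))"
      by (simp add: positive_def eq)
    show "countably_additive (sets (born_law m E \<rho>)) (\<lambda>B. ennreal (Re (trace_op m (\<rho> \<circ> E B))))"
    proof (rule countably_additiveI)
      fix A :: "nat \<Rightarrow> real set"
      assume "range A \<subseteq> sets (born_law m E \<rho>)" and d: "disjoint_family A"
      then have A: "range A \<subseteq> sets borel" by (simp add: sets_born_law)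
      then have "A i \<in> sets borel" "(\<Union>i. A i) \<in> sets borel" for i by auto
      then show "(\<Sum>i. ennreal (Re (trace_op m (\<rho> \<circ> E (A i))))) =
          ennreal (Re (trace_op m (\<rho> \<circ> E (\<Union>i. A i))))"
        using suminf_swap_ennreal[of "\<lambda>i k. emeasure (pure_law E (v k)) (A i)"] A d
        by (simp add: eq suminf_emeasure sets_pure_law)
    qed
  qed (use B in \<open>auto simp: sets_born_law\<close>)
  then show ?thesis by (simp add: eq B)
qed

lemma prob_space_born_law:
  assumes v: "pure_decomposition m \<rho> v" and tr: "trace_op m \<rho> = 1" and \<rho>: "positive_op m \<rho>"
    and E: "pvm m E"
  shows "prob_space (born_law m E \<rho>)"
proof (rule prob_spaceI)
  have vf: "v k \<in> fock m" for k using v by (simp add: pure_decomposition_def)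
  have "E UNIV (v k) = v k" for k using E vf by (auto simp: pvm_def)
  then have "emeasure (born_law m E \<rho>) UNIV = (\<Sum>k. ennreal (nsq (v k)))"
    by (simp add: emeasure_born_law[OF v tr \<rho> E] emeasure_pure_law[OF E vf])
  also have "\<dots> = 1"
    using suminf_ennreal_eq[OF nsq_nonneg pure_decomposition_weight(1)[OF v tr]] by simp
  finally show "emeasure (born_law m E \<rho>) (space (born_law m E \<rho>)) = 1" by simp
qed

section \<open>Integrals under a countable mixture of measures\<close>

context
  fixes M :: "real measure" and N :: "nat \<Rightarrow> real measure"
  assumes sets_M: "sets M = sets borel" and sets_N: "\<And>k. sets (N k) = sets borel"
    and emeasure_M: "\<And>B. B \<in> sets borel \<Longrightarrow> emeasure M B = (\<Sum>k. emeasure (N k) B)"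
begin

lemma nn_integral_mixture:
  assumes f: "f \<in> borel_measurable borel"
  shows "(\<integral>\<^sup>+x. f x \<partial>M) = (\<Sum>k. \<integral>\<^sup>+x. f x \<partial>N k)"
  using f
proof (induction rule: borel_measurable_induct)
  case (cong f g)
  then have "f = g" by auto
  with cong show ?case by simp
next
  case (set A)
  then show ?case using sets_M sets_N by (simp add: emeasure_M)
next
  case (mult u c)
  have u: "u \<in> borel_measurable M" "u \<in> borel_measurable (N k)" for k
    using mult(2) by (simp_all add: measurable_cong_sets[OF sets_M refl] measurable_cong_sets[OF sets_N refl])
  then show ?case by (simp add: nn_integral_cmult mult)
next
  case (add u v)
  have u: "u \<in> borel_measurable M" "u \<in> borel_measurable (N k)"
    "v \<in> borel_measurable M" "v \<in> borel_measurable (N k)" for k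
    using add.hyps by (simp_all add: measurable_cong_sets[OF sets_M refl] measurable_cong_sets[OF sets_N refl])
  then show ?case by (simp add: nn_integral_add add suminf_add)
next
  case (seq U)
  have U: "U i \<in> borel_measurable M" "U i \<in> borel_measurable (N k)" for k i
    using seq(1) by (simp_all add: measurable_cong_sets[OF sets_M refl] measurable_cong_sets[OF sets_N refl])
  have "(\<integral>\<^sup>+x. (SUP i. U i) x \<partial>M) = (SUP i. \<Sum>k. \<integral>\<^sup>+x. U i x \<partial>N k)"
    using nn_integral_monotone_convergence_SUP[OF seq(3) U(1)] seq.IH by (simp add: image_comp)
  also have "\<dots> = (\<Sum>k. SUP i. \<integral>\<^sup>+x. U i x \<partial>N k)"
    using seq(3)
    by (intro ennreal_suminf_SUP_eq[symmetric])
      (auto simp: incseq_def le_fun_def intro!: nn_integral_mono)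
  also have "\<dots> = (\<Sum>k. \<integral>\<^sup>+x. (SUP i. U i) x \<partial>N k)"
    using nn_integral_monotone_convergence_SUP[OF seq(3) U(2)] by (simp add: image_comp)
  finally show ?case .
qed

text \<open>The finite total dominates each term of the series, so integrability passes from the
  mixture to every component. Applied to the square, this places every pure component in the
  operator domains.\<close>

lemma integral_mixture_nonneg:
  fixes f :: "real \<Rightarrow> real"
  assumes f: "integrable M f" "f \<in> borel_measurable borel" "\<And>x. 0 \<le> f x"
  shows "integrable (N k) f" and "(\<lambda>k. \<integral>x. f x \<partial>N k) sums (\<integral>x. f x \<partial>M)"
proof -
  have fN: "f \<in> borel_measurable (N k)" for k
    using f(2) by (simp add: measurable_cong_sets[OF sets_N refl])
  have sum: "(\<Sum>k. \<integral>\<^sup>+x. ennreal (f x) \<partial>N k) = ennreal (\<integral>x. f x \<partial>M)"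
    using nn_integral_mixture[of "\<lambda>x. ennreal (f x)"] f nn_integral_eq_integral[OF f(1)] by simp
  have fin: "(\<integral>\<^sup>+x. ennreal (f x) \<partial>N k) < \<infinity>" for k
  proof -
    have "(\<integral>\<^sup>+x. ennreal (f x) \<partial>N k) \<le> (\<Sum>k. \<integral>\<^sup>+x. ennreal (f x) \<partial>N k)"
      using sum_le_suminf[of "\<lambda>k. \<integral>\<^sup>+x. ennreal (f x) \<partial>N k" "{k}"] by simp
    then show ?thesis using sum by (simp add: le_less_trans)
  qed
  show int: "integrable (N k) f" for k
    using fin fN f(3) by (intro integrableI_nonneg) auto
  then have nn: "(\<integral>\<^sup>+x. ennreal (f x) \<partial>N k) = ennreal (\<integral>x. f x \<partial>N k)" for k
    using f(3) by (intro nn_integral_eq_integral) auto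
  have pos: "0 \<le> (\<integral>x. f x \<partial>N k)" for k using f(3) by simp
  have s: "(\<Sum>k. ennreal (\<integral>x. f x \<partial>N k)) = ennreal (\<integral>x. f x \<partial>M)" using sum by (simp add: nn)
  then have summ: "summable (\<lambda>k. \<integral>x. f x \<partial>N k)"
    by (intro summable_suminf_not_top pos) simp
  then have "ennreal (\<Sum>k. \<integral>x. f x \<partial>N k) = ennreal (\<integral>x. f x \<partial>M)"
    using s suminf_ennreal2[OF pos summ] by simp
  then have "(\<Sum>k. \<integral>x. f x \<partial>N k) = (\<integral>x. f x \<partial>M)"
    using f(3) pos by (subst (asm) ennreal_inj) (auto intro: suminf_nonneg summ)
  with summ show "(\<lambda>k. \<integral>x. f x \<partial>N k) sums (\<integral>x. f x \<partial>M)" by (simp add: sums_iff)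
qed

lemma integral_mixture:
  fixes f :: "real \<Rightarrow> real"
  assumes f: "integrable M f" "f \<in> borel_measurable borel"
  shows "integrable (N k) f" and "(\<lambda>k. \<integral>x. f x \<partial>N k) sums (\<integral>x. f x \<partial>M)"
proof -
  let ?p = "\<lambda>x. max 0 (f x)" and ?n = "\<lambda>x. max 0 (- f x)"
  have eq: "f = (\<lambda>x. ?p x - ?n x)" by (auto simp: max_def)
  have p: "integrable M ?p" "?p \<in> borel_measurable borel" and n: "integrable M ?n" "?n \<in> borel_measurable borel"
    using f by auto
  note P = integral_mixture_nonneg[OF p] and Q = integral_mixture_nonneg[OF n]
  show "integrable (N k) f"
    by (subst eq) (intro Bochner_Integration.integrable_diff P(1) Q(1); simp)
  have "(\<integral>x. f x \<partial>M) = (\<integral>x. ?p x \<partial>M) - (\<integral>x. ?n x \<partial>M)"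
    by (subst eq) (rule Bochner_Integration.integral_diff[OF p(1) n(1)])
  moreover have "(\<integral>x. f x \<partial>N k) = (\<integral>x. ?p x \<partial>N k) - (\<integral>x. ?n x \<partial>N k)" for k
    by (subst eq) (rule Bochner_Integration.integral_diff; rule P(1) Q(1); simp)
  ultimately show "(\<lambda>k. \<integral>x. f x \<partial>N k) sums (\<integral>x. f x \<partial>M)"
    using sums_diff[OF P(2) Q(2)] by simp
qed

end

section \<open>Spectral measures and quadratic forms\<close>

lemma integral_finite_range:
  fixes s h :: "real \<Rightarrow> real"
  assumes "finite_measure M" "sets M = sets borel" "s \<in> borel_measurable borel" "finite (range s)"
  shows "(\<integral>x. h (s x) \<partial>M) = (\<Sum>c\<in>range s. h c * measure M (s -` {c}))"
proof -
  interpret finite_measure M by fact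
  have meas: "s -` {c} \<in> sets M" for c
    using measurable_sets[OF assms(3), of "{c}"] assms(2) by simp
  have "h (s x) = (\<Sum>c\<in>range s. h c * indicator (s -` {c}) x)" for x
  proof -
    have "(\<Sum>c\<in>range s. h c * indicator (s -` {c}) x) = (\<Sum>c\<in>range s. if c = s x then h c else 0)"
      by (intro sum.cong) (auto simp: indicator_def)
    then show ?thesis using assms(4) by simp
  qed
  then have "(\<integral>x. h (s x) \<partial>M) = (\<integral>x. (\<Sum>c\<in>range s. h c * indicator (s -` {c}) x) \<partial>M)"
    by simp
  also have "\<dots> = (\<Sum>c\<in>range s. h c * measure M (s -` {c}))"
    using meas sets.sets_into_space[OF meas] by (simp add: Bochner_Integration.integral_sum Int_absorb2 less_top[symmetric])
  finally show ?thesis .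
qed

lemma projection_add_diff:
  assumes T: "projection_op m T" and uv: "u \<in> fock m" "v \<in> fock m"
  shows "nsq (T (\<lambda>n. u n + v n)) - nsq (T (\<lambda>n. u n - v n)) = 4 * Re (braket (T u) (T v))"
proof -
  have lin: "linear_op m T" using T by (auto simp: projection_op_def intro: bounded_op_linear)
  have "T (\<lambda>n. u n + v n) = (\<lambda>n. T u n + T v n)" "T (\<lambda>n. u n - v n) = (\<lambda>n. T u n - T v n)"
    using linear_op_lincomb[OF lin uv, of 1 1] linear_op_lincomb[OF lin uv, of 1 "-1"] by simp_all
  then show ?thesis
    using linear_op_fock[OF lin] uv by (simp add: nsq_add[of _ m] nsq_diff[of _ m])
qed

text \<open>On the spectral projection P of the level set of a value c, the inequality is
  nonnegativity of \<open>nsq\<close> at P u - c P v, with the cross term written by polarisation.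
  Summing over the finitely many values turns the terms in u into \<open>nsq u\<close>.\<close>

lemma spectral_cauchy_schwarz_finite_range:
  fixes s :: "real \<Rightarrow> real"
  assumes E: "pvm m E" and uv: "u \<in> fock m" "v \<in> fock m"
    and s: "s \<in> borel_measurable borel" "finite (range s)"
  shows "(\<integral>x. s x \<partial>pure_law E (\<lambda>n. u n + v n)) - (\<integral>x. s x \<partial>pure_law E (\<lambda>n. u n - v n))
    \<le> 2 * (nsq u + (\<integral>x. (s x)\<^sup>2 \<partial>pure_law E v))"
proof -
  let ?P = "\<lambda>c. E (s -` {c})"
  have B: "s -` {c} \<in> sets borel" for c using measurable_sets[OF s(1), of "{c}"] by simp
  have P: "projection_op m (?P c)" for c using pvm_projection[OF E B] .
  have int: "(\<integral>x. h (s x) \<partial>pure_law E w) = (\<Sum>c\<in>range s. h c * nsq (?P c w))"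
    if "w \<in> fock m" for w h
    using integral_finite_range[OF finite_measure_pure_law[OF E that] sets_pure_law s]
    by (simp add: measure_pure_law[OF E that B])
  have "measure (pure_law E u) UNIV = (\<integral>x. 1 \<partial>pure_law E u)" by simp
  also have "\<dots> = (\<Sum>c\<in>range s. nsq (?P c u))" using int[OF uv(1), of "\<lambda>_. 1"] by simp
  finally have u1: "nsq u = (\<Sum>c\<in>range s. nsq (?P c u))"
    using E uv(1) by (simp add: measure_pure_law pvm_def)
  have "c * nsq (?P c (\<lambda>n. u n + v n)) - c * nsq (?P c (\<lambda>n. u n - v n))
      \<le> 2 * (nsq (?P c u) + c\<^sup>2 * nsq (?P c v))" for c
  proof -
    have "0 \<le> nsq (\<lambda>n. ?P c u n - of_real c * ?P c v n)" by (rule nsq_nonneg)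
    also have "\<dots> = nsq (?P c u) + c\<^sup>2 * nsq (?P c v) - 2 * (c * Re (braket (?P c u) (?P c v)))"
      using projection_fock[OF P] uv
      by (simp add: nsq_diff[of _ m] fock_scale nsq_scale braket_scale_right)
    finally show ?thesis
      using projection_add_diff[OF P uv, of c] by (simp flip: right_diff_distrib)
  qed
  then have "(\<Sum>c\<in>range s. c * nsq (?P c (\<lambda>n. u n + v n)) - c * nsq (?P c (\<lambda>n. u n - v n)))
      \<le> (\<Sum>c\<in>range s. 2 * (nsq (?P c u) + c\<^sup>2 * nsq (?P c v)))"
    by (rule sum_mono)
  then show ?thesis
    using int[OF fock_add[OF uv], of "\<lambda>c. c"] int[OF fock_diff[OF uv], of "\<lambda>c. c"]
      int[OF uv(2), of "\<lambda>c. c\<^sup>2"]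
    by (simp add: u1 sum_subtractf sum.distrib flip: sum_distrib_left)
qed

text \<open>Formally \<open>2 Re \<integral>y d\<langle>u, E v\<rangle> \<le> \<parallel>u\<parallel>\<^sup>2 + \<parallel>\<integral>y dE v\<parallel>\<^sup>2\<close>, with the left-hand side
  written by polarisation.\<close>

lemma spectral_cauchy_schwarz:
  fixes y :: "real \<Rightarrow> real"
  assumes E: "pvm m E" and uv: "u \<in> fock m" "v \<in> fock m"
    and y: "y \<in> borel_measurable borel"
    and int: "integrable (pure_law E (\<lambda>n. u n + v n)) y" "integrable (pure_law E (\<lambda>n. u n - v n)) y"
      "integrable (pure_law E v) (\<lambda>x. (y x)\<^sup>2)"
  shows "(\<integral>x. y x \<partial>pure_law E (\<lambda>n. u n + v n)) - (\<integral>x. y x \<partial>pure_law E (\<lambda>n. u n - v n))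
    \<le> 2 * (nsq u + (\<integral>x. (y x)\<^sup>2 \<partial>pure_law E v))"
proof -
  \<comment> \<open>The domination by 2 \<bar>y\<bar>, and by \<open>4 * (y x)\<^sup>2\<close> for
    the squares, allows the finite-range inequality to pass to the limit.\<close>
  obtain s where s: "\<And>i. simple_function borel (s i)"
    and lim: "\<And>x. (\<lambda>i. s i x) \<longlonglongrightarrow> y x" and bd: "\<And>i x. \<bar>s i x\<bar> \<le> 2 * \<bar>y x\<bar>"
    using borel_measurable_implies_sequence_metric[OF y, of 0] by auto
  have fin: "finite (range (s i))" for i using simple_functionD(1)[OF s] by simp
  have sm: "s i \<in> borel_measurable borel" for i
    using s by (simp add: borel_measurable_simple_function)
  have ineq: "(\<integral>x. s i x \<partial>pure_law E (\<lambda>n. u n + v n)) - (\<integral>x. s i x \<partial>pure_law E (\<lambda>n. u n - v n))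
      \<le> 2 * (nsq u + (\<integral>x. (s i x)\<^sup>2 \<partial>pure_law E v))" for i
    by (rule spectral_cauchy_schwarz_finite_range[OF E uv sm fin])
  have l1: "(\<lambda>i. \<integral>x. s i x \<partial>pure_law E w) \<longlonglongrightarrow> (\<integral>x. y x \<partial>pure_law E w)"
    if "integrable (pure_law E w) y" for w
    by (rule integral_dominated_convergence[where w = "\<lambda>x. 2 * \<bar>y x\<bar>"])
      (use that y sm lim bd in \<open>auto simp: measurable_cong_sets[OF sets_pure_law refl]\<close>)
  have sq: "(s i x)\<^sup>2 \<le> 4 * (y x)\<^sup>2" for i x
    using power_mono[OF bd[of i x], of 2] by (simp add: power_mult_distrib)
  have l2: "(\<lambda>i. \<integral>x. (s i x)\<^sup>2 \<partial>pure_law E v) \<longlonglongrightarrow> (\<integral>x. (y x)\<^sup>2 \<partial>pure_law E v)"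
    by (rule integral_dominated_convergence[where w = "\<lambda>x. 4 * (y x)\<^sup>2"])
      (use int(3) y sm lim sq in
        \<open>auto simp: measurable_cong_sets[OF sets_pure_law refl] intro!: tendsto_power\<close>)
  show ?thesis
    by (rule LIMSEQ_le[OF tendsto_diff[OF l1[OF int(1)] l1[OF int(2)]]
          tendsto_mult_left[OF tendsto_add[OF tendsto_const l2]]])
      (use ineq in auto)
qed

lemma integrable_square_imp:
  fixes M :: "real measure"
  assumes "finite_measure M" "sets M = sets borel" "integrable M (\<lambda>x. x\<^sup>2)"
  shows "integrable M (\<lambda>x. x)" "integrable M (\<lambda>x. (x - c)\<^sup>2)"
proof -
  interpret finite_measure M by fact
  have meas: "(\<lambda>x. x) \<in> borel_measurable M"
    using assms(2) by (simp add: measurable_cong_sets[OF assms(2) refl])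
  have "\<bar>x\<bar> \<le> 1 + x\<^sup>2" for x :: real
    using sum_squares_bound[of "\<bar>x\<bar>" 1] abs_ge_zero[of x] by (simp del: abs_ge_zero)
  then show i: "integrable M (\<lambda>x. x)"
    by (intro Bochner_Integration.integrable_bound[OF Bochner_Integration.integrable_add[OF
            integrable_const assms(3), of 1] meas]) auto
  have "(\<lambda>x. (x - c)\<^sup>2) = (\<lambda>x. x\<^sup>2 - 2 * c * x + c\<^sup>2)"
    by (auto simp: power2_eq_square algebra_simps)
  then show "integrable M (\<lambda>x. (x - c)\<^sup>2)" using assms(3) i by simp
qed

section \<open>Unbounded operators on their domains\<close>

definition op_domain :: "nat \<Rightarrow> op \<Rightarrow> wave set" where
  "op_domain m A = {\<psi> \<in> fock m. A \<psi> \<in> fock m}"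

text \<open>Linearity on all functions of the occupation numbers, without a domain condition,
  because ladder polynomials act entrywise on every such function.\<close>

definition wave_linear :: "op \<Rightarrow> bool" where
  "wave_linear A \<longleftrightarrow> (\<forall>\<psi> \<phi> a b. A (\<lambda>n. a * \<psi> n + b * \<phi> n) = (\<lambda>n. a * A \<psi> n + b * A \<phi> n))"

lemma wave_linearD: "wave_linear A \<Longrightarrow> A (\<lambda>n. a * \<psi> n + b * \<phi> n) = (\<lambda>n. a * A \<psi> n + b * A \<phi> n)"
  by (auto simp: wave_linear_def)

lemma op_domain_lincomb:
  "wave_linear A \<Longrightarrow> \<psi> \<in> op_domain m A \<Longrightarrow> \<phi> \<in> op_domain m A \<Longrightarrow>
    (\<lambda>n. a * \<psi> n + b * \<phi> n) \<in> op_domain m A"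
  by (auto simp: op_domain_def wave_linearD intro: fock_lincomb)

lemma spectral_measure_pvm: "spectral_measure m A E \<Longrightarrow> pvm m E"
  by (auto simp: spectral_measure_def)

lemma spectral_measure_mean:
  "spectral_measure m A E \<Longrightarrow> \<psi> \<in> op_domain m A \<Longrightarrow>
    braket \<psi> (A \<psi>) = of_real (\<integral>x. x \<partial>pure_law E \<psi>)"
  by (auto simp: spectral_measure_def op_domain_def)

lemma spectral_measure_domain:
  "spectral_measure m A E \<Longrightarrow> \<psi> \<in> fock m \<Longrightarrow>
    \<psi> \<in> op_domain m A \<longleftrightarrow> integrable (pure_law E \<psi>) (\<lambda>x. x\<^sup>2)"
  by (auto simp: spectral_measure_def op_domain_def)

text \<open>On its domain the quadratic form is the mean of a law on the real line, hence real, and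
  a real form is symmetric by polarisation.\<close>

lemma spectral_symmetric:
  assumes "spectral_measure m A E" "wave_linear A" "\<phi> \<in> op_domain m A" "\<psi> \<in> op_domain m A"
  shows "braket \<phi> (A \<psi>) = braket (A \<phi>) \<psi>"
  by (rule real_form_symmetric[where D = "op_domain m A" and m = m])
    (use assms in \<open>auto simp: wave_linearD spectral_measure_mean op_domain_lincomb, auto simp: op_domain_def\<close>)

lemma nsq_le_if_finite_sums_le:
  assumes "\<And>F. finite F \<Longrightarrow> (\<Sum>n\<in>F. (cmod (g n))\<^sup>2) \<le> K" "g \<in> fock m"
  shows "nsq g \<le> K"
  unfolding nsq_def using assms by (intro infsum_le_finite_sums fock_summable[of _ m]) auto

text \<open>The vector (A - c) v is tested against its finite truncations u. They lie in the domain
  of A, which (A - c) v itself may not. The inner product of u with (A - c) v is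
  \<open>nsq u\<close>, and the spectral Cauchy-Schwarz inequality for x - c bounds twice this by
  \<open>nsq u\<close> plus the second moment about c. Hence \<open>nsq u\<close> is at most that
  moment, for every truncation.\<close>

lemma spectral_variance:
  assumes A: "spectral_measure m A E" "wave_linear A"
    and fin: "\<And>\<psi>. \<psi> \<in> finite_fock m \<Longrightarrow> A \<psi> \<in> fock m"
    and v: "v \<in> op_domain m A"
  shows "nsq (\<lambda>n. A v n - of_real c * v n) \<le> (\<integral>x. (x - c)\<^sup>2 \<partial>pure_law E v)"
proof -
  let ?g = "\<lambda>n. A v n - of_real c * v n"
  let ?K = "\<integral>x. (x - c)\<^sup>2 \<partial>pure_law E v"
  have E: "pvm m E" using spectral_measure_pvm[OF A(1)] .
  have vf: "v \<in> fock m" "A v \<in> fock m" using v by (auto simp: op_domain_def)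
  have g: "?g \<in> fock m" using vf by (intro fock_diff fock_scale)
  show ?thesis
  proof (rule nsq_le_if_finite_sums_le[OF _ g])
    fix F :: "occ set" assume F: "finite F"
    define u where "u = (\<lambda>n. if n \<in> F then ?g n else 0)"
    have usum: "((\<lambda>n. (cmod (u n))\<^sup>2) has_sum (\<Sum>n\<in>F. (cmod (?g n))\<^sup>2)) UNIV"
      by (rule has_sum_finite_neutralI[OF F]) (auto simp: u_def)
    have "u \<in> finite_fock m"
      using g usum F unfolding finite_fock_def fock_def
      by (auto simp: u_def intro: has_sum_imp_summable finite_subset[OF _ F])
    then have uD: "u \<in> op_domain m A" and uf: "u \<in> fock m" "A u \<in> fock m"
      using fin by (auto simp: op_domain_def finite_fock_def)
    have nu: "nsq u = (\<Sum>n\<in>F. (cmod (?g n))\<^sup>2)" unfolding nsq_def by (rule infsumI[OF usum])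
    have "((\<lambda>n. cnj (u n) * ?g n) has_sum (\<Sum>n\<in>F. of_real ((cmod (?g n))\<^sup>2))) UNIV"
      by (rule has_sum_finite_neutralI[OF F])
        (auto simp: u_def complex_norm_square mult.commute simp del: of_real_power intro!: sum.cong)
    then have ug: "braket u ?g = of_real (nsq u)" unfolding braket_def nu by (simp add: infsumI)
    have pD: "(\<lambda>n. u n + v n) \<in> op_domain m A" and dD: "(\<lambda>n. u n - v n) \<in> op_domain m A"
      using op_domain_lincomb[OF A(2) uD v, of 1 1] op_domain_lincomb[OF A(2) uD v, of 1 "-1"] by auto
    have int2: "integrable (pure_law E w) (\<lambda>x. x\<^sup>2)" "integrable (pure_law E w) (\<lambda>x. x)"
      "integrable (pure_law E w) (\<lambda>x. (x - c)\<^sup>2)" "integrable (pure_law E w) (\<lambda>x. x - c)"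
      "(\<integral>x. x - c \<partial>pure_law E w) = Re (braket w (A w)) - c * nsq w"
      if "w \<in> op_domain m A" for w
    proof -
      have wf: "w \<in> fock m" using that by (simp add: op_domain_def)
      interpret finite_measure "pure_law E w" by (rule finite_measure_pure_law[OF E wf])
      show i: "integrable (pure_law E w) (\<lambda>x. x\<^sup>2)"
        using spectral_measure_domain[OF A(1) wf] that by simp
      show j: "integrable (pure_law E w) (\<lambda>x. x)" "integrable (pure_law E w) (\<lambda>x. (x - c)\<^sup>2)"
        using integrable_square_imp[OF finite_measure_axioms sets_pure_law i] by auto
      then show "integrable (pure_law E w) (\<lambda>x. x - c)" by simp
      have "measure (pure_law E w) UNIV = nsq w"
        using E wf by (simp add: measure_pure_law pvm_def)
      then show "(\<integral>x. x - c \<partial>pure_law E w) = Re (braket w (A w)) - c * nsq w"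
        using j spectral_measure_mean[OF A(1) that] by simp
    qed
    have "(\<integral>x. x - c \<partial>pure_law E (\<lambda>n. u n + v n)) - (\<integral>x. x - c \<partial>pure_law E (\<lambda>n. u n - v n))
        \<le> 2 * (nsq u + ?K)"
      by (rule spectral_cauchy_schwarz[OF E uf(1) vf(1) _ int2(4)[OF pD] int2(4)[OF dD] int2(3)[OF v]]) simp
    moreover have expand:
      "braket (\<lambda>n. u n + v n) (\<lambda>n. A u n + A v n) =
        braket u (A u) + braket u (A v) + braket v (A u) + braket v (A v)"
      "braket (\<lambda>n. u n - v n) (\<lambda>n. A u n - A v n) =
        braket u (A u) - braket u (A v) - braket v (A u) + braket v (A v)"
      using braket_lincomb_lincomb[OF uf(1) vf(1) uf(2) vf(2), of 1 1 1 1]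
        braket_lincomb_lincomb[OF uf(1) vf(1) uf(2) vf(2), of 1 "-1" 1 "-1"] by simp_all
    moreover have "A (\<lambda>n. u n + v n) = (\<lambda>n. A u n + A v n)" "A (\<lambda>n. u n - v n) = (\<lambda>n. A u n - A v n)"
      using wave_linearD[OF A(2), of 1 u 1 v] wave_linearD[OF A(2), of 1 u "-1" v] by auto
    moreover have "Re (braket v (A u)) = Re (braket u (A v))"
      using spectral_symmetric[OF A v uD] braket_cnj[of "A v" u] by (metis cnj.sel(1))
    ultimately have "4 * (Re (braket u (A v)) - c * Re (braket u v)) \<le> 2 * (nsq u + ?K)"
      unfolding int2(5)[OF pD] int2(5)[OF dD] nsq_add[OF uf(1) vf(1)] nsq_diff[OF uf(1) vf(1)]
      by (simp add: expand algebra_simps)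
    moreover have "braket u ?g = braket u (A v) - of_real c * braket u v"
      using uf vf by (simp add: braket_diff_right[of _ m] fock_scale braket_scale_right)
    from arg_cong[OF trans[OF this[symmetric] ug], of Re]
    have "Re (braket u (A v)) - c * Re (braket u v) = nsq u" by simp
    ultimately have "nsq u \<le> ?K" by simp
    then show "(\<Sum>n\<in>F. (cmod (?g n))\<^sup>2) \<le> ?K" by (simp add: nu)
  qed
qed

section \<open>Quadratures on the number basis\<close>

lemma has_sum_diff_real:
  fixes f g :: "'a \<Rightarrow> real"
  assumes "(f has_sum a) A" "(g has_sum b) A"
  shows "((\<lambda>x. f x - g x) has_sum a - b) A"
  using has_sum_add[OF assms(1) has_sum_cmult_right[OF assms(2), of "-1"]] by simp

lemma has_sum_sum_real:
  fixes f :: "'i \<Rightarrow> 'a \<Rightarrow> real"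
  assumes "\<And>i. i \<in> I \<Longrightarrow> (f i has_sum a i) A"
  shows "((\<lambda>x. \<Sum>i\<in>I. f i x) has_sum (\<Sum>i\<in>I. a i)) A"
  using assms by (induction I rule: infinite_finite_induct) (auto intro: has_sum_add)

section \<open>Ladder operators as weighted shifts of the occupation numbers\<close>

lemma has_sum_shift_up:
  fixes g :: "occ \<Rightarrow> real"
  assumes "\<And>n. n j < c \<Longrightarrow> g n = 0"
  shows "((\<lambda>n. g (n(j := n j + c))) has_sum S) UNIV \<longleftrightarrow> (g has_sum S) UNIV"
proof -
  have "bij_betw (\<lambda>n. n(j := n j + c)) UNIV {n. c \<le> n j}"
    by (rule bij_betwI[where g = "\<lambda>n. n(j := n j - c)"]) auto
  then have "((\<lambda>n. g (n(j := n j + c))) has_sum S) UNIV \<longleftrightarrow> (g has_sum S) {n. c \<le> n j}"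
    by (rule has_sum_reindex_bij_betw)
  also have "\<dots> \<longleftrightarrow> (g has_sum S) UNIV"
    by (rule has_sum_cong_neutral) (use assms in auto)
  finally show ?thesis .
qed

lemma annihilate_has_sum:
  assumes "annihilate j w \<in> fock m"
  shows "((\<lambda>n. real (n j) * (cmod (w n))\<^sup>2) has_sum nsq (annihilate j w)) UNIV"
proof -
  have "(cmod (annihilate j w n))\<^sup>2 = real ((n(j := n j + 1)) j) * (cmod (w (n(j := n j + 1))))\<^sup>2" for n
    by (simp add: annihilate_def norm_mult power_mult_distrib)
  with nsq_has_sum[OF assms] show ?thesis
    using has_sum_shift_up[of j 1 "\<lambda>n. real (n j) * (cmod (w n))\<^sup>2" "nsq (annihilate j w)"] by simp
qed

lemma create_has_sum:
  assumes "create j w \<in> fock m"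
  shows "((\<lambda>n. (real (n j) + 1) * (cmod (w n))\<^sup>2) has_sum nsq (create j w)) UNIV"
proof -
  have "(real (n j) + 1) * (cmod (w n))\<^sup>2 = (cmod (create j w (n(j := n j + 1))))\<^sup>2" for n
    by (simp add: create_def norm_mult power_mult_distrib)
  with nsq_has_sum[OF assms] show ?thesis
    using has_sum_shift_up[of j 1 "\<lambda>n. (cmod (create j w n))\<^sup>2" "nsq (create j w)"]
    by (simp add: create_def)
qed

lemma annihilate2_has_sum:
  assumes "annihilate j (annihilate j w) \<in> fock m"
  shows "((\<lambda>n. real (n j) * (real (n j) - 1) * (cmod (w n))\<^sup>2) has_sum nsq (annihilate j (annihilate j w))) UNIV"
proof -
  have "(cmod (annihilate j (annihilate j w) n))\<^sup>2 =
      real ((n(j := n j + 2)) j) * (real ((n(j := n j + 2)) j) - 1) * (cmod (w (n(j := n j + 2))))\<^sup>2" for n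
    by (simp add: annihilate_def norm_mult power_mult_distrib algebra_simps)
  moreover have "real (n j) * (real (n j) - 1) * (cmod (w n))\<^sup>2 = 0" if "n j < 2" for n
    using that by (cases "n j") auto
  ultimately show ?thesis
    using has_sum_shift_up[of j 2 "\<lambda>n. real (n j) * (real (n j) - 1) * (cmod (w n))\<^sup>2"
        "nsq (annihilate j (annihilate j w))"] nsq_has_sum[OF assms] by simp
qed

lemma create2_has_sum:
  assumes "create j (create j w) \<in> fock m"
  shows "((\<lambda>n. (real (n j) + 1) * (real (n j) + 2) * (cmod (w n))\<^sup>2) has_sum nsq (create j (create j w))) UNIV"
proof -
  have "(real (n j) + 1) * (real (n j) + 2) * (cmod (w n))\<^sup>2 = (cmod (create j (create j w) (n(j := n j + 2))))\<^sup>2" for n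
    by (simp add: create_def norm_mult power_mult_distrib algebra_simps)
  moreover have "(cmod (create j (create j w) n))\<^sup>2 = 0" if "n j < 2" for n
    using that by (cases "n j") (auto simp: create_def)
  ultimately show ?thesis
    using has_sum_shift_up[of j 2 "\<lambda>n. (cmod (create j (create j w) n))\<^sup>2"
        "nsq (create j (create j w))"] nsq_has_sum[OF assms] by simp
qed

lemma quadrature_even: "quadrature (2 * j) w = (\<lambda>n. (annihilate j w n + create j w n) / 2)"
  by (simp add: quadrature_def)

lemma quadrature_odd: "quadrature (2 * j + 1) w = (\<lambda>n. (annihilate j w n - create j w n) / (2 * \<i>))"
  by (simp add: quadrature_def)

lemma annihilate_quadrature:
  "annihilate j w = (\<lambda>n. 1 * quadrature (2 * j) w n + \<i> * quadrature (2 * j + 1) w n)"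
  unfolding quadrature_even quadrature_odd by (auto simp: field_simps)

lemma create_quadrature:
  "create j w = (\<lambda>n. 1 * quadrature (2 * j) w n + (- \<i>) * quadrature (2 * j + 1) w n)"
  unfolding quadrature_even quadrature_odd by (auto simp: field_simps)

lemma nsq_lincomb:
  assumes "\<psi> \<in> fock m" "\<phi> \<in> fock m"
  shows "nsq (\<lambda>n. a * \<psi> n + b * \<phi> n) =
    (cmod a)\<^sup>2 * nsq \<psi> + (cmod b)\<^sup>2 * nsq \<phi> + 2 * Re (cnj a * b * braket \<psi> \<phi>)"
proof -
  have "nsq (\<lambda>n. a * \<psi> n + b * \<phi> n) =
      nsq (\<lambda>n. a * \<psi> n) + nsq (\<lambda>n. b * \<phi> n) + 2 * Re (braket (\<lambda>n. a * \<psi> n) (\<lambda>n. b * \<phi> n))"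
    by (rule nsq_add[OF fock_scale[OF assms(1)] fock_scale[OF assms(2)]])
  then show ?thesis
    by (simp add: nsq_scale braket_scale_left braket_scale_right mult_ac)
qed

text \<open>The weight n + 1/2 is the mean of n and n + 1, which belong to the norms of a w and
  \<open>a\<^sup>\<dagger> w\<close>. Since a = q + \<i> p and
  \<open>a\<^sup>\<dagger> = q - \<i> p\<close>, the cross terms cancel in the sum of the two norms.
  Everything stays at the level of forms, so the vectors q w and p w suffice and q, p are never
  applied twice.\<close>

lemma number_form_mode:
  assumes "quadrature (2 * j) w \<in> fock m" "quadrature (2 * j + 1) w \<in> fock m"
  shows "((\<lambda>n. (real (n j) + 1 / 2) * (cmod (w n))\<^sup>2) has_sum
    nsq (quadrature (2 * j) w) + nsq (quadrature (2 * j + 1) w)) UNIV"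
proof -
  have "annihilate j w \<in> fock m" "create j w \<in> fock m"
    unfolding annihilate_quadrature create_quadrature by (rule fock_lincomb[OF assms])+
  then have "((\<lambda>n. 1 / 2 * (real (n j) * (cmod (w n))\<^sup>2 + (real (n j) + 1) * (cmod (w n))\<^sup>2)) has_sum
      1 / 2 * (nsq (annihilate j w) + nsq (create j w))) UNIV"
    by (intro has_sum_cmult_right has_sum_add annihilate_has_sum create_has_sum)
  moreover have "nsq (annihilate j w) + nsq (create j w) =
      2 * (nsq (quadrature (2 * j) w) + nsq (quadrature (2 * j + 1) w))"
    unfolding annihilate_quadrature[of j w] create_quadrature[of j w]
      nsq_lincomb[OF assms] by simp
  moreover have "1 / 2 * (real (n j) * (cmod (w n))\<^sup>2 + (real (n j) + 1) * (cmod (w n))\<^sup>2) =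
      (real (n j) + 1 / 2) * (cmod (w n))\<^sup>2" for n
    by (simp add: algebra_simps)
  ultimately show ?thesis by (simp add: add_divide_distrib)
qed

lemma sum_pairs: "(\<Sum>l<2 * (m :: nat). f l) = (\<Sum>j<m. f (2 * j) + f (2 * j + 1))"
  by (induction m) (auto simp: algebra_simps)

lemma number_form:
  assumes "\<And>l. l < 2 * m \<Longrightarrow> quadrature l w \<in> fock m"
  shows "((\<lambda>n. (real (\<Sum>j<m. n j) + real m / 2) * (cmod (w n))\<^sup>2) has_sum
    (\<Sum>l<2 * m. nsq (quadrature l w))) UNIV"
proof -
  have "((\<lambda>n. \<Sum>j<m. (real (n j) + 1 / 2) * (cmod (w n))\<^sup>2) has_sum
      (\<Sum>j<m. nsq (quadrature (2 * j) w) + nsq (quadrature (2 * j + 1) w))) UNIV"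
    by (intro has_sum_sum_real number_form_mode[where m = m] assms) auto
  moreover have "(\<Sum>j<m. (real (n j) + 1 / 2) * (cmod (w n))\<^sup>2) =
      (real (\<Sum>j<m. n j) + real m / 2) * (cmod (w n))\<^sup>2" for n
    by (simp add: sum.distrib flip: sum_distrib_right)
  ultimately show ?thesis by (simp only: sum_pairs)
qed

text \<open>Termwise comparison in the number basis: the total occupation is 0 at the vacuum and at
  least 1 at every other pattern, and after subtraction of the zero-point part m/2 the right-hand
  side is the mean total occupation.\<close>

lemma number_form_vacuum_bound:
  assumes w: "w \<in> fock m" and q: "\<And>l. l < 2 * m \<Longrightarrow> quadrature l w \<in> fock m"
  shows "nsq w - (cmod (w (\<lambda>_. 0)))\<^sup>2 \<le> (\<Sum>l<2 * m. nsq (quadrature l w)) - real m / 2 * nsq w"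
proof -
  let ?N = "\<lambda>n :: occ. real (\<Sum>j<m. n j)"
  have a: "((\<lambda>n. (?N n + real m / 2) * (cmod (w n))\<^sup>2 - real m / 2 * (cmod (w n))\<^sup>2) has_sum
      (\<Sum>l<2 * m. nsq (quadrature l w)) - real m / 2 * nsq w) UNIV"
    by (intro has_sum_diff_real number_form q has_sum_cmult_right nsq_has_sum[OF w])
  have "((\<lambda>n. (cmod (w n))\<^sup>2 - (if n = (\<lambda>_. 0) then (cmod (w n))\<^sup>2 else 0)) has_sum
      nsq w - (cmod (w (\<lambda>_. 0)))\<^sup>2) UNIV"
    by (intro has_sum_diff_real nsq_has_sum[OF w] has_sum_finite_neutralI[of "{\<lambda>_. 0}"]) auto
  then show ?thesis
  proof (rule has_sum_mono[OF _ a])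
    fix n :: occ
    have "(cmod (w n))\<^sup>2 \<le> ?N n * (cmod (w n))\<^sup>2" if "n \<noteq> (\<lambda>_. 0)"
    proof (cases "n \<in> occs m")
      case True
      from that obtain j where nj: "n j \<noteq> 0" by auto
      have "\<not> m \<le> j"
      proof
        assume "m \<le> j"
        then have "n j = 0" using True by (simp add: occs_def)
        with nj show False by simp
      qed
      then have "j < m" by simp
      then have "1 \<le> (\<Sum>j<m. n j)" using nj member_le_sum[of j "{..<m}" n] by simp
      then have "1 \<le> ?N n" by linarith
      then show ?thesis using mult_right_mono[of 1 "?N n" "(cmod (w n))\<^sup>2"] by simp
    qed (simp add: fock_zero_outside[OF w])
    then show "(cmod (w n))\<^sup>2 - (if n = (\<lambda>_. 0) then (cmod (w n))\<^sup>2 else 0)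
        \<le> (?N n + real m / 2) * (cmod (w n))\<^sup>2 - real m / 2 * (cmod (w n))\<^sup>2"
      by (auto simp: algebra_simps)
  qed
qed

lemma vacuum_in_fock: "vacuum \<in> fock m"
  unfolding vacuum_def by (rule ket_in_fock[OF zero_in_occs])

lemma nsq_ket: "nsq (ket n) = 1"
  using braket_self[of "ket n"] by (simp add: braket_ket_left) (simp add: ket_def)

lemma number_form_vacuum:
  assumes "\<And>l. l < 2 * m \<Longrightarrow> quadrature l vacuum \<in> fock m"
  shows "(\<Sum>l<2 * m. nsq (quadrature l vacuum)) = real m / 2"
proof -
  have "((\<lambda>n. (real (\<Sum>j<m. n j) + real m / 2) * (cmod (vacuum n))\<^sup>2) has_sum real m / 2) UNIV"
    by (rule has_sum_finite_neutralI[of "{\<lambda>_. 0}"]) (auto simp: vacuum_def ket_def)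
  from has_sum_unique[OF number_form[OF assms] this] show ?thesis by simp
qed

text \<open>The weights of the two norms are (n + 1)(n + 2) and n (n - 1). They differ by 4 n + 2,
  which is at least 2.\<close>

lemma ladder_gap:
  assumes w: "w \<in> fock m" and a: "annihilate j (annihilate j w) \<in> fock m"
    and c: "create j (create j w) \<in> fock m"
  shows "2 * nsq w + nsq (annihilate j (annihilate j w)) \<le> nsq (create j (create j w))"
proof -
  have "((\<lambda>n. 2 * (cmod (w n))\<^sup>2 + real (n j) * (real (n j) - 1) * (cmod (w n))\<^sup>2) has_sum
      2 * nsq w + nsq (annihilate j (annihilate j w))) UNIV"
    by (intro has_sum_add has_sum_cmult_right nsq_has_sum[OF w] annihilate2_has_sum[OF a])
  then show ?thesis
  proof (rule has_sum_mono[OF _ create2_has_sum[OF c]])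
    fix n :: occ
    have "2 + real (n j) * (real (n j) - 1) \<le> (real (n j) + 1) * (real (n j) + 2)"
      by (simp add: algebra_simps)
    from mult_right_mono[OF this, of "(cmod (w n))\<^sup>2"]
    show "2 * (cmod (w n))\<^sup>2 + real (n j) * (real (n j) - 1) * (cmod (w n))\<^sup>2
        \<le> (real (n j) + 1) * (real (n j) + 2) * (cmod (w n))\<^sup>2"
      by (simp add: distrib_right)
  qed
qed

text \<open>The coefficients of a and \<open>a\<^sup>\<dagger>\<close> in a quadrature, so that
  position and momentum share their proofs. The two components are conjugate to each other, which is
  the symmetry of the quadrature.\<close>

definition quad_coeff :: "nat \<Rightarrow> complex \<times> complex" where
  "quad_coeff l = (if even l then (1 / 2, 1 / 2) else (1 / (2 * \<i>), - 1 / (2 * \<i>)))"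

lemma quadrature_coeff:
  "quadrature l \<psi> = (\<lambda>n. fst (quad_coeff l) * annihilate (l div 2) \<psi> n + snd (quad_coeff l) * create (l div 2) \<psi> n)"
  by (auto simp: quadrature_def quad_coeff_def fun_eq_iff field_simps)

lemma annihilate_lincomb:
  "annihilate j (\<lambda>n. a * \<psi> n + b * \<phi> n) = (\<lambda>n. a * annihilate j \<psi> n + b * annihilate j \<phi> n)"
  by (simp add: annihilate_def algebra_simps)

lemma create_lincomb:
  "create j (\<lambda>n. a * \<psi> n + b * \<phi> n) = (\<lambda>n. a * create j \<psi> n + b * create j \<phi> n)"
  by (simp add: create_def algebra_simps)

lemma wave_linear_quadrature: "wave_linear (quadrature l)"
  unfolding wave_linear_def quadrature_coeff annihilate_lincomb create_lincomb
  by (simp add: algebra_simps)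

lemma wave_linear_sym_product: "wave_linear (sym_product l l')"
  unfolding wave_linear_def sym_product_def wave_linearD[OF wave_linear_quadrature]
  by (simp add: algebra_simps add_divide_distrib)

lemma annihilate_annihilate: "annihilate j (annihilate k \<psi>) n = annihilate k (annihilate j \<psi>) n"
  by (cases "j = k") (auto simp: annihilate_def fun_upd_twist)

lemma create_create: "create j (create k \<psi>) n = create k (create j \<psi>) n"
  by (cases "j = k") (auto simp: create_def fun_upd_twist)

text \<open>The commutator is a scalar and c is half of it. Hence either order of the product maps a
  vector of \<open>fock m\<close> into \<open>fock m\<close> as soon as the symmetrised product
  does.\<close>

lemma quadrature_commutator:
  obtains c where "\<And>n. quadrature l (quadrature l' \<psi>) n = sym_product l l' \<psi> n + c * \<psi> n"
    "\<And>n. quadrature l' (quadrature l \<psi>) n = sym_product l l' \<psi> n - c * \<psi> n"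
proof -
  define j k where "j = l div 2" and "k = l' div 2"
  obtain a b where ab: "quad_coeff l = (a, b)" by (cases "quad_coeff l")
  obtain a' b' where ab': "quad_coeff l' = (a', b')" by (cases "quad_coeff l'")
  define c where "c = (a * b' - b * a') * of_bool (j = k)"
  have comm: "annihilate j (create k \<psi>) n = create k (annihilate j \<psi>) n + of_bool (j = k) * \<psi> n" for j k n
    using canonical_commutation[of j k \<psi> n] by (simp add: algebra_simps)
  have "quadrature l (quadrature l' \<psi>) n - quadrature l' (quadrature l \<psi>) n = c * \<psi> n" for n
    unfolding quadrature_coeff[of l] quadrature_coeff[of l'] annihilate_lincomb create_lincomb
      j_def[symmetric] k_def[symmetric] ab ab' fst_conv snd_conv comm
      annihilate_annihilate[of j k] create_create[of j k]
    by (simp add: c_def algebra_simps)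
  then show ?thesis
    by (intro that[of "c / 2"]) (simp_all add: sym_product_def field_simps)
qed

lemma annihilate_ket: "annihilate j (ket n) = (\<lambda>k. of_real (sqrt (real (n j))) * ket (n(j := n j - 1)) k)"
  by (auto simp: annihilate_def ket_def fun_eq_iff)

lemma create_ket: "create j (ket n) = (\<lambda>k. of_real (sqrt (real (n j + 1))) * ket (n(j := n j + 1)) k)"
  by (auto simp: create_def ket_def fun_eq_iff)

lemma fun_upd_occs: "j < m \<Longrightarrow> n(j := i) \<in> occs m \<longleftrightarrow> n \<in> occs m"
  by (auto simp: occs_def)

text \<open>Symmetry of the entrywise action against a number state. It holds for every w in
  \<open>fock m\<close>, even where \<open>quadrature l w\<close> is not square-summable; this is
  what allows relations between such vectors to be read off entry by entry.\<close>

lemma braket_quadrature_ket: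
  assumes n: "n \<in> occs m" and l: "l < 2 * m" and w: "w \<in> fock m"
  shows "braket (quadrature l (ket n)) w = quadrature l w n"
proof -
  have j: "l div 2 < m" using l by simp
  have "annihilate (l div 2) (ket n) \<in> fock m" "create (l div 2) (ket n) \<in> fock m"
    unfolding annihilate_ket create_ket using n j by (auto intro!: fock_scale ket_in_fock simp: fun_upd_occs)
  then have "braket (quadrature l (ket n)) w =
      cnj (fst (quad_coeff l)) * braket (annihilate (l div 2) (ket n)) w
      + cnj (snd (quad_coeff l)) * braket (create (l div 2) (ket n)) w"
    unfolding quadrature_coeff by (intro braket_lincomb_left[OF w])
  also have "braket (annihilate (l div 2) (ket n)) w = create (l div 2) w n"
    unfolding annihilate_ket braket_scale_left braket_ket_left by (simp add: create_def)
  also have "braket (create (l div 2) (ket n)) w = annihilate (l div 2) w n"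
    unfolding create_ket braket_scale_left braket_ket_left by (simp add: annihilate_def)
  also have "cnj (fst (quad_coeff l)) = snd (quad_coeff l)" by (simp add: quad_coeff_def)
  also have "cnj (snd (quad_coeff l)) = fst (quad_coeff l)" by (simp add: quad_coeff_def)
  finally show ?thesis by (simp add: quadrature_coeff)
qed

lemma finite_support_in_finite_fock:
  assumes "finite {n. \<psi> n \<noteq> 0}" "\<And>n. n \<notin> occs m \<Longrightarrow> \<psi> n = 0"
  shows "\<psi> \<in> finite_fock m"
proof -
  have "((\<lambda>n. (cmod (\<psi> n))\<^sup>2) has_sum (\<Sum>n\<in>{n. \<psi> n \<noteq> 0}. (cmod (\<psi> n))\<^sup>2)) UNIV"
    by (rule has_sum_finite_neutralI[OF assms(1)]) auto
  then show ?thesis using assms by (auto simp: finite_fock_def fock_def intro: has_sum_imp_summable)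
qed

lemma annihilate_finite_fock:
  assumes "\<psi> \<in> finite_fock m" "j < m"
  shows "annihilate j \<psi> \<in> finite_fock m"
proof (rule finite_support_in_finite_fock)
  have "inj (\<lambda>n :: occ. n(j := n j + 1))"
    by (rule inj_on_inverseI[where g = "\<lambda>n. n(j := n j - 1)"]) auto
  then have "finite ((\<lambda>n :: occ. n(j := n j + 1)) -` {n. \<psi> n \<noteq> 0})"
    using assms by (intro finite_vimageI) (auto simp: finite_fock_def)
  then show "finite {n. annihilate j \<psi> n \<noteq> 0}"
    by (rule finite_subset[rotated]) (auto simp: annihilate_def)
qed (use assms in \<open>auto simp: annihilate_def finite_fock_def fock_def fun_upd_occs\<close>)

lemma create_finite_fock:
  assumes "\<psi> \<in> finite_fock m" "j < m"
  shows "create j \<psi> \<in> finite_fock m"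
proof (rule finite_support_in_finite_fock)
  have "finite ((\<lambda>n :: occ. n(j := n j + 1)) ` {n. \<psi> n \<noteq> 0})"
    using assms by (intro finite_imageI) (auto simp: finite_fock_def)
  moreover have "{n. create j \<psi> n \<noteq> 0} \<subseteq> (\<lambda>n :: occ. n(j := n j + 1)) ` {n. \<psi> n \<noteq> 0}"
  proof
    fix n assume "n \<in> {n. create j \<psi> n \<noteq> 0}"
    then show "n \<in> (\<lambda>n :: occ. n(j := n j + 1)) ` {n. \<psi> n \<noteq> 0}"
      by (intro image_eqI[of _ _ "n(j := n j - 1)"]) (auto simp: create_def fun_eq_iff)
  qed
  ultimately show "finite {n. create j \<psi> n \<noteq> 0}"
    by (rule finite_subset[rotated])
qed (use assms in \<open>auto simp: create_def finite_fock_def fock_def fun_upd_occs\<close>)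

lemma finite_fock_lincomb:
  assumes "\<psi> \<in> finite_fock m" "\<phi> \<in> finite_fock m"
  shows "(\<lambda>n. a * \<psi> n + b * \<phi> n) \<in> finite_fock m"
proof -
  have "finite ({n. \<psi> n \<noteq> 0} \<union> {n. \<phi> n \<noteq> 0})" using assms by (auto simp: finite_fock_def)
  then have "finite {n. a * \<psi> n + b * \<phi> n \<noteq> 0}" by (rule finite_subset[rotated]) auto
  then show ?thesis using assms by (auto simp: finite_fock_def intro: fock_lincomb)
qed

lemma quadrature_finite_fock:
  "\<psi> \<in> finite_fock m \<Longrightarrow> l < 2 * m \<Longrightarrow> quadrature l \<psi> \<in> finite_fock m"
  unfolding quadrature_coeff
  by (intro finite_fock_lincomb annihilate_finite_fock create_finite_fock) auto

lemma sym_product_finite_fock: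
  assumes "\<psi> \<in> finite_fock m" "l < 2 * m" "l' < 2 * m"
  shows "sym_product l l' \<psi> \<in> finite_fock m"
  using finite_fock_lincomb[of "quadrature l (quadrature l' \<psi>)" m "quadrature l' (quadrature l \<psi>)" "1/2" "1/2"]
  by (simp add: sym_product_def assms quadrature_finite_fock add_divide_distrib)

lemma finite_fock_fock: "\<psi> \<in> finite_fock m \<Longrightarrow> \<psi> \<in> fock m"
  by (simp add: finite_fock_def)

lemma quadrature_zero_outside:
  "w \<in> fock m \<Longrightarrow> l < 2 * m \<Longrightarrow> n \<notin> occs m \<Longrightarrow> quadrature l w n = 0"
  by (auto simp: quadrature_coeff annihilate_def create_def fock_zero_outside fun_upd_occs)

lemma unitary_inv:
  assumes "unitary_op m U" "v \<in> fock m"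
  obtains w where "w \<in> fock m" "U w = v"
proof -
  have "v \<in> U ` fock m" using assms by (simp add: unitary_op_def)
  then show ?thesis using that by auto
qed

lemma unitary_braket:
  "unitary_op m U \<Longrightarrow> \<phi> \<in> fock m \<Longrightarrow> \<psi> \<in> fock m \<Longrightarrow> braket (U \<phi>) (U \<psi>) = braket \<phi> \<psi>"
  by (auto simp: unitary_op_def)

lemma unitary_fock: "unitary_op m U \<Longrightarrow> \<psi> \<in> fock m \<Longrightarrow> U \<psi> \<in> fock m"
  by (auto simp: unitary_op_def bounded_op_def)

section \<open>The transformed number operator\<close>

text \<open>The defining relation of a Gaussian unitary holds on finitely supported vectors only; testing
  against number states and using the symmetry of the quadratures extends it to their domains.\<close>

lemma gaussian_pullback:
  assumes G: "gaussian_unitary m U S x"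
    and sym: "\<And>\<phi> \<psi>. \<phi> \<in> op_domain m (quadrature l) \<Longrightarrow> \<psi> \<in> op_domain m (quadrature l) \<Longrightarrow>
      braket \<phi> (quadrature l \<psi>) = braket (quadrature l \<phi>) \<psi>"
    and l: "l < 2 * m" and v: "v \<in> op_domain m (quadrature l)"
    and w: "w \<in> fock m" "U w = v" and u: "u \<in> fock m" "U u = quadrature l v"
  shows "u = (\<lambda>n. (\<Sum>k<2 * m. of_real (S $$ (l, k)) * quadrature k w n) + of_real (x $ l) * w n)"
proof
  fix n
  have U: "unitary_op m U" using G by (simp add: gaussian_unitary_def)
  show "u n = (\<Sum>k<2 * m. of_real (S $$ (l, k)) * quadrature k w n) + of_real (x $ l) * w n"
  proof (cases "n \<in> occs m")
    case True
    let ?q = "\<lambda>k. quadrature k (ket n)"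
    let ?h = "\<lambda>i. (\<Sum>k<2 * m. of_real (S $$ (l, k)) * ?q k i) + of_real (x $ l) * ket n i"
    have kf: "ket n \<in> fock m" using ket_in_fock[OF True] .
    have qf: "?q k \<in> fock m" if "k < 2 * m" for k
      using finite_fock_fock[OF quadrature_finite_fock[OF ket_in_finite_fock[OF True] that]] .
    have sumf: "(\<lambda>i. \<Sum>k<2 * m. of_real (S $$ (l, k)) * ?q k i) \<in> fock m"
      by (intro fock_sum fock_scale qf) auto
    then have hf: "?h \<in> fock m" using kf by (intro fock_add fock_scale)
    have qU: "quadrature l (U (ket n)) = U ?h"
      using G l ket_in_finite_fock[OF True] by (simp add: gaussian_unitary_def)
    \<comment> \<open>The defining relation itself places U (ket n) in the domain: its right-hand
      side is U of a finitely supported vector.\<close>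
    have dom: "U (ket n) \<in> op_domain m (quadrature l)"
      using qU unitary_fock[OF U kf] unitary_fock[OF U hf] by (simp add: op_domain_def)
    have "u n = braket (ket n) u" by (simp add: braket_ket_left)
    also have "\<dots> = braket (U (ket n)) (quadrature l v)"
      using unitary_braket[OF U kf u(1)] u(2) by simp
    also have "\<dots> = braket (U ?h) (U w)"
      using sym[OF dom v] by (simp add: qU w)
    also have "\<dots> = braket ?h w" by (rule unitary_braket[OF U hf w(1)])
    also have "\<dots> = braket (\<lambda>i. \<Sum>k<2 * m. of_real (S $$ (l, k)) * ?q k i) w
        + braket (\<lambda>i. of_real (x $ l) * ket n i) w"
      using sumf kf by (intro braket_add_left[OF w(1)] fock_scale)
    also have "braket (\<lambda>i. \<Sum>k<2 * m. of_real (S $$ (l, k)) * ?q k i) w =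
        (\<Sum>k<2 * m. of_real (S $$ (l, k)) * braket (?q k) w)"
      by (subst braket_sum_left[OF w(1)]) (auto intro!: fock_scale qf simp: braket_scale_left)
    also have "\<dots> = (\<Sum>k<2 * m. of_real (S $$ (l, k)) * quadrature k w n)"
      by (intro sum.cong) (auto simp: braket_quadrature_ket[OF True _ w(1)])
    also have "braket (\<lambda>i. of_real (x $ l) * ket n i) w = of_real (x $ l) * w n"
      by (simp add: braket_scale_left braket_ket_left)
    finally show ?thesis .
  next
    case False
    then show ?thesis
      using fock_zero_outside[OF u(1) False] fock_zero_outside[OF w(1) False]
        quadrature_zero_outside[OF w(1) _ False] by simp
  qed
qed

lemma nsq_sum_real:
  assumes "\<And>l. l \<in> I \<Longrightarrow> y l \<in> fock m"
  shows "nsq (\<lambda>n. \<Sum>l\<in>I. of_real (c l) * y l n) = (\<Sum>l\<in>I. \<Sum>l'\<in>I. c l * c l' * Re (braket (y l) (y l')))"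
proof -
  let ?z = "\<lambda>n. \<Sum>l\<in>I. complex_of_real (c l) * y l n"
  have z: "?z \<in> fock m" by (intro fock_sum fock_scale assms)
  have "braket ?z ?z = (\<Sum>l\<in>I. of_real (c l) * braket (y l) ?z)"
    by (subst braket_sum_left[OF z]) (auto intro: fock_scale assms simp: braket_scale_left)
  also have "\<dots> = (\<Sum>l\<in>I. of_real (c l) * (\<Sum>l'\<in>I. of_real (c l') * braket (y l) (y l')))"
    by (intro sum.cong refl)
      (subst braket_sum_right[OF assms], auto intro: fock_scale assms simp: braket_scale_right)
  finally have "Re (braket ?z ?z) =
      Re (\<Sum>l\<in>I. of_real (c l) * (\<Sum>l'\<in>I. of_real (c l') * braket (y l) (y l')))"
    by simp
  then show ?thesis by (simp add: braket_self sum_distrib_left mult.assoc)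
qed

text \<open>\<open>M\<close> is the inverse of \<open>S\<close>, so \<open>M\<^sup>T M\<close> is the matrix of \<open>U (\<Sum>k. r\<^sub>k\<^sup>2) U\<^sup>\<dagger>\<close> in \<open>r - x\<close>.\<close>

lemma transformed_number_form:
  fixes M :: "nat \<Rightarrow> nat \<Rightarrow> real"
  assumes G: "gaussian_unitary m U S x"
    and E1: "\<And>l. l < 2 * m \<Longrightarrow> spectral_measure m (quadrature l) (E1 l)"
    and inv: "\<And>k k'. k < 2 * m \<Longrightarrow> k' < 2 * m \<Longrightarrow> (\<Sum>l<2 * m. M k l * S $$ (l, k')) = of_bool (k = k')"
    and v: "\<And>l. l < 2 * m \<Longrightarrow> v \<in> op_domain m (quadrature l)"
    and A: "\<And>l l'. l < 2 * m \<Longrightarrow> l' < 2 * m \<Longrightarrow> v \<in> op_domain m (sym_product l l')"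
    and vf: "v \<in> fock m" and w: "w \<in> fock m" "U w = v"
  shows "\<And>k. k < 2 * m \<Longrightarrow> quadrature k w \<in> fock m"
    and "(\<Sum>k<2 * m. nsq (quadrature k w)) =
      (\<Sum>l<2 * m. \<Sum>l'<2 * m. (\<Sum>k<2 * m. M k l * M k l') *
        (Re (braket v (sym_product l l' v)) - x $ l' * Re (braket v (quadrature l v))
          - x $ l * Re (braket v (quadrature l' v)) + x $ l * x $ l' * nsq v))"
proof -
  have U: "unitary_op m U" using G by (simp add: gaussian_unitary_def)
  have sym: "braket \<phi> (quadrature l \<psi>) = braket (quadrature l \<phi>) \<psi>"
    if "l < 2 * m" "\<phi> \<in> op_domain m (quadrature l)" "\<psi> \<in> op_domain m (quadrature l)" for l \<phi> \<psi>
    using spectral_symmetric[OF E1[OF that(1)] wave_linear_quadrature that(2,3)] .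
  have qv: "quadrature l v \<in> fock m" if "l < 2 * m" for l using v[OF that] by (simp add: op_domain_def)
  have "\<exists>w. w \<in> fock m \<and> U w = quadrature l v" if "l < 2 * m" for l
    using unitary_inv[OF U qv[OF that]] by blast
  then have "\<exists>u. \<forall>l<2 * m. u l \<in> fock m \<and> U (u l) = quadrature l v" by metis
  then obtain u where u: "\<And>l. l < 2 * m \<Longrightarrow> u l \<in> fock m" "\<And>l. l < 2 * m \<Longrightarrow> U (u l) = quadrature l v"
    by auto
  \<comment> \<open>These are the vectors \<open>U\<^sup>-\<^sup>1 (r - x) v\<close>. Unitarity
    makes their Gram matrix that of the vectors (r - x) v, hence a polynomial in the moments of
    v.\<close>
  define y where "y l = (\<lambda>n. u l n - of_real (x $ l) * w n)" for l
  have yf: "y l \<in> fock m" if "l < 2 * m" for l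
    unfolding y_def using u(1)[OF that] w(1) by (intro fock_diff fock_scale)
  have y: "y l n = (\<Sum>k<2 * m. of_real (S $$ (l, k)) * quadrature k w n)" if "l < 2 * m" for l n
    unfolding y_def
    by (subst gaussian_pullback[OF G sym[OF that] that v[OF that] w u(1)[OF that] u(2)[OF that]]) simp_all
  \<comment> \<open>Solving y = S r w for r w. The \<open>y l\<close> are known to lie in
    \<open>fock m\<close>, so this is also where the quadratures of w become
    square-summable.\<close>
  have qw: "quadrature k w = (\<lambda>n. \<Sum>l<2 * m. of_real (M k l) * y l n)" if k: "k < 2 * m" for k
  proof
    fix n
    have "(\<Sum>l<2 * m. of_real (M k l) * y l n) =
        (\<Sum>l<2 * m. \<Sum>k'<2 * m. of_real (M k l * S $$ (l, k')) * quadrature k' w n)"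
      by (intro sum.cong refl) (simp add: y sum_distrib_left mult.assoc)
    also have "\<dots> = (\<Sum>k'<2 * m. of_real (\<Sum>l<2 * m. M k l * S $$ (l, k')) * quadrature k' w n)"
      by (subst sum.swap) (simp add: sum_distrib_right)
    also have "\<dots> = (\<Sum>k'<2 * m. of_bool (k = k') * quadrature k' w n)"
      by (intro sum.cong refl) (simp add: inv[OF k])
    also have "\<dots> = quadrature k w n" using k by (simp add: of_bool_def if_distrib[of "\<lambda>c. c * _"] cong: if_cong)
    finally show "quadrature k w n = (\<Sum>l<2 * m. of_real (M k l) * y l n)" by simp
  qed
  show "quadrature k w \<in> fock m" if "k < 2 * m" for k
    unfolding qw[OF that] by (intro fock_sum fock_scale yf) simp
  have gram: "Re (braket (y l) (y l')) = Re (braket v (sym_product l l' v))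
      - x $ l' * Re (braket v (quadrature l v))
      - x $ l * Re (braket v (quadrature l' v)) + x $ l * x $ l' * nsq v"
    if l: "l < 2 * m" and l': "l' < 2 * m" for l l'
  proof -
    have "braket (y l) (y l') = braket (u l) (u l') - of_real (x $ l') * braket (u l) w
        - of_real (x $ l) * braket w (u l') + of_real (x $ l) * of_real (x $ l') * braket w w"
      unfolding y_def
      using braket_lincomb_lincomb[OF u(1)[OF l] w(1) u(1)[OF l'] w(1), of 1 "- of_real (x $ l)" 1 "- of_real (x $ l')"]
      by simp
    also have "braket (u l) (u l') = braket (quadrature l v) (quadrature l' v)"
      using unitary_braket[OF U u(1)[OF l] u(1)[OF l']] by (simp add: u l l')
    also have "braket (u l) w = braket (quadrature l v) v"
      using unitary_braket[OF U u(1)[OF l] w(1)] by (simp add: u l w)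
    also have "braket w (u l') = braket v (quadrature l' v)"
      using unitary_braket[OF U w(1) u(1)[OF l']] by (simp add: u l' w)
    also have "braket w w = of_real (nsq v)"
      using unitary_braket[OF U w(1) w(1)] by (simp add: w braket_self)
    also have "braket (quadrature l v) v = braket v (quadrature l v)" by (rule sym[symmetric, OF l v[OF l] v[OF l]])
    finally have eq: "Re (braket (y l) (y l')) = Re (braket (quadrature l v) (quadrature l' v))
        - x $ l' * Re (braket v (quadrature l v)) - x $ l * Re (braket v (quadrature l' v))
        + x $ l * x $ l' * nsq v" by simp
    obtain c where c: "\<And>n. quadrature l (quadrature l' v) n = sym_product l l' v n + c * v n"
      "\<And>n. quadrature l' (quadrature l v) n = sym_product l l' v n - c * v n"
      by (rule quadrature_commutator[of l l' v]) auto
    have sf: "sym_product l l' v \<in> fock m" using A[OF l l'] by (simp add: op_domain_def)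
    have qq: "quadrature l (quadrature l' v) = (\<lambda>n. 1 * sym_product l l' v n + c * v n)"
      "quadrature l' (quadrature l v) = (\<lambda>n. 1 * sym_product l l' v n + (- c) * v n)"
      using c by auto
    \<comment> \<open>Both orders differ from the symmetrised product by a multiple of v. So the
      once-applied vectors lie in the domain of the other quadrature, and symmetry can be applied a
      second time.\<close>
    have "quadrature l (quadrature l' v) \<in> fock m" "quadrature l' (quadrature l v) \<in> fock m"
      unfolding qq by (rule fock_lincomb[OF sf vf])+
    then have D: "quadrature l' v \<in> op_domain m (quadrature l)" "quadrature l v \<in> op_domain m (quadrature l')"
      using qv l l' by (auto simp: op_domain_def)
    have "braket (quadrature l v) (quadrature l' v) = braket v (quadrature l (quadrature l' v))"
      using sym[OF l v[OF l] D(1)] by simp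
    moreover have "braket (quadrature l' v) (quadrature l v) = braket v (quadrature l' (quadrature l v))"
      using sym[OF l' v[OF l'] D(2)] by simp
    ultimately have "braket (quadrature l v) (quadrature l' v) + braket (quadrature l' v) (quadrature l v) =
        2 * braket v (sym_product l l' v)"
      unfolding qq braket_lincomb_right[OF vf sf vf] by simp
    from arg_cong[OF this, of Re]
    have "Re (braket (quadrature l v) (quadrature l' v)) + Re (braket (quadrature l' v) (quadrature l v)) =
        2 * Re (braket v (sym_product l l' v))" by simp
    moreover have "Re (braket (quadrature l' v) (quadrature l v)) = Re (braket (quadrature l v) (quadrature l' v))"
      by (metis braket_cnj cnj.sel(1))
    ultimately show ?thesis using eq by simp
  qed
  have "(\<Sum>k<2 * m. nsq (quadrature k w)) =
      (\<Sum>k<2 * m. \<Sum>l<2 * m. \<Sum>l'<2 * m. M k l * M k l' * Re (braket (y l) (y l')))"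
    by (intro sum.cong refl) (simp add: qw, subst nsq_sum_real[of _ _ m], auto intro: yf)
  also have "\<dots> = (\<Sum>l<2 * m. \<Sum>k<2 * m. \<Sum>l'<2 * m. M k l * M k l' * Re (braket (y l) (y l')))"
    by (rule sum.swap)
  also have "\<dots> = (\<Sum>l<2 * m. \<Sum>l'<2 * m. \<Sum>k<2 * m. M k l * M k l' * Re (braket (y l) (y l')))"
    by (intro sum.cong refl sum.swap)
  also have "\<dots> = (\<Sum>l<2 * m. \<Sum>l'<2 * m. (\<Sum>k<2 * m. M k l * M k l') * Re (braket (y l) (y l')))"
    by (simp add: sum_distrib_right)
  finally show "(\<Sum>k<2 * m. nsq (quadrature k w)) =
      (\<Sum>l<2 * m. \<Sum>l'<2 * m. (\<Sum>k<2 * m. M k l * M k l') *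
        (Re (braket v (sym_product l l' v)) - x $ l' * Re (braket v (quadrature l v))
          - x $ l * Re (braket v (quadrature l' v)) + x $ l * x $ l' * nsq v))"
    by (simp add: gram)
qed

section \<open>The inverse of S in Euler form\<close>

lemma mat_mult_index:
  assumes "A \<in> carrier_mat n n'" "B \<in> carrier_mat n' n''" "i < n" "j < n''"
  shows "(A * B) $$ (i, j) = (\<Sum>l<n'. A $$ (i, l) * B $$ (l, j))"
  using assms by (simp add: scalar_prod_def atLeast0LessThan)

lemma mat_cancel_left:
  fixes A :: "real mat"
  assumes "A \<in> carrier_mat n n" "B \<in> carrier_mat n n" "X \<in> carrier_mat n n" "A * B = 1\<^sub>m n"
  shows "A * (B * X) = X"
  using assoc_mult_mat[OF assms(1-3)] assms by simp

lemma squeeze_entry_pos: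
  "(\<And>j. j < m \<Longrightarrow> 1 \<le> s j) \<Longrightarrow> i < 2 * m \<Longrightarrow> 0 < squeeze_entry s i"
proof -
  assume s: "\<And>j. j < m \<Longrightarrow> 1 \<le> s j" and i: "i < 2 * m"
  then have "1 \<le> s (i div 2)" by simp
  then show ?thesis by (simp add: squeeze_entry_def)
qed

lemma mat_diag_cong: "(\<And>i. i < n \<Longrightarrow> f i = g i) \<Longrightarrow> mat_diag n f = mat_diag n g"
  by (auto simp: mat_diag_def)

text \<open>For S = R D V the inverse is \<open>M = V\<^sup>T D\<^sup>-\<^sup>1 R\<^sup>T\<close>.
  In \<open>M\<^sup>T M\<close> the factor V meets its transpose and cancels, so the weight matrix
  depends on R and D alone.\<close>

lemma gaussian_inverse:
  assumes "euler_decomposition m S R s"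
  obtains M :: "nat \<Rightarrow> nat \<Rightarrow> real" where
    "\<And>k k'. k < 2 * m \<Longrightarrow> k' < 2 * m \<Longrightarrow> (\<Sum>l<2 * m. M k l * S $$ (l, k')) = of_bool (k = k')"
    "\<And>l l'. l < 2 * m \<Longrightarrow> l' < 2 * m \<Longrightarrow>
      (\<Sum>k<2 * m. M k l * M k l') = (R * squeeze_inv_sq m s * transpose_mat R) $$ (l, l')"
proof -
  let ?n = "2 * m"
  obtain V where V: "passive_mat m V" and S: "S = R * squeeze_mat m s * V"
    and R: "passive_mat m R" and s: "\<And>j. j < m \<Longrightarrow> 1 \<le> s j"
    using assms by (auto simp: euler_decomposition_def)
  define D J where "D = squeeze_mat m s" and "J = mat_diag ?n (\<lambda>i. inverse (squeeze_entry s i))"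
  have c: "R \<in> carrier_mat ?n ?n" "V \<in> carrier_mat ?n ?n" "D \<in> carrier_mat ?n ?n" "J \<in> carrier_mat ?n ?n"
    "transpose_mat R \<in> carrier_mat ?n ?n" "transpose_mat V \<in> carrier_mat ?n ?n"
    using R V by (auto simp: passive_mat_def symplectic_def D_def J_def squeeze_mat_def)
  have RR: "transpose_mat R * R = 1\<^sub>m ?n" and VV: "transpose_mat V * V = 1\<^sub>m ?n"
    using R V mat_mult_left_right_inverse[OF c(1) c(5)] mat_mult_left_right_inverse[OF c(2) c(6)]
    by (auto simp: passive_mat_def)
  have VV': "V * transpose_mat V = 1\<^sub>m ?n" using V by (simp add: passive_mat_def)
  have JD: "J * D = 1\<^sub>m ?n"
    unfolding J_def D_def squeeze_mat_def mat_diag_diag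
    by (subst mat_diag_one[symmetric], rule mat_diag_cong) (use squeeze_entry_pos[of m s] s in force)
  have JJ: "J * J = squeeze_inv_sq m s"
    unfolding J_def squeeze_inv_sq_def mat_diag_diag by (simp add: power2_eq_square)
  define N where "N = transpose_mat V * (J * transpose_mat R)"
  have JR: "J * transpose_mat R \<in> carrier_mat ?n ?n" using c by simp
  have DV: "D * V \<in> carrier_mat ?n ?n" using c by simp
  have N: "N \<in> carrier_mat ?n ?n" unfolding N_def using c JR by (intro mult_carrier_mat)
  have Sc: "S = R * (D * V)" unfolding S D_def[symmetric] using c by (intro assoc_mult_mat)
  have "N * S = transpose_mat V * ((J * transpose_mat R) * (R * (D * V)))"
    unfolding N_def Sc using c JR DV by (intro assoc_mult_mat mult_carrier_mat)
  also have "(J * transpose_mat R) * (R * (D * V)) = J * (transpose_mat R * (R * (D * V)))"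
    using c DV by (intro assoc_mult_mat mult_carrier_mat)
  also have "transpose_mat R * (R * (D * V)) = D * V"
    by (rule mat_cancel_left[OF c(5) c(1) DV RR])
  also have "J * (D * V) = V" by (rule mat_cancel_left[OF c(4) c(3) c(2) JD])
  finally have NS: "N * S = 1\<^sub>m ?n" using VV by simp
  have Jt: "transpose_mat J = J" by (auto simp: J_def mat_diag_def)
  have "transpose_mat N = transpose_mat (J * transpose_mat R) * transpose_mat (transpose_mat V)"
    unfolding N_def by (rule transpose_mult[OF c(6) JR])
  also have "transpose_mat (J * transpose_mat R) = R * J"
    using transpose_mult[OF c(4) c(5)] by (simp add: Jt)
  finally have Nt: "transpose_mat N = R * J * V" by simp
  have RJ: "R * J \<in> carrier_mat ?n ?n" using c by simp
  have "transpose_mat N * N = (R * J) * (V * (transpose_mat V * (J * transpose_mat R)))"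
    unfolding Nt using N c(2) RJ unfolding N_def by (intro assoc_mult_mat)
  also have "V * (transpose_mat V * (J * transpose_mat R)) = J * transpose_mat R"
    by (rule mat_cancel_left[OF c(2) c(6) JR VV'])
  also have "(R * J) * (J * transpose_mat R) = ((R * J) * J) * transpose_mat R"
    using RJ c by (intro assoc_mult_mat[symmetric])
  also have "(R * J) * J = R * squeeze_inv_sq m s"
    using assoc_mult_mat[OF c(1) c(4) c(4)] JJ by simp
  finally have NN: "transpose_mat N * N = R * squeeze_inv_sq m s * transpose_mat R" .
  have Scar: "S \<in> carrier_mat ?n ?n" unfolding Sc using c(1) DV by simp
  show thesis
  proof (rule that[of "\<lambda>k l. N $$ (k, l)"])
    fix k k' assume k: "k < 2 * m" "k' < 2 * m"
    show "(\<Sum>l<2 * m. N $$ (k, l) * S $$ (l, k')) = of_bool (k = k')"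
      unfolding mat_mult_index[OF N Scar k, symmetric] NS using k by simp
  next
    fix l l' assume l: "l < 2 * m" "l' < 2 * m"
    have "(transpose_mat N * N) $$ (l, l') = (\<Sum>k<2 * m. transpose_mat N $$ (l, k) * N $$ (k, l'))"
      using N l by (intro mat_mult_index) auto
    also have "\<dots> = (\<Sum>k<2 * m. N $$ (k, l) * N $$ (k, l'))"
      using N l by (intro sum.cong) auto
    finally show "(\<Sum>k<2 * m. N $$ (k, l) * N $$ (k, l')) = (R * squeeze_inv_sq m s * transpose_mat R) $$ (l, l')"
      by (simp add: NN)
  qed
qed

section \<open>The fidelity bound at the true moments\<close>

lemma density_decomposition:
  assumes "density_op m \<rho>"
  obtains v where "pure_decomposition m \<rho> v" "trace_op m \<rho> = 1" "positive_op m \<rho>"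
  using positive_op_decomposition[OF density_op_positive[OF assms]] density_op_positive[OF assms] assms
  by (auto simp: density_op_def)

text \<open>A finite second moment of the mixture is one of every component, and a spectral measure
  has the same domain as its operator; so each component lies in that domain. Means and centred
  second moments then add up over the components. The centre c is free, so the mean of the mixture
  can be used for all of them.\<close>

lemma mixture_mean:
  assumes v: "pure_decomposition m \<rho> v" and tr: "trace_op m \<rho> = 1" and \<rho>: "positive_op m \<rho>"
    and A: "spectral_measure m A E" and int: "integrable (born_law m E \<rho>) (\<lambda>x. x\<^sup>2)"
  shows "v k \<in> op_domain m A"
    and "(\<lambda>k. Re (braket (v k) (A (v k)))) sums (\<integral>x. x \<partial>born_law m E \<rho>)"
    and "(\<lambda>k. \<integral>x. (x - c)\<^sup>2 \<partial>pure_law E (v k)) sums (\<integral>x. (x - c)\<^sup>2 \<partial>born_law m E \<rho>)"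
proof -
  have vf: "v k \<in> fock m" for k using v by (simp add: pure_decomposition_def)
  have E: "pvm m E" by (rule spectral_measure_pvm[OF A])
  interpret prob_space "born_law m E \<rho>" by (rule prob_space_born_law[OF v tr \<rho> E])
  note mix = integral_mixture[OF sets_born_law sets_pure_law emeasure_born_law[OF v tr \<rho> E]]
  have "integrable (pure_law E (v k)) (\<lambda>x. x\<^sup>2)" for k using mix(1)[OF _ int] by simp
  then show dom: "v k \<in> op_domain m A" for k using spectral_measure_domain[OF A vf] by simp
  have i1: "integrable (born_law m E \<rho>) (\<lambda>x. x)" and i2: "integrable (born_law m E \<rho>) (\<lambda>x. (x - c)\<^sup>2)"
    using integrable_square_imp[OF finite_measure_axioms sets_born_law int] by auto
  show "(\<lambda>k. Re (braket (v k) (A (v k)))) sums (\<integral>x. x \<partial>born_law m E \<rho>)"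
    using mix(2)[OF _ i1] by (simp add: spectral_measure_mean[OF A dom])
  show "(\<lambda>k. \<integral>x. (x - c)\<^sup>2 \<partial>pure_law E (v k)) sums (\<integral>x. (x - c)\<^sup>2 \<partial>born_law m E \<rho>)"
    using mix(2)[OF _ i2] by simp
qed

text \<open>The fidelity bound at the true moments, written symmetrically: as the weight matrix is
  symmetric, twice \<open>\<gamma> x\<^sup>T\<close> may be replaced by
  \<open>\<gamma> x\<^sup>T + x \<gamma>\<^sup>T\<close> under the trace. In this form it matches
  the Gram matrix of the vectors (r - x) v.\<close>

definition true_bound ::
  "config \<Rightarrow> (nat \<Rightarrow> real set \<Rightarrow> op) \<Rightarrow> (nat \<Rightarrow> nat \<Rightarrow> real set \<Rightarrow> op) \<Rightarrow> op \<Rightarrow> real" where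
  "true_bound P E1 E2 \<rho> =
     (let m = modes P; x = displacement P;
          \<gamma> = (\<lambda>l. \<integral>z. z \<partial>born_law m (E1 l) \<rho>); \<Gamma> = (\<lambda>l l'. \<integral>z. z \<partial>born_law m (E2 l l') \<rho>)
      in 1 + real m / 2 - (\<Sum>l<2 * m. \<Sum>l'<2 * m. weight_mat P $$ (l, l') *
           (\<Gamma> l l' - x $ l' * \<gamma> l - x $ l * \<gamma> l' + x $ l * x $ l')))"

text \<open>The quadratic form of \<open>U (\<Sum>k. r\<^sub>k\<^sup>2) U\<^sup>\<dagger>\<close> at
  an unnormalised vector; the factor \<open>nsq v\<close> accounts for the missing normalisation in
  the constant term.\<close>

definition energy :: "config \<Rightarrow> wave \<Rightarrow> real" where
  "energy P v =
     (let m = modes P; x = displacement P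
      in \<Sum>l<2 * m. \<Sum>l'<2 * m. weight_mat P $$ (l, l') *
           (Re (braket v (sym_product l l' v)) - x $ l' * Re (braket v (quadrature l v))
             - x $ l * Re (braket v (quadrature l' v)) + x $ l * x $ l' * nsq v))"

context
  fixes P :: config and U S E1 E2 and m :: nat and x :: "real vec" and \<phi> :: wave
  defines "m \<equiv> modes P" and "x \<equiv> displacement P" and "\<phi> \<equiv> U vacuum"
  assumes G: "gaussian_unitary m U S x"
    and eu: "euler_decomposition m S (orth P) (squeezing P)"
    and E: "quadrature_measurements m E1 E2"
begin

lemma U_unitary: "unitary_op m U"
  using G by (simp add: gaussian_unitary_def)

lemma target_fock: "\<phi> \<in> fock m"
  unfolding \<phi>_def by (rule unitary_fock[OF U_unitary vacuum_in_fock])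

lemma nsq_target: "nsq \<phi> = 1"
proof -
  have "complex_of_real (nsq \<phi>) = of_real (nsq vacuum)"
    using unitary_braket[OF U_unitary vacuum_in_fock vacuum_in_fock] by (simp add: braket_self \<phi>_def)
  then show ?thesis by (simp add: vacuum_def nsq_ket)
qed

lemma energy_pullback:
  assumes v: "\<And>l. l < 2 * m \<Longrightarrow> v \<in> op_domain m (quadrature l)"
    and A: "\<And>l l'. l < 2 * m \<Longrightarrow> l' < 2 * m \<Longrightarrow> v \<in> op_domain m (sym_product l l')"
    and w: "w \<in> fock m" "U w = v"
  shows "\<And>k. k < 2 * m \<Longrightarrow> quadrature k w \<in> fock m"
    and "energy P v = (\<Sum>k<2 * m. nsq (quadrature k w))"
proof -
  obtain M :: "nat \<Rightarrow> nat \<Rightarrow> real" where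
    inv: "\<And>k k'. k < 2 * m \<Longrightarrow> k' < 2 * m \<Longrightarrow> (\<Sum>l<2 * m. M k l * S $$ (l, k')) = of_bool (k = k')"
    and MM: "\<And>l l'. l < 2 * m \<Longrightarrow> l' < 2 * m \<Longrightarrow> (\<Sum>k<2 * m. M k l * M k l') = weight_mat P $$ (l, l')"
    using gaussian_inverse[OF eu, unfolded m_def, folded weight_mat_def] unfolding m_def by blast
  have E1: "spectral_measure m (quadrature l) (E1 l)" if "l < 2 * m" for l
    using E that by (simp add: quadrature_measurements_def)
  have vf: "v \<in> fock m" using unitary_fock[OF U_unitary w(1)] w(2) by simp
  note t = transformed_number_form[OF G E1 inv v A vf w]
  show "quadrature k w \<in> fock m" if "k < 2 * m" for k using t(1) that by simp
  show "energy P v = (\<Sum>k<2 * m. nsq (quadrature k w))"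
    using t(2) by (simp add: energy_def Let_def MM flip: m_def x_def)
qed

lemma energy_ge:
  assumes v: "\<And>l. l < 2 * m \<Longrightarrow> v \<in> op_domain m (quadrature l)"
    and A: "\<And>l l'. l < 2 * m \<Longrightarrow> l' < 2 * m \<Longrightarrow> v \<in> op_domain m (sym_product l l')"
    and vf: "v \<in> fock m"
  shows "nsq v - (cmod (braket \<phi> v))\<^sup>2 \<le> energy P v - real m / 2 * nsq v"
proof -
  obtain w where w: "w \<in> fock m" "U w = v" using unitary_inv[OF U_unitary vf] .
  have "complex_of_real (nsq v) = of_real (nsq w)"
    using unitary_braket[OF U_unitary w(1) w(1)] w(2) by (simp add: braket_self)
  then have "nsq v = nsq w" by simp
  moreover have "braket \<phi> v = w (\<lambda>_. 0)"
    using unitary_braket[OF U_unitary vacuum_in_fock w(1)] w(2)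
    by (simp add: \<phi>_def vacuum_def braket_ket_left)
  ultimately show ?thesis
    using number_form_vacuum_bound[OF w(1) energy_pullback(1)[OF v A w]] energy_pullback(2)[OF v A w]
    by simp
qed

text \<open>The target pulls back to the vacuum, where only the zero-point energy 1/2 of each mode
  is left.\<close>

lemma energy_target:
  assumes "\<And>l. l < 2 * m \<Longrightarrow> \<phi> \<in> op_domain m (quadrature l)"
    and "\<And>l l'. l < 2 * m \<Longrightarrow> l' < 2 * m \<Longrightarrow> \<phi> \<in> op_domain m (sym_product l l')"
  shows "energy P \<phi> = real m / 2"
proof -
  have "U vacuum = \<phi>" by (simp add: \<phi>_def)
  note e = energy_pullback[OF assms vacuum_in_fock this]
  show ?thesis using e(2) number_form_vacuum[OF e(1)] by simp
qed

lemma preparation_moments: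
  assumes \<rho>: "\<rho> \<in> preparations P E1 E2" and v: "pure_decomposition m \<rho> v"
  shows "\<And>l k. l < 2 * m \<Longrightarrow> v k \<in> op_domain m (quadrature l)"
    and "\<And>l l' k. l < 2 * m \<Longrightarrow> l' < 2 * m \<Longrightarrow> v k \<in> op_domain m (sym_product l l')"
    and "(\<lambda>k. energy P (v k)) sums (1 + real m / 2 - true_bound P E1 E2 \<rho>)"
proof -
  have d: "density_op m \<rho>" using \<rho> by (simp add: preparations_def m_def)
  then have tr: "trace_op m \<rho> = 1" and pos: "positive_op m \<rho>"
    by (auto simp: density_op_def density_op_positive)
  have E1: "spectral_measure m (quadrature l) (E1 l)" if "l < 2 * m" for l
    using E that by (simp add: quadrature_measurements_def)
  have E2: "spectral_measure m (sym_product l l') (E2 l l')" if "l < 2 * m" "l' < 2 * m" for l l'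
    using E that by (simp add: quadrature_measurements_def)
  have i1: "integrable (born_law m (E1 l) \<rho>) (\<lambda>x. x\<^sup>2)" if "l < 2 * m" for l
    using \<rho> that by (simp add: preparations_def m_def variance_at_most_def)
  have i2: "integrable (born_law m (E2 l l') \<rho>) (\<lambda>x. x\<^sup>2)" if "l < 2 * m" "l' < 2 * m" for l l'
    using \<rho> that by (simp add: preparations_def m_def variance_at_most_def)
  note m1 = mixture_mean[OF v tr pos E1 i1] and m2 = mixture_mean[OF v tr pos E2 i2]
  show "v k \<in> op_domain m (quadrature l)" if "l < 2 * m" for l k using m1(1) that by simp
  show "v k \<in> op_domain m (sym_product l l')" if "l < 2 * m" "l' < 2 * m" for l l' k
    using m2(1) that by simp
  have "(\<lambda>k. \<Sum>l<2 * m. \<Sum>l'<2 * m. weight_mat P $$ (l, l') *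
      (Re (braket (v k) (sym_product l l' (v k))) - x $ l' * Re (braket (v k) (quadrature l (v k)))
       - x $ l * Re (braket (v k) (quadrature l' (v k))) + x $ l * x $ l' * nsq (v k))) sums
    (\<Sum>l<2 * m. \<Sum>l'<2 * m. weight_mat P $$ (l, l') *
      ((\<integral>z. z \<partial>born_law m (E2 l l') \<rho>) - x $ l' * (\<integral>z. z \<partial>born_law m (E1 l) \<rho>)
       - x $ l * (\<integral>z. z \<partial>born_law m (E1 l') \<rho>) + x $ l * x $ l' * 1))"
    by (intro sums_sum sums_mult sums_add sums_diff m1(2) m2(2) pure_decomposition_weight(1)[OF v tr]) auto
  then show "(\<lambda>k. energy P (v k)) sums (1 + real m / 2 - true_bound P E1 E2 \<rho>)"
    unfolding energy_def true_bound_def Let_def m_def[symmetric] x_def[symmetric] by simp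
qed

lemma true_bound_le_fidelity:
  assumes \<rho>: "\<rho> \<in> preparations P E1 E2"
  shows "true_bound P E1 E2 \<rho> \<le> fidelity m (ketbra \<phi> \<phi>) \<rho>"
proof -
  have "density_op m \<rho>" using \<rho> by (simp add: preparations_def m_def)
  then obtain v where v: "pure_decomposition m \<rho> v" and tr: "trace_op m \<rho> = 1"
    by (rule density_decomposition)
  then have vf: "v k \<in> fock m" for k by (simp add: pure_decomposition_def)
  note mom = preparation_moments[OF \<rho> v]
  note w = pure_decomposition_weight(1)[OF v tr]
  have "(\<lambda>k. nsq (v k) - (cmod (braket \<phi> (v k)))\<^sup>2) sums (1 - fidelity m (ketbra \<phi> \<phi>) \<rho>)"
    by (intro sums_diff w fidelity_decomposition[OF v tr target_fock nsq_target])
  moreover have "(\<lambda>k. energy P (v k) - real m / 2 * nsq (v k)) sums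
      (1 + real m / 2 - true_bound P E1 E2 \<rho> - real m / 2 * 1)"
    by (intro sums_diff mom(3) sums_mult w)
  ultimately have "1 - fidelity m (ketbra \<phi> \<phi>) \<rho> \<le> 1 + real m / 2 - true_bound P E1 E2 \<rho> - real m / 2 * 1"
    by (rule sums_le[rotated]) (intro energy_ge mom vf)
  then show ?thesis by simp
qed

lemma true_bound_target:
  assumes \<rho>: "ketbra \<phi> \<phi> \<in> preparations P E1 E2"
  shows "true_bound P E1 E2 (ketbra \<phi> \<phi>) = 1"
proof -
  let ?v = "\<lambda>k n. if k = (0 :: nat) then \<phi> n else 0"
  note mom = preparation_moments[OF \<rho> pure_state_decomposition[OF target_fock]]
  have sums: "(\<lambda>k. energy P (?v k)) sums (\<Sum>k\<in>{0}. energy P (?v k))"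
  proof (rule sums_finite)
    fix k :: nat assume "k \<notin> {0}"
    then have z: "?v k = (\<lambda>n. 0)" by simp
    have "braket (\<lambda>n. 0) \<psi> = 0" for \<psi> by (simp add: braket_def)
    then show "energy P (?v k) = 0" unfolding z by (simp add: energy_def nsq_def)
  qed simp
  have "energy P \<phi> = real m / 2"
    using mom(1)[of _ 0] mom(2)[of _ _ 0] by (intro energy_target) simp_all
  then show ?thesis using sums_unique2[OF mom(3) sums] by simp
qed

end

section \<open>Concentration of linear estimators\<close>

text \<open>The one-sided inequality is needed: the two-sided one fails when \<open>\<alpha>\<close> is close to \<open>1\<close>.\<close>

lemma (in prob_space) Cantelli:
  assumes X: "integrable M X" "integrable M (\<lambda>\<omega>. (X \<omega>)\<^sup>2)" and mean: "expectation X = 0"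
    and var: "expectation (\<lambda>\<omega>. (X \<omega>)\<^sup>2) \<le> V" and t: "0 < t"
  shows "prob {\<omega> \<in> space M. t \<le> X \<omega>} \<le> V / (V + t\<^sup>2)"
proof -
  have "0 \<le> expectation (\<lambda>\<omega>. (X \<omega>)\<^sup>2)" by simp
  with var have V: "0 \<le> V" by linarith
  \<comment> \<open>The value of s that minimises \<open>(V + s\<^sup>2) / (s + t)\<^sup>2\<close>,
    the Markov bound for the squared shifted variable.\<close>
  define s where "s = V / t"
  have st: "0 < s + t" using V t by (simp add: s_def add_nonneg_pos)
  have eq: "(X \<omega> + s)\<^sup>2 = (X \<omega>)\<^sup>2 + 2 * s * X \<omega> + s\<^sup>2" for \<omega> by (simp add: power2_eq_square algebra_simps)
  have int: "integrable M (\<lambda>\<omega>. (X \<omega> + s)\<^sup>2)" unfolding eq using X by simp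
  have "prob {\<omega> \<in> space M. t \<le> X \<omega>} \<le> prob {\<omega> \<in> space M. (s + t)\<^sup>2 \<le> (X \<omega> + s)\<^sup>2}"
  proof (rule finite_measure_mono)
    show "{\<omega> \<in> space M. t \<le> X \<omega>} \<subseteq> {\<omega> \<in> space M. (s + t)\<^sup>2 \<le> (X \<omega> + s)\<^sup>2}"
      using st by (auto intro!: power_mono)
    show "{\<omega> \<in> space M. (s + t)\<^sup>2 \<le> (X \<omega> + s)\<^sup>2} \<in> sets M"
      using X by measurable
  qed
  also have "\<dots> \<le> expectation (\<lambda>\<omega>. (X \<omega> + s)\<^sup>2) / (s + t)\<^sup>2"
    using st int by (intro integral_Markov_inequality_measure[where A = "{}"]) auto
  also have "\<dots> \<le> (V + s\<^sup>2) / (s + t)\<^sup>2"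
    unfolding eq using X mean var by (intro divide_right_mono) (auto simp: prob_space)
  also have "\<dots> = V / (V + t\<^sup>2)"
  proof -
    have "V + t\<^sup>2 > 0" using V t by (simp add: add_nonneg_pos)
    have "s + t = (V + t\<^sup>2) / t" using t by (simp add: s_def field_simps power2_eq_square)
    moreover have "V + s\<^sup>2 = V * (V + t\<^sup>2) / t\<^sup>2"
      using t by (simp add: s_def field_simps power2_eq_square)
    ultimately show ?thesis using t \<open>V + t\<^sup>2 > 0\<close> by (simp add: power_divide power2_eq_square)
  qed
  finally show ?thesis .
qed

section \<open>Second moments and tails of linear statistics of independent outcomes\<close>

context product_prob_space
begin

text \<open>The product of two coordinates is written as a product over all of I with factor 1
  elsewhere, so that integration factorises. For i \<noteq> j a factor with mean 0 remains; for i =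
  j the two factors merge into a square.\<close>

lemma product_coordinate_moment:
  assumes I: "finite I" "i \<in> I" "j \<in> I"
    and f: "\<And>k. k \<in> I \<Longrightarrow> integrable (M k) (f k)" "\<And>k. k \<in> I \<Longrightarrow> integrable (M k) (\<lambda>x. (f k x)\<^sup>2)"
    and mean: "\<And>k. k \<in> I \<Longrightarrow> (\<integral>x. f k x \<partial>M k) = (0 :: real)"
  shows "integrable (Pi\<^sub>M I M) (\<lambda>\<omega>. f i (\<omega> i) * f j (\<omega> j))"
    and "(\<integral>\<omega>. f i (\<omega> i) * f j (\<omega> j) \<partial>Pi\<^sub>M I M) = of_bool (i = j) * (\<integral>x. (f i x)\<^sup>2 \<partial>M i)"
proof -
  define g where "g k x = (if k = i then if k = j then (f k x)\<^sup>2 else f k x else if k = j then f k x else 1)" for k x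
  have int: "integrable (M k) (g k)" if "k \<in> I" for k
    using f[OF that] unfolding g_def by (cases "k = i"; cases "k = j") auto
  have prod: "(\<Prod>k\<in>I. g k (\<omega> k)) = f i (\<omega> i) * f j (\<omega> j)" for \<omega>
  proof (cases "i = j")
    case True
    have "(\<Prod>k\<in>I. g k (\<omega> k)) = g i (\<omega> i) * (\<Prod>k\<in>I - {i}. g k (\<omega> k))"
      using I by (simp add: prod.remove)
    also have "(\<Prod>k\<in>I - {i}. g k (\<omega> k)) = 1" by (rule prod.neutral) (auto simp: g_def True)
    finally show ?thesis by (simp add: g_def True power2_eq_square)
  next
    case False
    have "(\<Prod>k\<in>I. g k (\<omega> k)) = g i (\<omega> i) * (\<Prod>k\<in>I - {i}. g k (\<omega> k))"
      using I by (simp add: prod.remove)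
    also have "(\<Prod>k\<in>I - {i}. g k (\<omega> k)) = g j (\<omega> j) * (\<Prod>k\<in>I - {i} - {j}. g k (\<omega> k))"
      using I False by (intro prod.remove) auto
    also have "(\<Prod>k\<in>I - {i} - {j}. g k (\<omega> k)) = 1" by (rule prod.neutral) (auto simp: g_def)
    finally show ?thesis using False by (simp add: g_def)
  qed
  show "integrable (Pi\<^sub>M I M) (\<lambda>\<omega>. f i (\<omega> i) * f j (\<omega> j))"
    using product_integrable_prod[OF I(1) int] by (simp add: prod)
  have "(\<integral>\<omega>. f i (\<omega> i) * f j (\<omega> j) \<partial>Pi\<^sub>M I M) = (\<Prod>k\<in>I. \<integral>x. g k x \<partial>M k)"
    using product_integral_prod[OF I(1) int] by (simp add: prod)
  also have "\<dots> = of_bool (i = j) * (\<integral>x. (f i x)\<^sup>2 \<partial>M i)"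
  proof (cases "i = j")
    case True
    have "(\<Prod>k\<in>I. \<integral>x. g k x \<partial>M k) = (\<integral>x. g i x \<partial>M i) * (\<Prod>k\<in>I - {i}. \<integral>x. g k x \<partial>M k)"
      using I by (simp add: prod.remove)
    also have "(\<Prod>k\<in>I - {i}. \<integral>x. g k x \<partial>M k) = 1"
      by (rule prod.neutral) (auto simp: g_def True M.prob_space)
    finally show ?thesis by (simp add: g_def True)
  next
    case False
    have "(\<integral>x. g i x \<partial>M i) = 0" using mean[OF I(2)] False by (simp add: g_def)
    then show ?thesis using I False by (auto simp: prod_zero_iff)
  qed
  finally show "(\<integral>\<omega>. f i (\<omega> i) * f j (\<omega> j) \<partial>Pi\<^sub>M I M) = of_bool (i = j) * (\<integral>x. (f i x)\<^sup>2 \<partial>M i)" .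
qed

lemma product_linear_tail:
  assumes I: "finite I"
    and f: "\<And>k. k \<in> I \<Longrightarrow> integrable (M k) (f k)" "\<And>k. k \<in> I \<Longrightarrow> integrable (M k) (\<lambda>x. (f k x)\<^sup>2)"
    and mean: "\<And>k. k \<in> I \<Longrightarrow> (\<integral>x. f k x \<partial>M k) = (0 :: real)"
    and V: "(\<Sum>k\<in>I. \<integral>x. (f k x)\<^sup>2 \<partial>M k) \<le> V" and t: "0 < t"
  shows "measure (Pi\<^sub>M I M) {\<omega> \<in> space (Pi\<^sub>M I M). t \<le> (\<Sum>k\<in>I. f k (\<omega> k))} \<le> V / (V + t\<^sup>2)"
proof (rule prob_space.Cantelli)
  show "prob_space (Pi\<^sub>M I M)" by (rule prob_space_PiM) (rule M.prob_space_axioms)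
  have one: "integrable (Pi\<^sub>M I M) (\<lambda>\<omega>. f i (\<omega> i)) \<and> (\<integral>\<omega>. f i (\<omega> i) \<partial>Pi\<^sub>M I M) = 0" if i: "i \<in> I" for i
  proof -
    interpret P: prob_space "Pi\<^sub>M I M" by fact
    have d: "distr (Pi\<^sub>M I M) (M i) (\<lambda>\<omega>. \<omega> i) = M i" by (rule PiM_component[OF i])
    have m: "(\<lambda>\<omega>. \<omega> i) \<in> measurable (Pi\<^sub>M I M) (M i)" by (rule measurable_component_singleton[OF i])
    show ?thesis
      using integrable_distr_eq[OF m, of "f i"] integral_distr[OF m, of "f i"] f(1)[OF i] mean[OF i]
      by (simp add: d)
  qed
  show "integrable (Pi\<^sub>M I M) (\<lambda>\<omega>. \<Sum>k\<in>I. f k (\<omega> k))" using one by auto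
  show "(\<integral>\<omega>. (\<Sum>k\<in>I. f k (\<omega> k)) \<partial>Pi\<^sub>M I M) = 0" using one by (simp add: Bochner_Integration.integral_sum)
  have sq: "(\<Sum>k\<in>I. f k (\<omega> k))\<^sup>2 = (\<Sum>i\<in>I. \<Sum>j\<in>I. f i (\<omega> i) * f j (\<omega> j))" for \<omega>
    by (simp add: power2_eq_square sum_product)
  note mom = product_coordinate_moment[OF I _ _ f mean]
  show "integrable (Pi\<^sub>M I M) (\<lambda>\<omega>. (\<Sum>k\<in>I. f k (\<omega> k))\<^sup>2)"
    unfolding sq by (intro Bochner_Integration.integrable_sum mom(1))
  have "(\<integral>\<omega>. (\<Sum>k\<in>I. f k (\<omega> k))\<^sup>2 \<partial>Pi\<^sub>M I M) = (\<Sum>i\<in>I. \<Sum>j\<in>I. of_bool (i = j) * (\<integral>x. (f i x)\<^sup>2 \<partial>M i))"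
    unfolding sq using mom by (simp add: Bochner_Integration.integral_sum Bochner_Integration.integrable_sum)
  also have "\<dots> = (\<Sum>i\<in>I. \<integral>x. (f i x)\<^sup>2 \<partial>M i)"
    using I by (intro sum.cong) (auto simp: of_bool_def if_distrib[of "\<lambda>c. c * _"] cong: if_cong)
  finally show "(\<integral>\<omega>. (\<Sum>k\<in>I. f k (\<omega> k))\<^sup>2 \<partial>Pi\<^sub>M I M) \<le> V" using V by simp
qed (rule t)

end

lemma estimator_tail:
  fixes M :: "'i \<Rightarrow> real measure"
  assumes I: "finite I" and M: "\<And>i. i \<in> I \<Longrightarrow> prob_space (M i)" "\<And>i. i \<in> I \<Longrightarrow> sets (M i) = sets borel"
    and var: "\<And>i. i \<in> I \<Longrightarrow> variance_at_most (M i) (v i)"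
    and V: "(\<Sum>i\<in>I. (c i)\<^sup>2 * v i) \<le> V" and t: "0 < t"
  shows "measure (Pi\<^sub>M I M) {\<omega> \<in> space (Pi\<^sub>M I M).
    t \<le> (\<Sum>i\<in>I. c i * \<omega> i) - (\<Sum>i\<in>I. c i * (\<integral>x. x \<partial>M i))} \<le> V / (V + t\<^sup>2)"
proof -
  \<comment> \<open>The product construction asks for a probability space at every index, so a point
    mass is placed outside I.\<close>
  define N where "N i = (if i \<in> I then M i else return borel (0 :: real))" for i
  have N: "prob_space (N i)" for i using M(1) prob_space_return[of "0 :: real" borel] by (simp add: N_def)
  interpret product_prob_space N by (rule product_prob_spaceI) (rule N)
  have PM: "Pi\<^sub>M I M = Pi\<^sub>M I N" by (intro PiM_cong) (auto simp: N_def)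
  let ?f = "\<lambda>i x. c i * (x - (\<integral>y. y \<partial>M i))"
  have i: "integrable (M i) (\<lambda>x. x)" "integrable (M i) (\<lambda>x. (x - a)\<^sup>2)" if "i \<in> I" for i a
  proof -
    interpret prob_space "M i" by (rule M(1)[OF that])
    show "integrable (M i) (\<lambda>x. x)" "integrable (M i) (\<lambda>x. (x - a)\<^sup>2)"
      using integrable_square_imp[OF finite_measure_axioms M(2)[OF that]] var[OF that]
      by (auto simp: variance_at_most_def)
  qed
  have "measure (Pi\<^sub>M I N) {\<omega> \<in> space (Pi\<^sub>M I N). t \<le> (\<Sum>i\<in>I. ?f i (\<omega> i))} \<le> V / (V + t\<^sup>2)"
  proof (rule product_linear_tail[OF I _ _ _ _ t])
    fix k assume k: "k \<in> I"
    interpret prob_space "M k" by (rule M(1)[OF k])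
    show "integrable (N k) (?f k)" using k i(1)[OF k] by (simp add: N_def)
    show "integrable (N k) (\<lambda>x. (?f k x)\<^sup>2)" using k i(2)[OF k] by (simp add: N_def power_mult_distrib)
    show "(\<integral>x. ?f k x \<partial>N k) = 0" using k i(1)[OF k] by (simp add: N_def prob_space)
  next
    have "(\<Sum>k\<in>I. \<integral>x. (?f k x)\<^sup>2 \<partial>N k) \<le> (\<Sum>k\<in>I. (c k)\<^sup>2 * v k)"
    proof (rule sum_mono)
      fix k assume k: "k \<in> I"
      have "(\<integral>x. (x - (\<integral>y. y \<partial>M k))\<^sup>2 \<partial>M k) \<le> v k" using var[OF k] by (simp add: variance_at_most_def)
      from mult_left_mono[OF this, of "(c k)\<^sup>2"]
      show "(\<integral>x. (?f k x)\<^sup>2 \<partial>N k) \<le> (c k)\<^sup>2 * v k" using k by (simp add: N_def power_mult_distrib)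
    qed
    with V show "(\<Sum>k\<in>I. \<integral>x. (?f k x)\<^sup>2 \<partial>N k) \<le> V" by simp
  qed
  then show ?thesis by (simp add: PM right_diff_distrib sum_subtractf)
qed

section \<open>The estimator\<close>

lemma isometry_sum:
  fixes A :: "nat \<Rightarrow> nat \<Rightarrow> real"
  assumes "\<And>i i'. i < N \<Longrightarrow> i' < N \<Longrightarrow> (\<Sum>l<N. A l i * A l i') = of_bool (i = i')"
  shows "(\<Sum>l<N. (\<Sum>i<N. A l i * u i)\<^sup>2) = (\<Sum>i<N. (u i)\<^sup>2)"
proof -
  have "(\<Sum>l<N. (\<Sum>i<N. A l i * u i)\<^sup>2) = (\<Sum>l<N. \<Sum>i<N. \<Sum>i'<N. (A l i * A l i') * (u i * u i'))"
    by (simp add: power2_eq_square sum_product mult_ac)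
  also have "\<dots> = (\<Sum>i<N. \<Sum>l<N. \<Sum>i'<N. (A l i * A l i') * (u i * u i'))" by (rule sum.swap)
  also have "\<dots> = (\<Sum>i<N. \<Sum>i'<N. \<Sum>l<N. (A l i * A l i') * (u i * u i'))"
    by (intro sum.cong refl sum.swap)
  also have "\<dots> = (\<Sum>i<N. \<Sum>i'<N. of_bool (i = i') * (u i * u i'))"
    by (intro sum.cong refl) (simp add: assms flip: sum_distrib_right)
  also have "\<dots> = (\<Sum>i<N. (u i)\<^sup>2)"
    by (intro sum.cong refl)
      (simp add: of_bool_def power2_eq_square if_distrib[of "\<lambda>c. c * _"] cong: if_cong)
  finally show ?thesis .
qed

lemma nonzero_divide_cancel: "b \<noteq> 0 \<Longrightarrow> a / b * b = (a :: real)"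
  by simp

lemma least_nat_bounds:
  fixes r :: real
  assumes "0 \<le> r"
  shows "0 < (LEAST C. 0 < C \<and> real C \<ge> r)" "r \<le> real (LEAST C. 0 < C \<and> real C \<ge> r)"
    "real (LEAST C. 0 < C \<and> real C \<ge> r) \<le> r + 1"
proof -
  \<comment> \<open>The floor plus one is positive also for r = 0 and exceeds r by at most
    1.\<close>
  let ?C = "nat \<lfloor>r\<rfloor> + 1"
  have C: "0 < ?C \<and> real ?C \<ge> r" "real ?C \<le> r + 1" using assms by linarith+
  show "0 < (LEAST C. 0 < C \<and> real C \<ge> r)" "r \<le> real (LEAST C. 0 < C \<and> real C \<ge> r)"
    using LeastI[of "\<lambda>C. 0 < C \<and> real C \<ge> r", OF C(1)] by auto
  have "(LEAST C. 0 < C \<and> real C \<ge> r) \<le> ?C" by (rule Least_le[of "\<lambda>C. 0 < C \<and> real C \<ge> r", OF C(1)])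
  then show "real (LEAST C. 0 < C \<and> real C \<ge> r) \<le> r + 1" using C(2) by linarith
qed

text \<open>The entries are grouped by their unordered index pair. A group has two equal weights off
  the diagonal and one on it: a second moment measured once serves both of its entries.\<close>

lemma sum_min_max:
  fixes w :: "nat \<Rightarrow> nat \<Rightarrow> real"
  assumes sym: "\<And>a b. a < N \<Longrightarrow> b < N \<Longrightarrow> w a b = w b a"
  shows "(\<Sum>l<N. \<Sum>k<N. w l k * G (min k l) (max k l)) =
    (\<Sum>(a, b)\<in>{(a, b). a \<le> b \<and> b < N \<and> w a b \<noteq> 0}. (if a = b then 1 else 2) * w a b * G a b)"
proof -
  let ?T = "{(a, b). a \<le> b \<and> b < N}"
  let ?S = "{..<N} \<times> {..<N}"
  let ?h = "\<lambda>(l, k). (min k l, max k l)"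
  let ?F = "\<lambda>(l, k). w l k * G (min k l) (max k l)"
  have fin: "finite ?T" by (rule finite_subset[of _ ?S]) auto
  have "(\<Sum>l<N. \<Sum>k<N. w l k * G (min k l) (max k l)) = (\<Sum>p\<in>?S. ?F p)"
    by (simp add: sum.cartesian_product)
  also have "\<dots> = (\<Sum>q\<in>?T. \<Sum>p\<in>{p \<in> ?S. ?h p = q}. ?F p)"
    by (rule sum.group[symmetric]) (use fin in auto)
  also have "\<dots> = (\<Sum>q\<in>?T. case q of (a, b) \<Rightarrow> (if a = b then 1 else 2) * w a b * G a b)"
  proof (intro sum.cong refl)
    fix q assume q: "q \<in> ?T"
    obtain a b where ab: "q = (a, b)" "a \<le> b" "b < N" using q by auto
    have "{p \<in> ?S. ?h p = q} = {(a, b), (b, a)}"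
      using ab(2,3) unfolding ab(1) by (auto simp: min_def max_def split: if_splits)
    then show "(\<Sum>p\<in>{p \<in> ?S. ?h p = q}. ?F p) = (case q of (a, b) \<Rightarrow> (if a = b then 1 else 2) * w a b * G a b)"
      using ab sym[of a b] by (cases "a = b") (auto simp: min_def max_def)
  qed
  also have "\<dots> = (\<Sum>(a, b)\<in>{(a, b). a \<le> b \<and> b < N \<and> w a b \<noteq> 0}. (if a = b then 1 else 2) * w a b * G a b)"
    by (rule sum.mono_neutral_right) (use fin in auto)
  finally show ?thesis .
qed

section \<open>The estimate as an affine function of the outcomes\<close>

definition measured :: "config \<Rightarrow> (nat \<times> nat) set" where
  "measured P = {(a, b). a \<le> b \<and> b < 2 * modes P \<and> weight_mat P $$ (a, b) \<noteq> 0}"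

lemma finite_measured: "finite (measured P)"
  by (rule finite_subset[of _ "{..<2 * modes P} \<times> {..<2 * modes P}"]) (auto simp: measured_def)

lemma copies_eq:
  "copies P = (\<lambda>(l, c). First l c) ` ({..<2 * modes P} \<times> {..<C1 P}) \<union>
     (\<lambda>((a, b), c). Second a b c) ` (measured P \<times> {..<C2 P})"
  unfolding copies_def measured_def by (auto simp: image_iff)

lemma finite_copies: "finite (copies P)"
  unfolding copies_eq using finite_measured[of P] by simp

lemma sum_copies:
  fixes h :: "copy \<Rightarrow> real"
  shows "(\<Sum>i\<in>copies P. h i) = (\<Sum>l<2 * modes P. \<Sum>c<C1 P. h (First l c))
    + (\<Sum>(a, b)\<in>measured P. \<Sum>c<C2 P. h (Second a b c))"
proof -
  have "(\<Sum>i\<in>copies P. h i) = (\<Sum>i\<in>(\<lambda>(l, c). First l c) ` ({..<2 * modes P} \<times> {..<C1 P}). h i)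
      + (\<Sum>i\<in>(\<lambda>((a, b), c). Second a b c) ` (measured P \<times> {..<C2 P}). h i)"
    unfolding copies_eq using finite_measured[of P] by (intro sum.union_disjoint) auto
  also have "(\<Sum>i\<in>(\<lambda>(l, c). First l c) ` ({..<2 * modes P} \<times> {..<C1 P}). h i) =
      (\<Sum>l<2 * modes P. \<Sum>c<C1 P. h (First l c))"
    by (subst sum.reindex) (auto simp: inj_on_def sum.cartesian_product case_prod_unfold)
  also have "(\<Sum>i\<in>(\<lambda>((a, b), c). Second a b c) ` (measured P \<times> {..<C2 P}). h i) =
      (\<Sum>(a, b)\<in>measured P. \<Sum>c<C2 P. h (Second a b c))"
    by (subst sum.reindex) (auto simp: inj_on_def sum.cartesian_product case_prod_unfold)
  finally show ?thesis .
qed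

text \<open>The slopes of the fidelity estimate in the single outcomes. The 2 in the first case
  comes from the term 2 \<gamma> of the fidelity bound, the 2 in the second from the two entries
  that an off-diagonal average fills.\<close>

definition estimator_coeff :: "config \<Rightarrow> copy \<Rightarrow> real" where
  "estimator_coeff P i = (case i of
     First l c \<Rightarrow> 2 * (\<Sum>k<2 * modes P. weight_mat P $$ (l, k) * displacement P $ k) / real (C1 P)
   | Second a b c \<Rightarrow> - (if a = b then 1 else 2) * weight_mat P $$ (a, b) / real (C2 P))"

definition estimator_const :: "config \<Rightarrow> real" where
  "estimator_const P = 1 + real (modes P) / 2 -
     (\<Sum>l<2 * modes P. \<Sum>k<2 * modes P. weight_mat P $$ (l, k) * displacement P $ l * displacement P $ k)"

section \<open>Norm bounds for the weight matrix and the resulting variance\<close>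

context
  fixes P :: config and m N :: nat and x :: "real vec" and w :: "nat \<Rightarrow> nat \<Rightarrow> real"
  assumes valid: "valid_config P"
  defines "m \<equiv> modes P" and "N \<equiv> 2 * modes P" and "x \<equiv> displacement P"
    and "w \<equiv> \<lambda>l k. weight_mat P $$ (l, k)"
begin

lemma orth_carrier: "orth P \<in> carrier_mat N N"
  using valid by (simp add: valid_config_def passive_mat_def symplectic_def N_def)

lemma weight_carrier: "weight_mat P \<in> carrier_mat N N"
  using orth_carrier unfolding weight_mat_def squeeze_inv_sq_def N_def
  by (intro mult_carrier_mat[of _ "2 * modes P" "2 * modes P"]) auto

lemma orth_rows:
  assumes "l < N" "l' < N"
  shows "(\<Sum>i<N. orth P $$ (l, i) * orth P $$ (l', i)) = of_bool (l = l')"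
proof -
  have "orth P * transpose_mat (orth P) = 1\<^sub>m N"
    using valid by (simp add: valid_config_def passive_mat_def N_def)
  then have "(\<Sum>i<N. orth P $$ (l, i) * transpose_mat (orth P) $$ (i, l')) = 1\<^sub>m N $$ (l, l')"
    using mat_mult_index[OF orth_carrier transpose_carrier_mat[THEN iffD2, OF orth_carrier] assms] by simp
  then show ?thesis using assms orth_carrier by simp
qed

lemma orth_columns:
  assumes "i < N" "i' < N"
  shows "(\<Sum>l<N. orth P $$ (l, i) * orth P $$ (l, i')) = of_bool (i = i')"
proof -
  have "orth P * transpose_mat (orth P) = 1\<^sub>m N"
    using valid by (simp add: valid_config_def passive_mat_def N_def)
  then have "transpose_mat (orth P) * orth P = 1\<^sub>m N"
    using mat_mult_left_right_inverse[OF orth_carrier] orth_carrier by simp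
  then have "(\<Sum>l<N. transpose_mat (orth P) $$ (i, l) * orth P $$ (l, i')) = 1\<^sub>m N $$ (i, i')"
    using mat_mult_index[OF transpose_carrier_mat[THEN iffD2, OF orth_carrier] orth_carrier assms] by simp
  then show ?thesis using assms orth_carrier by simp
qed

lemma weight_entry:
  assumes "l < N" "l' < N"
  shows "w l l' = (\<Sum>i<N. orth P $$ (l, i) * inverse ((squeeze_entry (squeezing P) i)\<^sup>2) * orth P $$ (l', i))"
proof -
  have "orth P * squeeze_inv_sq (modes P) (squeezing P) =
      Matrix.mat N N (\<lambda>(i, j). orth P $$ (i, j) * inverse ((squeeze_entry (squeezing P) j)\<^sup>2))"
    unfolding squeeze_inv_sq_def N_def[symmetric] by (rule mat_diag_mult_right[OF orth_carrier])
  then have "w l l' = (\<Sum>i<N. Matrix.mat N N (\<lambda>(i, j). orth P $$ (i, j) * inverse ((squeeze_entry (squeezing P) j)\<^sup>2)) $$ (l, i)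
      * transpose_mat (orth P) $$ (i, l'))"
    unfolding w_def weight_mat_def using assms orth_carrier
    by (subst mat_mult_index[of _ N N _ N]) auto
  then show ?thesis using assms orth_carrier by simp
qed

lemma weight_sym: "l < N \<Longrightarrow> l' < N \<Longrightarrow> w l l' = w l' l"
  by (simp add: weight_entry mult_ac)

lemma squeezing_bounds: "j < m \<Longrightarrow> 1 \<le> squeezing P j" "j < m \<Longrightarrow> squeezing P j \<le> s_max P"
  using valid by (auto simp: valid_config_def s_max_def m_def)

lemma modes_pos: "1 \<le> m"
  using valid by (simp add: valid_config_def m_def)

lemma s_max_ge_1: "1 \<le> s_max P"
  using squeezing_bounds[of 0] modes_pos by simp

lemma squeeze_inv_sq_bounds:
  assumes "i < N"
  shows "0 \<le> inverse ((squeeze_entry (squeezing P) i)\<^sup>2)"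
    "inverse ((squeeze_entry (squeezing P) i)\<^sup>2) \<le> (s_max P)\<^sup>2"
proof -
  have i: "i div 2 < m" using assms by (simp add: N_def m_def)
  note s = squeezing_bounds[OF i]
  show "inverse ((squeeze_entry (squeezing P) i)\<^sup>2) \<le> (s_max P)\<^sup>2"
  proof (cases "even i")
    case True
    have "inverse ((squeezing P (i div 2))\<^sup>2) \<le> 1"
      using s by (simp add: inverse_le_1_iff)
    also have "1 \<le> (s_max P)\<^sup>2" using s_max_ge_1 by simp
    finally show ?thesis using True by (simp add: squeeze_entry_def)
  next
    case False
    have "(squeezing P (i div 2))\<^sup>2 \<le> (s_max P)\<^sup>2" using s by (intro power_mono) auto
    then show ?thesis using False by (simp add: squeeze_entry_def power_inverse)
  qed
qed simp

text \<open>The weight matrix is diagonal in the orthonormal columns of \<open>orth P\<close>, with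
  eigenvalues between 0 and \<open>(s_max P)\<^sup>2\<close>. Its action is an isometry, a diagonal
  contraction or stretch by at most that factor, and another isometry.\<close>

lemma weight_norm: "(\<Sum>l<N. (\<Sum>k<N. w l k * y k)\<^sup>2) \<le> s_max P ^ 4 * (\<Sum>k<N. (y k)\<^sup>2)"
proof -
  let ?R = "\<lambda>l i. orth P $$ (l, i)"
  let ?d = "\<lambda>i. inverse ((squeeze_entry (squeezing P) i)\<^sup>2)"
  define z where "z i = (\<Sum>k<N. ?R k i * y k)" for i
  have "(\<Sum>k<N. w l k * y k) = (\<Sum>i<N. ?R l i * (?d i * z i))" if "l < N" for l
  proof -
    have "(\<Sum>k<N. w l k * y k) = (\<Sum>k<N. \<Sum>i<N. ?R l i * (?d i * (?R k i * y k)))"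
      using that by (intro sum.cong refl) (simp add: weight_entry sum_distrib_left mult_ac)
    also have "\<dots> = (\<Sum>i<N. \<Sum>k<N. ?R l i * (?d i * (?R k i * y k)))" by (rule sum.swap)
    finally show ?thesis by (simp add: z_def sum_distrib_left)
  qed
  then have "(\<Sum>l<N. (\<Sum>k<N. w l k * y k)\<^sup>2) = (\<Sum>l<N. (\<Sum>i<N. ?R l i * (?d i * z i))\<^sup>2)" by simp
  also have "\<dots> = (\<Sum>i<N. (?d i * z i)\<^sup>2)" by (rule isometry_sum[OF orth_columns])
  also have "\<dots> \<le> (\<Sum>i<N. s_max P ^ 4 * (z i)\<^sup>2)"
  proof (intro sum_mono)
    fix i assume "i \<in> {..<N}"
    then have "(?d i)\<^sup>2 \<le> ((s_max P)\<^sup>2)\<^sup>2" using squeeze_inv_sq_bounds by (intro power_mono) auto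
    then show "(?d i * z i)\<^sup>2 \<le> s_max P ^ 4 * (z i)\<^sup>2"
      unfolding power_mult_distrib by (intro mult_right_mono) (auto simp flip: power_mult)
  qed
  also have "\<dots> = s_max P ^ 4 * (\<Sum>i<N. (\<Sum>k<N. ?R k i * y k)\<^sup>2)"
    by (simp add: z_def sum_distrib_left)
  also have "(\<Sum>i<N. (\<Sum>k<N. ?R k i * y k)\<^sup>2) = (\<Sum>k<N. (y k)\<^sup>2)"
    by (rule isometry_sum) (rule orth_rows)
  finally show ?thesis .
qed

text \<open>\<open>weight_norm\<close> applied to the N standard basis vectors, whose images are the
  columns.\<close>

lemma weight_frobenius: "(\<Sum>l<N. \<Sum>k<N. (w l k)\<^sup>2) \<le> real N * s_max P ^ 4"
proof -
  have "(\<Sum>l<N. \<Sum>k<N. (w l k)\<^sup>2) = (\<Sum>k<N. \<Sum>l<N. (\<Sum>i<N. w l i * of_bool (i = k))\<^sup>2)"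
    by (subst sum.swap) (intro sum.cong refl, simp add: of_bool_def if_distrib[of "\<lambda>c. _ * c"] cong: if_cong)
  also have "\<dots> \<le> (\<Sum>k<N. s_max P ^ 4 * (\<Sum>i<N. (of_bool (i = k))\<^sup>2))"
    by (intro sum_mono weight_norm)
  also have "\<dots> = (\<Sum>k<N. s_max P ^ 4)"
    by (intro sum.cong refl) (simp add: of_bool_def if_distrib[of "\<lambda>c. c\<^sup>2"] cong: if_cong)
  finally show ?thesis by simp
qed

lemma displacement_norm: "displacement_norm_sq P = (\<Sum>k<N. (x $ k)\<^sup>2)"
proof -
  have "x \<in> carrier_vec N" using valid by (simp add: valid_config_def x_def N_def)
  then show ?thesis
    by (simp add: displacement_norm_sq_def scalar_prod_def power2_eq_square atLeast0LessThan x_def)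
qed

lemma fidelity_bound_expand:
  assumes \<Gamma>: "\<Gamma> \<in> carrier_mat N N"
  shows "fidelity_bound P \<gamma> \<Gamma> =
    1 + real m / 2 - (\<Sum>l<N. \<Sum>k<N. w l k * (\<Gamma> $$ (k, l) - (2 * \<gamma> $ k - x $ k) * x $ l))"
proof -
  let ?B = "\<Gamma> - Matrix.mat N N (\<lambda>(i, k). (2 * \<gamma> $ i - x $ i) * x $ k)"
  have B: "?B \<in> carrier_mat N N" by (rule minus_carrier_mat) simp
  have "mat_trace (weight_mat P * ?B) = (\<Sum>l<N. \<Sum>k<N. w l k * ?B $$ (k, l))"
    unfolding mat_trace_def w_def using weight_carrier
    by (intro sum.cong) (auto simp: mat_mult_index[OF weight_carrier B] simp del: index_mult_mat(1))
  also have "\<dots> = (\<Sum>l<N. \<Sum>k<N. w l k * (\<Gamma> $$ (k, l) - (2 * \<gamma> $ k - x $ k) * x $ l))"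
    using \<Gamma> by (intro sum.cong refl) auto
  finally show ?thesis by (simp add: fidelity_bound_def Let_def m_def x_def N_def)
qed

lemma estimator_linear:
  "fidelity_bound P (gamma_est P \<omega>) (Gamma_est P \<omega>) =
    estimator_const P + (\<Sum>i\<in>copies P. estimator_coeff P i * \<omega> i)"
proof -
  define g where "g l = (\<Sum>c<C1 P. \<omega> (First l c)) / real (C1 P)" for l
  define G where "G a b = (\<Sum>c<C2 P. \<omega> (Second a b c)) / real (C2 P)" for a b
  have "fidelity_bound P (gamma_est P \<omega>) (Gamma_est P \<omega>) =
      1 + real m / 2 - (\<Sum>l<N. \<Sum>k<N. w l k * (G (min k l) (max k l) - (2 * g k - x $ k) * x $ l))"
    by (subst fidelity_bound_expand) (auto simp: Gamma_est_def gamma_est_def N_def g_def G_def)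
  also have "(\<Sum>l<N. \<Sum>k<N. w l k * (G (min k l) (max k l) - (2 * g k - x $ k) * x $ l)) =
      (\<Sum>l<N. \<Sum>k<N. w l k * G (min k l) (max k l)) - (\<Sum>l<N. \<Sum>k<N. 2 * (w l k * x $ l) * g k)
      + (\<Sum>l<N. \<Sum>k<N. w l k * x $ l * x $ k)"
    by (simp add: algebra_simps sum.distrib sum_subtractf)
  also have "(\<Sum>l<N. \<Sum>k<N. 2 * (w l k * x $ l) * g k) = (\<Sum>k<N. \<Sum>l<N. 2 * (w k l * x $ l) * g k)"
    by (subst sum.swap) (intro sum.cong refl, simp add: weight_sym)
  also have "\<dots> = (\<Sum>k<N. 2 * (\<Sum>l<N. w k l * x $ l) * g k)"
    by (simp add: sum_distrib_left sum_distrib_right)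
  also have "\<dots> = (\<Sum>l<N. \<Sum>c<C1 P. estimator_coeff P (First l c) * \<omega> (First l c))"
    by (intro sum.cong refl)
      (simp add: g_def estimator_coeff_def w_def x_def N_def flip: sum_distrib_left sum_divide_distrib)
  also have "(\<Sum>l<N. \<Sum>k<N. w l k * G (min k l) (max k l)) =
      (\<Sum>(a, b)\<in>measured P. (if a = b then 1 else 2) * w a b * G a b)"
    unfolding measured_def using sum_min_max[OF weight_sym, where G = G] by (simp add: w_def N_def)
  also have "\<dots> = - (\<Sum>(a, b)\<in>measured P. \<Sum>c<C2 P. estimator_coeff P (Second a b c) * \<omega> (Second a b c))"
    unfolding sum_negf[symmetric] G_def estimator_coeff_def w_def
    by (intro sum.cong refl) (auto simp: sum_distrib_left sum_divide_distrib sum_negf)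
  finally show ?thesis
    by (simp add: sum_copies estimator_const_def m_def w_def x_def N_def)
qed

text \<open>With mode range 0 the columns of mode 0 would vanish, against their
  normalisation.\<close>

lemma mode_range_pos: "1 \<le> mode_range P"
proof (rule ccontr)
  assume "\<not> 1 \<le> mode_range P"
  then have "2 * m \<le> card {i. i < 2 * m \<and> orth P $$ (i, 0) = 0 \<and> orth P $$ (i, 1) = 0}"
    using valid modes_pos by (force simp: valid_config_def has_mode_range_def m_def)
  moreover have "card {i. i < 2 * m \<and> orth P $$ (i, 0) = 0 \<and> orth P $$ (i, 1) = 0} \<le> card {..<2 * m}"
    by (rule card_mono) auto
  ultimately have "{i. i < 2 * m \<and> orth P $$ (i, 0) = 0 \<and> orth P $$ (i, 1) = 0} = {..<2 * m}"
    by (intro card_subset_eq) auto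
  then have "orth P $$ (i, 0) = 0" if "i < N" for i using that by (auto simp: N_def m_def)
  then have "(\<Sum>l<N. orth P $$ (l, 0) * orth P $$ (l, 0)) = 0" by simp
  then show False using orth_columns[of 0 0] modes_pos by (simp add: N_def m_def)
qed

lemma kappa_ge_2: "2 \<le> kappa P"
  using mode_range_pos modes_pos by (simp add: kappa_def m_def)

lemma log_conf_pos: "0 < log_conf P"
  using valid by (simp add: log_conf_def valid_config_def)

text \<open>\<open>ln y \<le> y - 1\<close> at y = 1 / (1 - \<alpha>). With L for
  \<open>log_conf P\<close> it is equivalent to L / (1 + L) \<le> \<alpha>, the form in which the
  Cantelli bound yields the failure probability.\<close>

lemma log_conf_bound: "log_conf P * (1 - fail_prob P) \<le> fail_prob P"
proof -
  let ?a = "1 - fail_prob P"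
  have a: "0 < ?a" using valid by (simp add: valid_config_def)
  have "log_conf P \<le> 1 / ?a - 1" unfolding log_conf_def using a by (intro ln_le_minus_one) simp
  then have "log_conf P * ?a \<le> (1 / ?a - 1) * ?a" using a by (intro mult_right_mono) auto
  also have "\<dots> = fail_prob P" using a by (simp add: field_simps)
  finally show ?thesis .
qed

definition C1_bound :: real where
  "C1_bound = 2 ^ 6 * ((sigma1 P)\<^sup>2 * (2 * real m + 1) * real m * s_max P ^ 4 * displacement_norm_sq P)
     / ((err P)\<^sup>2 * log_conf P)"

definition C2_bound :: real where
  "C2_bound = 2 ^ 5 * ((sigma2 P)\<^sup>2 * (2 * real (kappa P) * real m + 1) * (real m)\<^sup>2 * s_max P ^ 4 * real (kappa P))
     / ((err P)\<^sup>2 * log_conf P)"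

lemma err_log_pos: "0 < (err P)\<^sup>2 * log_conf P"
  using valid log_conf_pos by (simp add: valid_config_def)

lemma displacement_norm_nonneg: "0 \<le> displacement_norm_sq P"
  unfolding displacement_norm by (intro sum_nonneg) simp

lemma C1_props: "0 < C1 P" "C1_bound \<le> real (C1 P)" "real (C1 P) \<le> C1_bound + 1"
proof -
  have "0 \<le> C1_bound"
    unfolding C1_bound_def using err_log_pos displacement_norm_nonneg s_max_ge_1
    by (intro divide_nonneg_pos mult_nonneg_nonneg) auto
  from least_nat_bounds[OF this] show "0 < C1 P" "C1_bound \<le> real (C1 P)" "real (C1 P) \<le> C1_bound + 1"
    by (auto simp: C1_def C1_bound_def m_def)
qed

lemma C2_props: "0 < C2 P" "C2_bound \<le> real (C2 P)" "real (C2 P) \<le> C2_bound + 1"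
proof -
  have "0 \<le> C2_bound"
    unfolding C2_bound_def using err_log_pos s_max_ge_1
    by (intro divide_nonneg_pos mult_nonneg_nonneg) auto
  from least_nat_bounds[OF this] show "0 < C2 P" "C2_bound \<le> real (C2 P)" "real (C2 P) \<le> C2_bound + 1"
    by (auto simp: C2_def C2_bound_def m_def)
qed

text \<open>Each of the two groups of copies is given half of the budget \<open>?T\<close>. The
  first is controlled by the operator norm of the weight matrix at the displacement, the second by
  its Frobenius norm.\<close>

lemma estimator_variance:
  "(\<Sum>i\<in>copies P. (estimator_coeff P i)\<^sup>2 * (case i of First _ _ \<Rightarrow> (sigma1 P)\<^sup>2 | Second _ _ _ \<Rightarrow> (sigma2 P)\<^sup>2))
    \<le> (err P)\<^sup>2 * log_conf P"
proof -
  let ?T = "(err P)\<^sup>2 * log_conf P"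
  have "(\<Sum>c<C1 P. (estimator_coeff P (First l c))\<^sup>2 * (sigma1 P)\<^sup>2) =
      4 * (sigma1 P)\<^sup>2 * (\<Sum>k<N. w l k * x $ k)\<^sup>2 / real (C1 P)" for l
    using C1_props(1)
    by (simp add: estimator_coeff_def w_def x_def N_def power_divide power_mult_distrib
        power2_eq_square[of "real (C1 P)"])
  then have "(\<Sum>l<2 * modes P. \<Sum>c<C1 P. (estimator_coeff P (First l c))\<^sup>2 * (sigma1 P)\<^sup>2) =
      4 * (sigma1 P)\<^sup>2 * (\<Sum>l<N. (\<Sum>k<N. w l k * x $ k)\<^sup>2) / real (C1 P)"
    by (simp add: N_def sum_distrib_left sum_divide_distrib)
  also have "\<dots> \<le> 4 * (sigma1 P)\<^sup>2 * (s_max P ^ 4 * displacement_norm_sq P) / real (C1 P)"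
    unfolding displacement_norm by (intro divide_right_mono mult_left_mono weight_norm) auto
  also have "\<dots> \<le> ?T / 2"
  proof -
    let ?q = "(sigma1 P)\<^sup>2 * (s_max P ^ 4 * displacement_norm_sq P)"
    have q: "0 \<le> ?q" using displacement_norm_nonneg s_max_ge_1 by simp
    have "2 ^ 6 * ((2 * real m + 1) * real m) * ?q = C1_bound * ?T"
      unfolding C1_bound_def nonzero_divide_cancel[OF less_imp_neq[OF err_log_pos, symmetric]]
      by (simp add: mult_ac)
    also have "\<dots> \<le> real (C1 P) * ?T" using C1_props(2) err_log_pos by (intro mult_right_mono) auto
    finally have "2 ^ 6 * ((2 * real m + 1) * real m) * ?q \<le> real (C1 P) * ?T" .
    \<comment> \<open>Half of the budget demands \<open>C1 P * ?T \<ge> 8 * ?q\<close>; the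
      prescribed factor is at least 64 because m \<ge> 1.\<close>
    moreover have "8 * ?q \<le> 2 ^ 6 * ((2 * real m + 1) * real m) * ?q"
    proof (rule mult_right_mono[OF _ q])
      have "1 * 1 \<le> (2 * real m + 1) * real m" using modes_pos by (intro mult_mono) auto
      then have "(2 :: real) ^ 6 * 1 \<le> 2 ^ 6 * ((2 * real m + 1) * real m)"
        by (intro mult_left_mono) auto
      moreover have "(8 :: real) \<le> 2 ^ 6 * 1" by simp
      ultimately show "8 \<le> 2 ^ 6 * ((2 * real m + 1) * real m)" by (rule order_trans[rotated])
    qed
    ultimately have "8 * ?q \<le> real (C1 P) * ?T" by linarith
    then show ?thesis using C1_props(1) by (simp add: field_simps)
  qed
  finally have first: "(\<Sum>l<2 * modes P. \<Sum>c<C1 P. (estimator_coeff P (First l c))\<^sup>2 * (sigma1 P)\<^sup>2) \<le> ?T / 2" .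
  \<comment> \<open>Off the diagonal the squared coefficient is \<open>4 * (w a b)\<^sup>2\<close>,
    while the Frobenius sum contains this entry twice; comparison with that sum costs a factor
    2.\<close>
  have sq_le: "(if a = b then 1 else 2)\<^sup>2 * (w a b)\<^sup>2 \<le> 2 * ((if a = b then 1 else 2) * w a b * w a b)" for a b
    using zero_le_square[of "w a b"] by (cases "a = b") (simp_all add: power2_eq_square)
  have "(\<Sum>(a, b)\<in>measured P. \<Sum>c<C2 P. (estimator_coeff P (Second a b c))\<^sup>2 * (sigma2 P)\<^sup>2) =
      (\<Sum>(a, b)\<in>measured P. (sigma2 P)\<^sup>2 / real (C2 P) * (((if a = b then 1 else 2))\<^sup>2 * (w a b)\<^sup>2))"
    using C2_props(1)
    by (intro sum.cong refl) (auto simp: estimator_coeff_def w_def power2_eq_square field_simps)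
  also have "\<dots> \<le> (\<Sum>(a, b)\<in>measured P. (sigma2 P)\<^sup>2 / real (C2 P) * (2 * ((if a = b then 1 else 2) * w a b * w a b)))"
    unfolding case_prod_unfold by (intro sum_mono mult_left_mono divide_nonneg_nonneg sq_le) auto
  also have "\<dots> = (sigma2 P)\<^sup>2 / real (C2 P) * (2 * (\<Sum>(a, b)\<in>measured P. (if a = b then 1 else 2) * w a b * w a b))"
    by (simp only: case_prod_unfold sum_distrib_left)
  also have "(\<Sum>(a, b)\<in>measured P. (if a = b then 1 else 2) * w a b * w a b) =
      (\<Sum>l<N. \<Sum>k<N. w l k * w (min k l) (max k l))"
    using sum_min_max[OF weight_sym, where G = w] by (simp add: measured_def w_def N_def)
  also have "(\<Sum>l<N. \<Sum>k<N. w l k * w (min k l) (max k l)) = (\<Sum>l<N. \<Sum>k<N. (w l k)\<^sup>2)"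
    by (intro sum.cong refl) (auto simp: power2_eq_square min_def max_def weight_sym)
  also have "(sigma2 P)\<^sup>2 / real (C2 P) * (2 * (\<Sum>l<N. \<Sum>k<N. (w l k)\<^sup>2))
      \<le> (sigma2 P)\<^sup>2 / real (C2 P) * (2 * (real N * s_max P ^ 4))"
    by (intro mult_left_mono weight_frobenius divide_nonneg_nonneg) auto
  also have "\<dots> \<le> ?T / 2"
  proof -
    let ?q = "(sigma2 P)\<^sup>2 * (real m * s_max P ^ 4)"
    have q: "0 \<le> ?q" using s_max_ge_1 by simp
    have "2 ^ 5 * ((2 * real (kappa P) * real m + 1) * (real m * real (kappa P))) * ?q = C2_bound * ?T"
      unfolding C2_bound_def nonzero_divide_cancel[OF less_imp_neq[OF err_log_pos, symmetric]]
      by (simp add: mult_ac power2_eq_square)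
    also have "\<dots> \<le> real (C2 P) * ?T" using C2_props(2) err_log_pos by (intro mult_right_mono) auto
    finally have "2 ^ 5 * ((2 * real (kappa P) * real m + 1) * (real m * real (kappa P))) * ?q \<le> real (C2 P) * ?T" .
    \<comment> \<open>Here \<open>2 * N = 4 * m\<close> in the Frobenius estimate and the factor 2
      of the half budget combine to 8; the prescribed factor is at least 32 because m \<ge> 1 and
      \<kappa> \<ge> 2.\<close>
    moreover have "8 * ?q \<le> 2 ^ 5 * ((2 * real (kappa P) * real m + 1) * (real m * real (kappa P))) * ?q"
    proof (rule mult_right_mono[OF _ q])
      have "1 * (1 * 1) \<le> (2 * real (kappa P) * real m + 1) * (real m * real (kappa P))"
        using modes_pos kappa_ge_2 by (intro mult_mono) auto
      then have "(2 :: real) ^ 5 * 1 \<le> 2 ^ 5 * ((2 * real (kappa P) * real m + 1) * (real m * real (kappa P)))"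
        by (intro mult_left_mono) auto
      moreover have "(8 :: real) \<le> 2 ^ 5 * 1" by simp
      ultimately show "8 \<le> 2 ^ 5 * ((2 * real (kappa P) * real m + 1) * (real m * real (kappa P)))" by (rule order_trans[rotated])
    qed
    ultimately have "8 * ?q \<le> real (C2 P) * ?T" by linarith
    then show ?thesis using C2_props(1) by (simp add: field_simps N_def m_def)
  qed
  finally have "(\<Sum>(a, b)\<in>measured P. \<Sum>c<C2 P. (estimator_coeff P (Second a b c))\<^sup>2 * (sigma2 P)\<^sup>2) \<le> ?T / 2" .
  with first show ?thesis unfolding sum_copies by simp
qed

end

section \<open>Mean, deviation and error probabilities of the test\<close>

definition copy_law ::
  "config \<Rightarrow> (nat \<Rightarrow> real set \<Rightarrow> op) \<Rightarrow> (nat \<Rightarrow> nat \<Rightarrow> real set \<Rightarrow> op) \<Rightarrow> op \<Rightarrow> copy \<Rightarrow> real measure" where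
  "copy_law P E1 E2 \<rho> i = (case i of First l c \<Rightarrow> born_law (modes P) (E1 l) \<rho>
     | Second l l' c \<Rightarrow> born_law (modes P) (E2 l l') \<rho>)"

lemma outcome_space_eq: "outcome_space P E1 E2 \<rho> = Pi\<^sub>M (copies P) (copy_law P E1 E2 \<rho>)"
  unfolding outcome_space_def copy_law_def ..

lemma copies_cases:
  assumes "i \<in> copies P"
  obtains (First) l c where "i = First l c" "l < 2 * modes P"
  | (Second) l l' c where "i = Second l l' c" "l < 2 * modes P" "l' < 2 * modes P"
  using assms unfolding copies_def by fastforce

context
  fixes P :: config and E1 E2 and \<rho> :: op
  assumes valid: "valid_config P"
    and E: "quadrature_measurements (modes P) E1 E2"
    and \<rho>: "\<rho> \<in> preparations P E1 E2"
begin

lemma prep_density: "density_op (modes P) \<rho>"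
  using \<rho> by (simp add: preparations_def)

lemma prep_spectral:
  "l < 2 * modes P \<Longrightarrow> spectral_measure (modes P) (quadrature l) (E1 l)"
  "l < 2 * modes P \<Longrightarrow> l' < 2 * modes P \<Longrightarrow> spectral_measure (modes P) (sym_product l l') (E2 l l')"
  using E by (auto simp: quadrature_measurements_def)

lemma prep_variance:
  "l < 2 * modes P \<Longrightarrow> variance_at_most (born_law (modes P) (E1 l) \<rho>) ((sigma1 P)\<^sup>2)"
  "l < 2 * modes P \<Longrightarrow> l' < 2 * modes P \<Longrightarrow>
    variance_at_most (born_law (modes P) (E2 l l') \<rho>) ((sigma2 P)\<^sup>2)"
  using \<rho> by (auto simp: preparations_def)

lemma prep_prob_space:
  assumes "spectral_measure (modes P) A F"
  shows "prob_space (born_law (modes P) F \<rho>)"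
proof -
  obtain v where "pure_decomposition (modes P) \<rho> v" "trace_op (modes P) \<rho> = 1" "positive_op (modes P) \<rho>"
    using prep_density by (rule density_decomposition)
  then show ?thesis by (rule prob_space_born_law) (rule spectral_measure_pvm[OF assms])
qed

lemma copy_law_props:
  assumes "i \<in> copies P"
  shows "prob_space (copy_law P E1 E2 \<rho> i)" "sets (copy_law P E1 E2 \<rho> i) = sets borel"
    "variance_at_most (copy_law P E1 E2 \<rho> i)
      (case i of First _ _ \<Rightarrow> (sigma1 P)\<^sup>2 | Second _ _ _ \<Rightarrow> (sigma2 P)\<^sup>2)"
proof -
  show "prob_space (copy_law P E1 E2 \<rho> i)"
    using assms by (cases rule: copies_cases) (simp_all add: copy_law_def prep_prob_space[OF prep_spectral(1)]
        prep_prob_space[OF prep_spectral(2)])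
  show "sets (copy_law P E1 E2 \<rho> i) = sets borel"
    by (cases i) (simp_all add: copy_law_def sets_born_law)
  show "variance_at_most (copy_law P E1 E2 \<rho> i)
      (case i of First _ _ \<Rightarrow> (sigma1 P)\<^sup>2 | Second _ _ _ \<Rightarrow> (sigma2 P)\<^sup>2)"
    using assms by (cases rule: copies_cases) (simp_all add: copy_law_def prep_variance)
qed

text \<open>\<open>E2 l l'\<close> and \<open>E2 l' l\<close> are spectral measures of one and the
  same operator; both means equal the same series of quadratic forms over the pure
  components.\<close>

lemma second_moment_sym:
  assumes "l < 2 * modes P" "l' < 2 * modes P"
  shows "(\<integral>x. x \<partial>born_law (modes P) (E2 l l') \<rho>) = (\<integral>x. x \<partial>born_law (modes P) (E2 l' l) \<rho>)"
proof -
  obtain v where v: "pure_decomposition (modes P) \<rho> v" "trace_op (modes P) \<rho> = 1" "positive_op (modes P) \<rho>"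
    using prep_density by (rule density_decomposition)
  have "sym_product l' l = sym_product l l'" by (simp add: sym_product_def fun_eq_iff add.commute)
  then show ?thesis
    using mixture_mean(2)[OF v prep_spectral(2)[OF assms]]
      mixture_mean(2)[OF v prep_spectral(2)[OF assms(2,1)]]
      prep_variance(2)[OF assms] prep_variance(2)[OF assms(2,1)]
    by (auto simp: variance_at_most_def intro: sums_unique2)
qed

text \<open>The estimate is affine, so its mean is its value at the family \<mu> of mean outcomes.
  An average of equal means is the true moment, and symmetry of the weights turns the result into
  the symmetric form of \<open>true_bound\<close>.\<close>

lemma estimator_mean:
  "estimator_const P + (\<Sum>i\<in>copies P. estimator_coeff P i * (\<integral>x. x \<partial>copy_law P E1 E2 \<rho> i)) =
    true_bound P E1 E2 \<rho>"
proof -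
  let ?N = "2 * modes P"
  let ?x = "displacement P"
  define w where "w = (\<lambda>l k. weight_mat P $$ (l, k))"
  define g where "g = (\<lambda>l. \<integral>x. x \<partial>born_law (modes P) (E1 l) \<rho>)"
  define G where "G = (\<lambda>l k. \<integral>x. x \<partial>born_law (modes P) (E2 l k) \<rho>)"
  \<comment> \<open>Defined for all names of copies, also those outside \<open>copies P\<close>, so
    \<open>Gamma_est P \<mu>\<close> is the complete matrix of second moments.\<close>
  define \<mu> where "\<mu> = (\<lambda>i. \<integral>x. x \<partial>copy_law P E1 E2 \<rho> i)"
  have sym: "w l k = w k l" if "l < ?N" "k < ?N" for l k
    using weight_sym[OF valid] that by (simp add: w_def)
  have \<gamma>: "gamma_est P \<mu> $ l = g l" if "l < ?N" for l
    using that C1_props(1)[OF valid] by (simp add: gamma_est_def \<mu>_def copy_law_def g_def)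
  have \<Gamma>: "Gamma_est P \<mu> $$ (k, l) = G l k" if "l < ?N" "k < ?N" for l k
  proof -
    have "Gamma_est P \<mu> $$ (k, l) = G (min k l) (max k l)"
      using that C2_props(1)[OF valid] by (simp add: Gamma_est_def \<mu>_def copy_law_def G_def)
    then show ?thesis
      using second_moment_sym[of l k] that by (auto simp: min_def max_def G_def)
  qed
  have car: "Gamma_est P \<mu> \<in> carrier_mat ?N ?N" by (simp add: Gamma_est_def)
  have "estimator_const P + (\<Sum>i\<in>copies P. estimator_coeff P i * \<mu> i) =
      1 + real (modes P) / 2 - (\<Sum>l<?N. \<Sum>k<?N. w l k * (G l k - (2 * g k - ?x $ k) * ?x $ l))"
    unfolding estimator_linear[OF valid, symmetric] fidelity_bound_expand[OF valid car]
    by (simp add: \<gamma> \<Gamma> w_def)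
  also have "(\<Sum>l<?N. \<Sum>k<?N. w l k * (G l k - (2 * g k - ?x $ k) * ?x $ l)) =
      (\<Sum>l<?N. \<Sum>k<?N. w l k * (G l k - ?x $ l * g k + ?x $ l * ?x $ k)) - (\<Sum>l<?N. \<Sum>k<?N. w l k * (?x $ l * g k))"
    unfolding sum_subtractf[symmetric] by (intro sum.cong refl) (simp add: algebra_simps)
  also have "(\<Sum>l<?N. \<Sum>k<?N. w l k * (?x $ l * g k)) = (\<Sum>l<?N. \<Sum>k<?N. w l k * (?x $ k * g l))"
    by (subst sum.swap) (intro sum.cong refl, simp add: sym)
  also have "(\<Sum>l<?N. \<Sum>k<?N. w l k * (G l k - ?x $ l * g k + ?x $ l * ?x $ k)) - (\<Sum>l<?N. \<Sum>k<?N. w l k * (?x $ k * g l)) =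
      (\<Sum>l<?N. \<Sum>k<?N. w l k * (G l k - ?x $ k * g l - ?x $ l * g k + ?x $ l * ?x $ k))"
    unfolding sum_subtractf[symmetric] by (intro sum.cong refl) (simp add: algebra_simps)
  finally show ?thesis
    by (simp add: \<mu>_def true_bound_def Let_def w_def g_def G_def)
qed

lemma failure_bound: "(err P)\<^sup>2 * log_conf P / ((err P)\<^sup>2 * log_conf P + (err P)\<^sup>2) \<le> fail_prob P"
proof -
  let ?e = "(err P)\<^sup>2"
  have e: "0 < ?e" using valid by (simp add: valid_config_def)
  have l: "0 < log_conf P" by (rule log_conf_pos[OF valid])
  have "?e * log_conf P / (?e * log_conf P + ?e) = log_conf P / (log_conf P + 1)"
    using e mult_divide_mult_cancel_left[of ?e "log_conf P" "log_conf P + 1"] by (simp add: distrib_left)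
  also have "\<dots> \<le> fail_prob P"
    using log_conf_bound[OF valid] l by (simp add: divide_simps algebra_simps)
  finally show ?thesis .
qed

text \<open>The sign s selects the tail: s = 1 is an estimate that is too large and leads to false
  acceptance, s = -1 one that is too small and leads to false rejection.\<close>

lemma estimator_deviation:
  assumes s: "s = 1 \<or> s = -1"
  shows "measure (outcome_space P E1 E2 \<rho>) {\<omega> \<in> space (outcome_space P E1 E2 \<rho>).
    err P \<le> s * (fidelity_bound P (gamma_est P \<omega>) (Gamma_est P \<omega>) - true_bound P E1 E2 \<rho>)} \<le> fail_prob P"
proof -
  let ?T = "(err P)\<^sup>2 * log_conf P"
  let ?v = "\<lambda>i. case i of First _ _ \<Rightarrow> (sigma1 P)\<^sup>2 | Second _ _ _ \<Rightarrow> (sigma2 P)\<^sup>2"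
  have e: "0 < err P" using valid by (simp add: valid_config_def)
  have eq: "s * (fidelity_bound P (gamma_est P \<omega>) (Gamma_est P \<omega>) - true_bound P E1 E2 \<rho>) =
      (\<Sum>i\<in>copies P. (s * estimator_coeff P i) * \<omega> i)
      - (\<Sum>i\<in>copies P. (s * estimator_coeff P i) * (\<integral>x. x \<partial>copy_law P E1 E2 \<rho> i))" for \<omega>
    unfolding estimator_linear[OF valid] estimator_mean[symmetric]
    by (simp add: algebra_simps sum_distrib_left)
  have "(\<Sum>i\<in>copies P. (s * estimator_coeff P i)\<^sup>2 * ?v i) \<le> ?T"
    using estimator_variance[OF valid] s by (auto simp: power_mult_distrib)
  then have "measure (outcome_space P E1 E2 \<rho>) {\<omega> \<in> space (outcome_space P E1 E2 \<rho>).
      err P \<le> s * (fidelity_bound P (gamma_est P \<omega>) (Gamma_est P \<omega>) - true_bound P E1 E2 \<rho>)} \<le> ?T / (?T + (err P)\<^sup>2)"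
    unfolding eq outcome_space_eq
    by (intro estimator_tail[where v = ?v, OF finite_copies copy_law_props(1) copy_law_props(2)
          copy_law_props(3) _ e])
  also have "\<dots> \<le> fail_prob P" by (rule failure_bound)
  finally show ?thesis .
qed

lemma outcome_prob_space: "prob_space (outcome_space P E1 E2 \<rho>)"
  unfolding outcome_space_eq by (intro prob_space_PiM copy_law_props)

lemma estimator_measurable:
  "(\<lambda>\<omega>. fidelity_bound P (gamma_est P \<omega>) (Gamma_est P \<omega>)) \<in> borel_measurable (outcome_space P E1 E2 \<rho>)"
proof -
  have "(\<lambda>\<omega>. \<omega> i) \<in> borel_measurable (outcome_space P E1 E2 \<rho>)" if "i \<in> copies P" for i
    using measurable_component_singleton[OF that, of "copy_law P E1 E2 \<rho>"]
      measurable_cong_sets[OF refl copy_law_props(2)[OF that]] by (auto simp: outcome_space_eq)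
  then show ?thesis unfolding estimator_linear[OF valid] by measurable
qed

lemma reject_event: "{\<omega> \<in> space (outcome_space P E1 E2 \<rho>). rejects P \<omega>} \<in> sets (outcome_space P E1 E2 \<rho>)"
  unfolding rejects_def using estimator_measurable by measurable

lemma deviation_event:
  "{\<omega> \<in> space (outcome_space P E1 E2 \<rho>).
    err P \<le> s * (fidelity_bound P (gamma_est P \<omega>) (Gamma_est P \<omega>) - true_bound P E1 E2 \<rho>)}
    \<in> sets (outcome_space P E1 E2 \<rho>)"
  using estimator_measurable by measurable

lemma accept_prob_eq: "accept_prob P E1 E2 \<rho> = 1 - reject_prob P E1 E2 \<rho>"
proof -
  interpret prob_space "outcome_space P E1 E2 \<rho>" by (rule outcome_prob_space)
  show ?thesis
    using prob_neg[of "rejects P"] reject_event by (simp add: accept_prob_def reject_prob_def)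
qed

lemma reject_prob_ge:
  assumes "true_bound P E1 E2 \<rho> < threshold P"
  shows "1 - fail_prob P \<le> reject_prob P E1 E2 \<rho>"
proof -
  interpret prob_space "outcome_space P E1 E2 \<rho>" by (rule outcome_prob_space)
  \<comment> \<open>Acceptance means an estimate of at least \<open>threshold P + err P\<close>,
    which exceeds the true bound by at least \<open>err P\<close>.\<close>
  have "accept_prob P E1 E2 \<rho> \<le> fail_prob P"
    unfolding accept_prob_def
    by (rule order_trans[OF finite_measure_mono[OF _ deviation_event[of 1]] estimator_deviation])
      (use assms in \<open>auto simp: rejects_def\<close>)
  then show ?thesis by (simp add: accept_prob_eq)
qed

lemma accept_prob_ge:
  assumes "true_bound P E1 E2 \<rho> = 1"
  shows "1 - fail_prob P \<le> accept_prob P E1 E2 \<rho>"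
proof -
  interpret prob_space "outcome_space P E1 E2 \<rho>" by (rule outcome_prob_space)
  \<comment> \<open>In the form \<open>threshold P + err P \<le> 1 - err P\<close>: rejection
    requires the estimate to fall more than \<open>err P\<close> below the true bound 1.\<close>
  have "2 * err P \<le> 1 - threshold P" using valid by (simp add: valid_config_def)
  then have "reject_prob P E1 E2 \<rho> \<le> fail_prob P"
    unfolding reject_prob_def
    by (intro order_trans[OF finite_measure_mono[OF _ deviation_event[of "-1"]] estimator_deviation])
      (use assms in \<open>auto simp: rejects_def\<close>)
  then show ?thesis by (simp add: accept_prob_eq)
qed

end

lemma test_certifies:
  assumes valid: "valid_config P"
    and G: "gaussian_unitary (modes P) U S (displacement P)"
    and eu: "euler_decomposition (modes P) S (orth P) (squeezing P)"
    and E: "quadrature_measurements (modes P) E1 E2"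
  shows "certification_test (modes P) (preparations P E1 E2) (reject_prob P E1 E2) (accept_prob P E1 E2)
    (ketbra (U vacuum) (U vacuum)) (threshold P) (fail_prob P)"
  unfolding certification_test_def
proof (intro conjI ballI impI)
  fix \<rho> assume \<rho>: "\<rho> \<in> preparations P E1 E2"
    and F: "fidelity (modes P) (ketbra (U vacuum) (U vacuum)) \<rho> < threshold P"
  show "1 - fail_prob P \<le> reject_prob P E1 E2 \<rho>"
    using true_bound_le_fidelity[OF G eu E \<rho>] F by (intro reject_prob_ge[OF valid E \<rho>]) simp
next
  assume \<rho>: "ketbra (U vacuum) (U vacuum) \<in> preparations P E1 E2"
  show "1 - fail_prob P \<le> accept_prob P E1 E2 (ketbra (U vacuum) (U vacuum))"
    by (rule accept_prob_ge[OF valid E \<rho> true_bound_target[OF G eu E \<rho>]])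
qed

section \<open>The number of copies\<close>

lemma create2_eq:
  "create 0 (create 0 v) = (\<lambda>n. 1 * (sym_product 0 0 v n - sym_product 1 1 v n) + (- 2 * \<i>) * sym_product 0 1 v n)"
proof -
  have q: "create 0 \<psi> = (\<lambda>n. 1 * quadrature 0 \<psi> n + (- \<i>) * quadrature 1 \<psi> n)" for \<psi>
    using create_quadrature[of 0 \<psi>] by simp
  show ?thesis
    unfolding q wave_linearD[OF wave_linear_quadrature]
    by (intro ext) (simp add: sym_product_def field_simps)
qed

lemma annihilate2_eq:
  "annihilate 0 (annihilate 0 v) = (\<lambda>n. 1 * (sym_product 0 0 v n - sym_product 1 1 v n) + (2 * \<i>) * sym_product 0 1 v n)"
proof -
  have q: "annihilate 0 \<psi> = (\<lambda>n. 1 * quadrature 0 \<psi> n + \<i> * quadrature 1 \<psi> n)" for \<psi>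
    using annihilate_quadrature[of 0 \<psi>] by simp
  show ?thesis
    unfolding q wave_linearD[OF wave_linear_quadrature]
    by (intro ext) (simp add: sym_product_def field_simps)
qed

lemma nsq_add_le:
  assumes "\<psi> \<in> fock m" "\<phi> \<in> fock m"
  shows "nsq (\<lambda>n. \<psi> n + \<phi> n) \<le> 2 * nsq \<psi> + 2 * nsq \<phi>"
  using nsq_add[OF assms] nsq_diff[OF assms] nsq_nonneg[of "\<lambda>n. \<psi> n - \<phi> n"] by simp

text \<open>The commutator \<open>[a\<^sup>2, a\<^sup>\<dagger>\<^sup>2] = 4 n + 2\<close> prevents the variances of \<open>q\<^sup>2\<close>, \<open>p\<^sup>2\<close> and
  \<open>(q p + p q) / 2\<close> from being small simultaneously.\<close>

lemma quadratic_uncertainty: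
  assumes v: "v \<in> fock m"
    and A: "sym_product 0 0 v \<in> fock m" "sym_product 1 1 v \<in> fock m" "sym_product 0 1 v \<in> fock m"
    and real: "Im (braket v (sym_product 0 0 v)) = 0" "Im (braket v (sym_product 1 1 v)) = 0"
      "Im (braket v (sym_product 0 1 v)) = 0"
  shows "2 * nsq v \<le> 4 * nsq (\<lambda>n. sym_product 0 0 v n - of_real c0 * v n)
    + 4 * nsq (\<lambda>n. sym_product 1 1 v n - of_real c1 * v n)
    + 8 * nsq (\<lambda>n. sym_product 0 1 v n - of_real c2 * v n)"
proof -
  let ?A = "create 0 (create 0 v)" and ?B = "annihilate 0 (annihilate 0 v)"
  let ?D = "\<lambda>n. sym_product 0 0 v n - sym_product 1 1 v n"
  have D: "?D \<in> fock m" using A by (intro fock_diff)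
  have f: "?A \<in> fock m" "?B \<in> fock m"
    unfolding create2_eq annihilate2_eq using D A(3) by (intro fock_lincomb; simp)+
  \<comment> \<open>If the three constants are means of a normalised v, then z is the mean of
    \<open>a\<^sup>2\<close>. Since the forms of \<open>a\<^sup>2\<close> and
    \<open>a\<^sup>\<dagger>\<^sup>2\<close> at v are conjugate, subtracting z and its conjugate
    changes the two norms equally, so the gap of \<open>ladder_gap\<close> survives for arbitrary
    constants.\<close>
  define z where "z = Complex (c0 - c1) (2 * c2)"
  have AB: "braket v ?B = cnj (braket v ?A)"
    unfolding create2_eq annihilate2_eq braket_lincomb_right[OF v D A(3)] braket_diff_right[OF v A(1,2)]
    using real by (simp add: complex_eq_iff)
  have zA: "(\<lambda>n. cnj z * v n) \<in> fock m" "(\<lambda>n. z * v n) \<in> fock m" using fock_scale[OF v] by blast+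
  have "braket ?A (\<lambda>n. cnj z * v n) = cnj (braket ?B (\<lambda>n. z * v n))"
    using AB by (simp add: braket_scale_right) (metis AB braket_cnj complex_cnj_cnj)
  then have "Re (braket ?A (\<lambda>n. cnj z * v n)) = Re (braket ?B (\<lambda>n. z * v n))" by simp
  then have "nsq (\<lambda>n. ?A n - cnj z * v n) - nsq (\<lambda>n. ?B n - z * v n) = nsq ?A - nsq ?B"
    by (simp add: nsq_diff[OF f(1) zA(1)] nsq_diff[OF f(2) zA(2)] nsq_scale)
  then have "2 * nsq v \<le> nsq (\<lambda>n. ?A n - cnj z * v n)"
    using ladder_gap[OF v f(2,1)] nsq_nonneg[of "\<lambda>n. ?B n - z * v n"] by simp
  also have "(\<lambda>n. ?A n - cnj z * v n) = (\<lambda>n. ((sym_product 0 0 v n - of_real c0 * v n)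
      + (- 1) * (sym_product 1 1 v n - of_real c1 * v n)) + (- 2 * \<i>) * (sym_product 0 1 v n - of_real c2 * v n))"
  proof -
    have z: "cnj z = of_real c0 - of_real c1 - 2 * \<i> * of_real c2" by (simp add: z_def complex_eq_iff)
    show ?thesis unfolding create2_eq z by (simp add: algebra_simps)
  qed
  \<comment> \<open>Origin of the coefficients: two successive splittings give 2 * 2 = 4 for the
    squares, and the factor of modulus 2 in front of the mixed product gives 2 * 4 = 8.\<close>
  also have "nsq \<dots> \<le> 2 * nsq (\<lambda>n. (sym_product 0 0 v n - of_real c0 * v n)
      + (- 1) * (sym_product 1 1 v n - of_real c1 * v n))
      + 2 * nsq (\<lambda>n. (- 2 * \<i>) * (sym_product 0 1 v n - of_real c2 * v n))"
    using A v by (intro nsq_add_le[of _ m] fock_add fock_scale fock_diff)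
  also have "nsq (\<lambda>n. (sym_product 0 0 v n - of_real c0 * v n)
      + (- 1) * (sym_product 1 1 v n - of_real c1 * v n)) \<le>
      2 * nsq (\<lambda>n. sym_product 0 0 v n - of_real c0 * v n)
      + 2 * nsq (\<lambda>n. (- 1) * (sym_product 1 1 v n - of_real c1 * v n))"
    using A v by (intro nsq_add_le[of _ m] fock_scale fock_diff)
  finally show ?thesis unfolding nsq_scale by (simp add: norm_mult)
qed

text \<open>The uncertainty relation for mode 0, centred for every component at the means of the
  mixture, sums over the components to \<open>2 \<le> 4 * V 0 0 + 4 * V 1 1 + 8 * V 0 1\<close>. The
  right-hand side is at most \<open>16 * (sigma2 P)\<^sup>2\<close>. A single preparation is
  enough.\<close>

lemma sigma2_lower_bound:
  assumes valid: "valid_config P" and E: "quadrature_measurements (modes P) E1 E2"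
    and \<rho>: "\<rho> \<in> preparations P E1 E2"
  shows "1 \<le> 8 * (sigma2 P)\<^sup>2"
proof -
  let ?m = "modes P"
  have m: "(0 :: nat) < 2 * ?m" "(1 :: nat) < 2 * ?m" using modes_pos[OF valid] by auto
  obtain v where v: "pure_decomposition ?m \<rho> v" "trace_op ?m \<rho> = 1" "positive_op ?m \<rho>"
    using prep_density[OF valid E \<rho>] by (rule density_decomposition)
  have vf: "v k \<in> fock ?m" for k using v(1) by (simp add: pure_decomposition_def)
  define c where "c l l' = (\<integral>x. x \<partial>born_law ?m (E2 l l') \<rho>)" for l l'
  define I where "I l l' k = (\<integral>x. (x - c l l')\<^sup>2 \<partial>pure_law (E2 l l') (v k))" for l l' k
  define V where "V l l' = (\<integral>x. (x - c l l')\<^sup>2 \<partial>born_law ?m (E2 l l') \<rho>)" for l l'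
  have var: "V l l' \<le> (sigma2 P)\<^sup>2" "I l l' sums V l l'"
    and A: "sym_product l l' (v k) \<in> fock ?m" "Im (braket (v k) (sym_product l l' (v k))) = 0"
    and le: "nsq (\<lambda>n. sym_product l l' (v k) n - of_real (c l l') * v k n) \<le> I l l' k"
    if l: "l < 2 * ?m" "l' < 2 * ?m" for l l' k
  proof -
    note S = prep_spectral(2)[OF valid E \<rho> l]
    have va: "variance_at_most (born_law ?m (E2 l l') \<rho>) ((sigma2 P)\<^sup>2)"
      using prep_variance(2)[OF valid E \<rho> l] .
    then have i: "integrable (born_law ?m (E2 l l') \<rho>) (\<lambda>x. x\<^sup>2)" by (simp add: variance_at_most_def)
    note mm = mixture_mean[OF v S i]
    show "V l l' \<le> (sigma2 P)\<^sup>2" using va by (simp add: variance_at_most_def V_def c_def)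
    show "I l l' sums V l l'" unfolding I_def V_def by (rule mm(3))
    show "sym_product l l' (v k) \<in> fock ?m" "Im (braket (v k) (sym_product l l' (v k))) = 0"
      using mm(1)[of k] spectral_measure_mean[OF S mm(1)] by (simp_all add: op_domain_def)
    show "nsq (\<lambda>n. sym_product l l' (v k) n - of_real (c l l') * v k n) \<le> I l l' k"
      unfolding I_def by (rule spectral_variance[OF S wave_linear_sym_product _ mm(1)])
        (intro finite_fock_fock sym_product_finite_fock l)
  qed
  have "2 * nsq (v k) \<le> 4 * I 0 0 k + 4 * I 1 1 k + 8 * I 0 1 k" for k
    using quadratic_uncertainty[OF vf A(1)[OF m(1,1)] A(1)[OF m(2,2)] A(1)[OF m] A(2)[OF m(1,1)]
        A(2)[OF m(2,2)] A(2)[OF m], of k "c 0 0" "c 1 1" "c 0 1"]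
      le[OF m(1,1), of k] le[OF m(2,2), of k] le[OF m, of k] by linarith
  moreover have "(\<lambda>k. 2 * nsq (v k)) sums (2 * 1)"
    by (intro sums_mult pure_decomposition_weight(1)[OF v(1,2)])
  moreover have "(\<lambda>k. 4 * I 0 0 k + 4 * I 1 1 k + 8 * I 0 1 k) sums (4 * V 0 0 + 4 * V 1 1 + 8 * V 0 1)"
    by (intro sums_add sums_mult var(2) m)
  ultimately have "2 * 1 \<le> 4 * V 0 0 + 4 * V 1 1 + 8 * V 0 1" by (rule sums_le)
  then show ?thesis using var(1)[OF m(1,1)] var(1)[OF m(2,2)] var(1)[OF m] by linarith
qed

text \<open>A mode couples at most 2 d rows, hence supplies at most \<open>(2 * d)\<^sup>2\<close>
  index pairs; over all modes this is \<open>4 * m * d\<^sup>2\<close>. There are at most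
  \<open>4 * m\<^sup>2\<close> pairs altogether, and the smaller of the two numbers is 2 m
  \<kappa>.\<close>

lemma card_measured:
  assumes valid: "valid_config P"
  shows "card (measured P) \<le> 2 * modes P * kappa P"
proof -
  let ?m = "modes P" and ?d = "mode_range P"
  define supp where "supp j = {i. i < 2 * ?m \<and> \<not> (orth P $$ (i, 2 * j) = 0 \<and> orth P $$ (i, 2 * j + 1) = 0)}" for j
  have supp: "card (supp j) \<le> 2 * ?d" if "j < ?m" for j
  proof -
    let ?Z = "{i. i < 2 * ?m \<and> orth P $$ (i, 2 * j) = 0 \<and> orth P $$ (i, 2 * j + 1) = 0}"
    have "supp j = {..<2 * ?m} - ?Z" by (auto simp: supp_def)
    moreover have "card ({..<2 * ?m} - ?Z) = card {..<2 * ?m} - card ?Z"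
      by (intro card_Diff_subset) auto
    moreover have "2 * (?m - ?d) \<le> card ?Z" "?d \<le> ?m"
      using valid that by (auto simp: valid_config_def has_mode_range_def)
    ultimately show ?thesis by simp
  qed
  have fin: "finite (supp j)" for j by (simp add: supp_def)
  have "measured P \<subseteq> (\<Union>j<?m. supp j \<times> supp j)"
  proof
    fix q assume "q \<in> measured P"
    then obtain a b where q: "q = (a, b)" "a < 2 * ?m" "b < 2 * ?m" "weight_mat P $$ (a, b) \<noteq> 0"
      by (auto simp: measured_def)
    then have "(\<Sum>i<2 * ?m. orth P $$ (a, i) * inverse ((squeeze_entry (squeezing P) i)\<^sup>2) * orth P $$ (b, i)) \<noteq> 0"
      using weight_entry[OF valid q(2,3)] by simp
    then obtain i where i: "i < 2 * ?m" "orth P $$ (a, i) \<noteq> 0" "orth P $$ (b, i) \<noteq> 0"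
      by (metis (no_types, lifting) lessThan_iff mult_eq_0_iff sum.neutral)
    have "i = 2 * (i div 2) \<or> i = 2 * (i div 2) + 1" by linarith
    then have "a \<in> supp (i div 2)" "b \<in> supp (i div 2)"
      using i q(2,3) by (auto simp: supp_def)
    moreover have "i div 2 < ?m" using i by simp
    ultimately show "q \<in> (\<Union>j<?m. supp j \<times> supp j)" using q(1) by auto
  qed
  then have "card (measured P) \<le> card (\<Union>j<?m. supp j \<times> supp j)"
    using fin by (intro card_mono) auto
  also have "\<dots> \<le> (\<Sum>j<?m. card (supp j \<times> supp j))" by (rule card_UN_le) simp
  also have "\<dots> \<le> (\<Sum>j<?m. (2 * ?d) * (2 * ?d))"
    unfolding card_cartesian_product by (intro sum_mono mult_mono supp) auto
  finally have 1: "card (measured P) \<le> 4 * ?m * ?d\<^sup>2" by (simp add: power2_eq_square)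
  have "card (measured P) \<le> card ({..<2 * ?m} \<times> {..<2 * ?m})"
    by (intro card_mono) (auto simp: measured_def)
  then have 2: "card (measured P) \<le> 4 * ?m * ?m" by simp
  show ?thesis unfolding kappa_def using 1 2 by (simp add: min_def)
qed

lemma card_copies:
  "real (card (copies P)) = 2 * real (modes P) * real (C1 P) + real (card (measured P)) * real (C2 P)"
proof -
  have "real (card (copies P)) = (\<Sum>i\<in>copies P. 1)" by simp
  also have "\<dots> = 2 * real (modes P) * real (C1 P) + real (card (measured P)) * real (C2 P)"
    unfolding sum_copies by simp
  finally show ?thesis .
qed

text \<open>The unrounded copy numbers give 192 = 64 * 3 times the two summands u and y of
  \<open>copy_bound\<close>, where 2 m + 1 \<le> 3 m and 2 \<kappa> m + 1 \<le> 3 \<kappa> m are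
  used. Rounding adds at most one copy per measured observable, and these are charged to y.\<close>

lemma copies_bound:
  assumes valid: "valid_config P" and B: "(err P)\<^sup>2 * log_conf P \<le> B"
    and \<sigma>: "1 \<le> 8 * (sigma2 P)\<^sup>2"
  shows "real (card (copies P)) \<le> (192 + 24 * B) * copy_bound P"
proof -
  define m k T s X a b where "m = real (modes P)" and "k = real (kappa P)" and "T = (err P)\<^sup>2 * log_conf P"
    and "s = s_max P ^ 4" and "X = displacement_norm_sq P" and "a = (sigma1 P)\<^sup>2" and "b = (sigma2 P)\<^sup>2"
  have m: "1 \<le> m" using modes_pos[OF valid] by (simp add: m_def)
  have k: "2 \<le> k" using kappa_ge_2[OF valid] by (simp add: k_def)
  have T: "0 < T" using err_log_pos[OF valid] by (simp add: T_def)
  have s: "1 \<le> s" using s_max_ge_1[OF valid] by (simp add: s_def)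
  have X: "0 \<le> X" using displacement_norm_nonneg[OF valid] by (simp add: X_def)
  have ab: "0 \<le> a" "0 \<le> b" "1 \<le> 8 * b" using \<sigma> by (auto simp: a_def b_def)
  define u where "u = s * (2 * a * X * m ^ 3) / T"
  define y where "y = s * (b * k ^ 3 * m ^ 4) / T"
  have cb: "copy_bound P = u + y"
    by (simp add: copy_bound_def u_def y_def m_def k_def T_def s_def X_def a_def b_def distrib_left add_divide_distrib)
  have u0: "0 \<le> u" unfolding u_def using m T s X ab by simp
  have "2 * m * C1_bound P = 64 * (2 * m + 1) * (u / m)"
    using m by (simp add: C1_bound_def[OF valid] u_def m_def[symmetric] s_def X_def a_def T_def power3_eq_cube field_simps)
  also have "\<dots> \<le> 64 * (3 * m) * (u / m)"
    using m u0 by (intro mult_right_mono) auto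
  finally have c1: "2 * m * C1_bound P \<le> 192 * u" using m by simp
  have y0: "0 \<le> y" unfolding y_def using m k T s ab by simp
  have "2 * m * k * C2_bound P = 64 * (2 * k * m + 1) * (y / (k * m))"
    using m k by (simp add: C2_bound_def[OF valid] y_def m_def[symmetric] k_def[symmetric] s_def b_def T_def
        power3_eq_cube power2_eq_square power4_eq_xxxx field_simps)
  also have "\<dots> \<le> 64 * (3 * (k * m)) * (y / (k * m))"
  proof (rule mult_right_mono)
    have "1 * 1 \<le> k * m" using m k by (intro mult_mono) auto
    then show "64 * (2 * k * m + 1) \<le> 64 * (3 * (k * m))" by simp
    show "0 \<le> y / (k * m)" using y0 m k by simp
  qed
  finally have c2: "2 * m * k * C2_bound P \<le> 192 * y" using m k by simp
  \<comment> \<open>Both \<open>B\<close> and \<open>8 * b \<ge> 1\<close> enter here: they bound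
    the number of observables by a multiple of the second summand, which remains positive even for
    zero displacement.\<close>
  have "m * k * T \<le> m * k * B" using B m k by (intro mult_left_mono) (auto simp: T_def)
  also have "\<dots> \<le> m * k * B * (8 * b * s * k\<^sup>2 * m ^ 3)"
  proof -
    have "1 * 1 * 1 * 1 \<le> (8 * b) * s * k\<^sup>2 * m ^ 3"
      using m k s ab by (intro mult_mono) auto
    moreover have "0 \<le> m * k * B" using m k B T by (auto simp: T_def)
    ultimately show ?thesis using mult_left_mono[of 1 "8 * b * s * k\<^sup>2 * m ^ 3" "m * k * B"] by simp
  qed
  also have "\<dots> = 8 * B * y * T"
    using T by (simp add: y_def power3_eq_cube power2_eq_square power4_eq_xxxx)
  finally have mk: "m * k \<le> 8 * B * y" using T by simp
  have "real (card (measured P)) \<le> 2 * m * k"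
    using card_measured[OF valid] unfolding m_def k_def by (metis of_nat_le_iff of_nat_mult of_nat_numeral)
  then have "real (card (copies P)) \<le> 2 * m * (C1_bound P + 1) + 2 * m * k * (C2_bound P + 1)"
    unfolding card_copies m_def[symmetric] using C1_props(3)[OF valid] C2_props(3)[OF valid] m k
    by (intro add_mono mult_mono) auto
  also have "\<dots> = 2 * m * C1_bound P + 2 * m * k * C2_bound P + (2 * m + 2 * (m * k))"
    by (simp add: algebra_simps)
  also have "\<dots> \<le> 192 * u + 192 * y + 3 * (m * k)"
  proof -
    \<comment> \<open>As \<kappa> \<ge> 2, the 2 m roundings for the single quadratures are at most
      m \<kappa>; together with 2 m \<kappa> for the products they make 3 m \<kappa>.\<close>
    have "m * 2 \<le> m * k" using k m by (intro mult_left_mono) auto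
    then show ?thesis using c1 c2 by linarith
  qed
  also have "\<dots> \<le> 192 * u + 192 * y + 24 * B * y" using mk by linarith
  also have "\<dots> \<le> (192 + 24 * B) * (u + y)"
    using u0 B T by (simp add: algebra_simps T_def)
  finally show ?thesis by (simp add: cb)
qed

text \<open>For fixed remaining parameters \<open>copy_bound\<close> tends to 0 as
  \<open>(err P)\<^sup>2 * log_conf P\<close> grows, while every quadrature is measured on at least
  one copy. The constant is therefore uniform on each set where this product is at most
  \<open>B\<close>, and depends on \<open>B\<close>. The existence of a preparation supplies the
  lower bound on \<open>sigma2 P\<close>.\<close>

theorem theorem2:
  shows
    "(\<forall>P U S E1 E2.
        valid_config P \<longrightarrow>
        gaussian_unitary (modes P) U S (displacement P) \<longrightarrow>
        euler_decomposition (modes P) S (orth P) (squeezing P) \<longrightarrow>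
        quadrature_measurements (modes P) E1 E2 \<longrightarrow>
        certification_test (modes P) (preparations P E1 E2)
          (reject_prob P E1 E2) (accept_prob P E1 E2)
          (ketbra (U vacuum) (U vacuum)) (threshold P) (fail_prob P))
     \<and>
     (\<forall>B. (\<lambda>P. real (card (copies P)))
        \<in> O[principal {P. valid_config P \<and> (err P)\<^sup>2 * log_conf P \<le> B \<and>
              (\<exists>E1 E2. quadrature_measurements (modes P) E1 E2 \<and> preparations P E1 E2 \<noteq> {})}](copy_bound))"
proof (intro conjI allI impI)
  fix B :: real
  show "(\<lambda>P. real (card (copies P)))
    \<in> O[principal {P. valid_config P \<and> (err P)\<^sup>2 * log_conf P \<le> B \<and>
          (\<exists>E1 E2. quadrature_measurements (modes P) E1 E2 \<and> preparations P E1 E2 \<noteq> {})}](copy_bound)"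
  proof (rule bigoI[of _ "192 + 24 * B"], unfold eventually_principal, intro ballI)
    fix P assume "P \<in> {P. valid_config P \<and> (err P)\<^sup>2 * log_conf P \<le> B \<and>
      (\<exists>E1 E2. quadrature_measurements (modes P) E1 E2 \<and> preparations P E1 E2 \<noteq> {})}"
    then obtain E1 E2 \<rho> where P: "valid_config P" "(err P)\<^sup>2 * log_conf P \<le> B"
      and E: "quadrature_measurements (modes P) E1 E2" "\<rho> \<in> preparations P E1 E2" by auto
    have B: "0 \<le> 192 + 24 * B" using err_log_pos[OF P(1)] P(2) by linarith
    have "real (card (copies P)) \<le> (192 + 24 * B) * copy_bound P"
      by (rule copies_bound[OF P sigma2_lower_bound[OF P(1) E]])
    also have "\<dots> \<le> (192 + 24 * B) * norm (copy_bound P)" using B by (intro mult_left_mono) auto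
    finally show "norm (real (card (copies P))) \<le> (192 + 24 * B) * norm (copy_bound P)" by simp
  qed
qed (rule test_certifies)

end
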